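(* Let $\mathcal S$ be a class of cohomologies on a category $\mathcal C$. The following are equivalent: (1) all $H\in\mathcal S$ are equivalent to one another; (2) every $H\in\mathcal S$ is a realisation of $U_{\mathcal S}$ along $r_H$; (3) for every $H\in\mathcal S$ the canonical functor $\mathcal A_{\mathcal S}(\mathcal C)\to\mathcal A(H)$ is an equivalence. Likewise, in the relative case, let $\mathcal S$ be a class of relative cohomologies on $\mathcal C^\square$. The following are equivalent: (1') all $H\in\mathcal S$ are $\partial$-equivalent to one another; (2') every $H\in\mathcal S$ is a realisation of $U_{\partial,\mathcal S}$ along $r_{\partial,H}$; (3') for every $H\in\mathcal S$ the canonical functor $\mathcal A_{\partial,\mathcal S}(\mathcal C)\to\mathcal A_\partial(H)$ is an equivalence.
   Context: Size issues are handled as usual by universes. $R$ is a fixed commutative ring; abelian categories and exact functors are $R$-linear. Cohomologies. A cohomology $H$ on $\mathcal C$ with values in an abelian category $\mathcal A$ is a family $\{H^i\}_{i\in\mathbb N}$ of contravariant functors $H^i:\mathcal C\to\mathcal A$. For an exact functor $G:\mathcal A\to\mathcal B$, the push-forward $G_*H$ is $\{G\circ H^i\}_i$. Relative cohomologies. $\mathcal C^\square$ is a category of pairs $(X,Y)$ with $X\in\mathcal C$ and $Y$ a (closed, distinguished) subobject of $X$, morphisms being morphisms of pairs. A relative cohomology on $\mathcal C^\square$ with values in $\mathcal A$ is a family of contravariant functors $H^i:\mathcal C^\square\to\mathcal A$, $i\in\mathbb N$, with boundary morphisms $\partial^i:H^i(Y,Z)\to H^{i+1}(X,Y)$ for all $(X,Y),(Y,Z)\in\mathcal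 C^\square$, natural in the triple $(X,Y,Z)$, such that $\cdots\to H^i(X,Y)\to H^i(X,Z)\to H^i(Y,Z)\xrightarrow{\partial^i}H^{i+1}(X,Y)\to\cdots$ is exact. Push-forward along exact functors is defined in the evident way. Universal theories (known to exist). The universal cohomology $U$ has values in an abelian category $\mathcal A(\mathcal C)$: for every cohomology $H$ with values in $\mathcal A$ there is an exact functor $F_H:\mathcal A(\mathcal C)\to\mathcal A$, unique up to isomorphism, with $H\cong (F_H)_*U$. Similarly the universal relative cohomology $U_\partial$ has values in $\mathcal A_\partial(\mathcal C)$, and every relative $H$ with values in $\mathcal A$ is $(F_H^\partial)_*U_\partial$ for an exact functor $F_H^\partial:\mathcal A_\partial(\mathcal C)\to\mathcal A$, unique up to isomorphism. Here $\mathrm{Ker}\,F$, for $F$ exact, is the Serre subcategory of objects sent to $0$. Set $\mathcal A(H):=\mathcal A(\mathcal C)/\mathrm{Ker}\,F_H$ and, for $H$ relative, $\mathcal A_\partial(H):=\mathcal A_\partial(\mathcal C)/\mathrm{Ker}\,F_H^\partial$ (Serre quotients). $H,H'$ are equivalent if there is an equivalence $\mathcal A(H)\cong\mathcal A(H')$ (under $\mathcal A(\mathcal C)$), i.e. $\mathrm{Ker}\,F_H=\mathrm{Ker}\,F_{H'}$; relative $H,H'$ are $\partial$-equivalent if $\mathcal A_\partial(H)\cong\mathcal A_\partial(H')$ under $\mathcal A_\partial(\mathcal C)$, i.e. $\mathrm{Ker}\,F_H^\partial=\mathrm{Ker}\,F_{H'}^\partial$. $H'$ is a realisation of $H$ along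 $G$ if $G$ is a faithful exact functor with $H'=G_*H$ (up to isomorphism). For a class $\mathcal S$ put $\mathcal I_{\mathcal S}:=\bigcap_{H\in\mathcal S}\mathrm{Ker}\,F_H$, $\mathcal A_{\mathcal S}(\mathcal C):=\mathcal A(\mathcal C)/\mathcal I_{\mathcal S}$, and let $U_{\mathcal S}$ be the push-forward of $U$ along the projection. For $H\in\mathcal S$ with values in $\mathcal A$, $F_H$ factors through an exact functor $r_H:\mathcal A_{\mathcal S}(\mathcal C)\to\mathcal A$ with $H=(r_H)_*U_{\mathcal S}$, and there is a canonical further quotient functor $\mathcal A_{\mathcal S}(\mathcal C)\to\mathcal A(H)$. Similarly, with $\mathcal I_{\partial,\mathcal S}:=\bigcap_{H\in\mathcal S}\mathrm{Ker}\,F_H^\partial$, define $\mathcal A_{\partial,\mathcal S}(\mathcal C):=\mathcal A_\partial(\mathcal C)/\mathcal I_{\partial,\mathcal S}$, $U_{\partial,\mathcal S}$, $r_{\partial,H}$ and $\mathcal A_{\partial,\mathcal S}(\mathcal C)\to\mathcal A_\partial(H)$. *)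

theory Defs
  imports "HOL-Algebra.Module"
begin

section \<open>Categories and functors\<close>

text \<open>A universe is a pair of HOL types (objects and arrows). \<open>g \<cdot> f\<close> is ``\<open>g\<close> after \<open>f\<close>''.\<close>

record ('o, 'm) category =
  Ob :: "'o set"
  Ar :: "'m set"
  src :: "'m \<Rightarrow> 'o"
  tgt :: "'m \<Rightarrow> 'o"
  ident :: "'o \<Rightarrow> 'm"
  cmp :: "'m \<Rightarrow> 'm \<Rightarrow> 'm"  (infixr \<open>\<cdot>\<index>\<close> 75)

definition Hom :: "('o, 'm, 'z) category_scheme \<Rightarrow> 'o \<Rightarrow> 'o \<Rightarrow> 'm set" where
  "Hom C X Y = {f \<in> Ar C. src C f = X \<and> tgt C f = Y}"

locale category =
  fixes C :: "('o, 'm, 'z) category_scheme" (structure)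
  assumes src_in_Ob: "f \<in> Ar C \<Longrightarrow> src C f \<in> Ob C"
    and tgt_in_Ob: "f \<in> Ar C \<Longrightarrow> tgt C f \<in> Ob C"
    and ident_in_Hom: "X \<in> Ob C \<Longrightarrow> ident C X \<in> Hom C X X"
    and cmp_in_Hom: "f \<in> Hom C X Y \<Longrightarrow> g \<in> Hom C Y Z \<Longrightarrow> g \<cdot> f \<in> Hom C X Z"
    and cmp_ident_right: "f \<in> Ar C \<Longrightarrow> f \<cdot> ident C (src C f) = f"
    and cmp_ident_left: "f \<in> Ar C \<Longrightarrow> ident C (tgt C f) \<cdot> f = f"
    and cmp_assoc: "f \<in> Hom C W X \<Longrightarrow> g \<in> Hom C X Y \<Longrightarrow> h \<in> Hom C Y Z
      \<Longrightarrow> (h \<cdot> g) \<cdot> f = h \<cdot> (g \<cdot> f)"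

definition opp :: "('o, 'm, 'z) category_scheme \<Rightarrow> ('o, 'm) category" where
  "opp C = \<lparr>Ob = Ob C, Ar = Ar C, src = tgt C, tgt = src C, ident = ident C,
            cmp = (\<lambda>g f. f \<cdot>\<^bsub>C\<^esub> g)\<rparr>"

definition is_mono :: "('o, 'm, 'z) category_scheme \<Rightarrow> 'm \<Rightarrow> bool" where
  "is_mono C m \<longleftrightarrow> m \<in> Ar C \<and>
     (\<forall>W. \<forall>f \<in> Hom C W (src C m). \<forall>g \<in> Hom C W (src C m). m \<cdot>\<^bsub>C\<^esub> f = m \<cdot>\<^bsub>C\<^esub> g \<longrightarrow> f = g)"

definition is_epi :: "('o, 'm, 'z) category_scheme \<Rightarrow> 'm \<Rightarrow> bool" where
  "is_epi C e \<longleftrightarrow> e \<in> Ar C \<and>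
     (\<forall>W. \<forall>f \<in> Hom C (tgt C e) W. \<forall>g \<in> Hom C (tgt C e) W. f \<cdot>\<^bsub>C\<^esub> e = g \<cdot>\<^bsub>C\<^esub> e \<longrightarrow> f = g)"

definition is_iso :: "('o, 'm, 'z) category_scheme \<Rightarrow> 'm \<Rightarrow> bool" where
  "is_iso C f \<longleftrightarrow> f \<in> Ar C \<and>
     (\<exists>g \<in> Hom C (tgt C f) (src C f).
        g \<cdot>\<^bsub>C\<^esub> f = ident C (src C f) \<and> f \<cdot>\<^bsub>C\<^esub> g = ident C (tgt C f))"

definition is_zero_object :: "('o, 'm, 'z) category_scheme \<Rightarrow> 'o \<Rightarrow> bool" where
  "is_zero_object C Z \<longleftrightarrow> Z \<in> Ob C \<and>
     (\<forall>X \<in> Ob C. (\<exists>!f. f \<in> Hom C X Z) \<and> (\<exists>!f. f \<in> Hom C Z X))"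

record ('o, 'm, 'p, 'n) cfunctor =
  fOb :: "'o \<Rightarrow> 'p"
  fAr :: "'m \<Rightarrow> 'n"

locale is_functor = A: category A + B: category B
  for A :: "('o, 'm, 'y) category_scheme" and B :: "('p, 'n, 'z) category_scheme"
    and F :: "('o, 'm, 'p, 'n) cfunctor" +
  assumes fOb_in_Ob: "X \<in> Ob A \<Longrightarrow> fOb F X \<in> Ob B"
    and fAr_in_Hom: "f \<in> Ar A \<Longrightarrow> fAr F f \<in> Hom B (fOb F (src A f)) (fOb F (tgt A f))"
    and fAr_ident: "X \<in> Ob A \<Longrightarrow> fAr F (ident A X) = ident B (fOb F X)"
    and fAr_cmp: "f \<in> Hom A X Y \<Longrightarrow> g \<in> Hom A Y Z
      \<Longrightarrow> fAr F (g \<cdot>\<^bsub>A\<^esub> f) = fAr F g \<cdot>\<^bsub>B\<^esub> fAr F f"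

definition id_functor :: "('o, 'm, 'o, 'm) cfunctor" where
  "id_functor = \<lparr>fOb = (\<lambda>X. X), fAr = (\<lambda>f. f)\<rparr>"

definition functor_comp ::
    "('p, 'n, 'q, 'k) cfunctor \<Rightarrow> ('o, 'm, 'p, 'n) cfunctor \<Rightarrow> ('o, 'm, 'q, 'k) cfunctor" where
  "functor_comp G F = \<lparr>fOb = fOb G \<circ> fOb F, fAr = fAr G \<circ> fAr F\<rparr>"

definition nat_iso ::
    "('o, 'm, 'y) category_scheme \<Rightarrow> ('p, 'n, 'z) category_scheme \<Rightarrow>
     ('o, 'm, 'p, 'n) cfunctor \<Rightarrow> ('o, 'm, 'p, 'n) cfunctor \<Rightarrow> ('o \<Rightarrow> 'n) \<Rightarrow> bool" where
  "nat_iso A B F G \<theta> \<longleftrightarrow>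
     (\<forall>X \<in> Ob A. \<theta> X \<in> Hom B (fOb F X) (fOb G X) \<and> is_iso B (\<theta> X)) \<and>
     (\<forall>f \<in> Ar A. \<theta> (tgt A f) \<cdot>\<^bsub>B\<^esub> fAr F f = fAr G f \<cdot>\<^bsub>B\<^esub> \<theta> (src A f))"

definition isomorphic_functors ::
    "('o, 'm, 'y) category_scheme \<Rightarrow> ('p, 'n, 'z) category_scheme \<Rightarrow>
     ('o, 'm, 'p, 'n) cfunctor \<Rightarrow> ('o, 'm, 'p, 'n) cfunctor \<Rightarrow> bool" where
  "isomorphic_functors A B F G \<longleftrightarrow> (\<exists>\<theta>. nat_iso A B F G \<theta>)"

definition is_faithful ::
    "('o, 'm, 'z) category_scheme \<Rightarrow> ('o, 'm, 'p, 'n) cfunctor \<Rightarrow> bool" where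
  "is_faithful A F \<longleftrightarrow>
     (\<forall>X \<in> Ob A. \<forall>Y \<in> Ob A. inj_on (fAr F) (Hom A X Y))"

section \<open>Linear and abelian categories, exact functors\<close>

record ('o, 'm, 'r) linear_cat = "('o, 'm) category" +
  hzero :: "'o \<Rightarrow> 'o \<Rightarrow> 'm"
  hadd :: "'m \<Rightarrow> 'm \<Rightarrow> 'm"
  hsmult :: "'r \<Rightarrow> 'm \<Rightarrow> 'm"

text \<open>The fields \<open>mult\<close> and \<open>one\<close> exist only because the library's module record extends the
  ring record; the locale \<^locale>\<open>module\<close> does not constrain them.\<close>

definition Hom_module :: "('o, 'm, 'r) linear_cat \<Rightarrow> 'o \<Rightarrow> 'o \<Rightarrow> ('r, 'm) module" where
  "Hom_module A X Y =
     \<lparr>carrier = Hom A X Y, mult = undefined, one = undefined,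
      zero = hzero A X Y, add = hadd A, smult = hsmult A\<rparr>"

locale linear_category = R: cring R + category A
  for R :: "('r, 'x) ring_scheme" and A :: "('o, 'm, 'r) linear_cat" (structure) +
  assumes module_Hom: "X \<in> Ob A \<Longrightarrow> Y \<in> Ob A \<Longrightarrow> module R (Hom_module A X Y)"
    and cmp_hadd_left: "f \<in> Hom A X Y \<Longrightarrow> g \<in> Hom A Y Z \<Longrightarrow> g' \<in> Hom A Y Z
      \<Longrightarrow> hadd A g g' \<cdot> f = hadd A (g \<cdot> f) (g' \<cdot> f)"
    and cmp_hadd_right: "f \<in> Hom A X Y \<Longrightarrow> f' \<in> Hom A X Y \<Longrightarrow> g \<in> Hom A Y Z
      \<Longrightarrow> g \<cdot> hadd A f f' = hadd A (g \<cdot> f) (g \<cdot> f')"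
    and cmp_hsmult_left: "a \<in> carrier R \<Longrightarrow> f \<in> Hom A X Y \<Longrightarrow> g \<in> Hom A Y Z
      \<Longrightarrow> hsmult A a g \<cdot> f = hsmult A a (g \<cdot> f)"
    and cmp_hsmult_right: "a \<in> carrier R \<Longrightarrow> f \<in> Hom A X Y \<Longrightarrow> g \<in> Hom A Y Z
      \<Longrightarrow> g \<cdot> hsmult A a f = hsmult A a (g \<cdot> f)"

definition is_kernel :: "('o, 'm, 'r) linear_cat \<Rightarrow> 'm \<Rightarrow> 'm \<Rightarrow> bool" where
  "is_kernel A k f \<longleftrightarrow> f \<in> Ar A \<and> k \<in> Ar A \<and> tgt A k = src A f \<and>
     f \<cdot>\<^bsub>A\<^esub> k = hzero A (src A k) (tgt A f) \<and>
     (\<forall>h \<in> Ar A. tgt A h = src A f \<and> f \<cdot>\<^bsub>A\<^esub> h = hzero A (src A h) (tgt A f) \<longrightarrow>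
        (\<exists>!u. u \<in> Hom A (src A h) (src A k) \<and> k \<cdot>\<^bsub>A\<^esub> u = h))"

definition is_cokernel :: "('o, 'm, 'r) linear_cat \<Rightarrow> 'm \<Rightarrow> 'm \<Rightarrow> bool" where
  "is_cokernel A c f \<longleftrightarrow> f \<in> Ar A \<and> c \<in> Ar A \<and> src A c = tgt A f \<and>
     c \<cdot>\<^bsub>A\<^esub> f = hzero A (src A f) (tgt A c) \<and>
     (\<forall>h \<in> Ar A. src A h = tgt A f \<and> h \<cdot>\<^bsub>A\<^esub> f = hzero A (src A f) (tgt A h) \<longrightarrow>
        (\<exists>!u. u \<in> Hom A (tgt A c) (tgt A h) \<and> u \<cdot>\<^bsub>A\<^esub> c = h))"

definition is_biproduct ::
    "('o, 'm, 'r) linear_cat \<Rightarrow> 'o \<Rightarrow> 'o \<Rightarrow> 'o \<Rightarrow> 'm \<Rightarrow> 'm \<Rightarrow> 'm \<Rightarrow> 'm \<Rightarrow> bool" where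
  "is_biproduct A X Y P i j p q \<longleftrightarrow> P \<in> Ob A \<and>
     i \<in> Hom A X P \<and> j \<in> Hom A Y P \<and> p \<in> Hom A P X \<and> q \<in> Hom A P Y \<and>
     p \<cdot>\<^bsub>A\<^esub> i = ident A X \<and> q \<cdot>\<^bsub>A\<^esub> j = ident A Y \<and>
     q \<cdot>\<^bsub>A\<^esub> i = hzero A X Y \<and> p \<cdot>\<^bsub>A\<^esub> j = hzero A Y X \<and>
     hadd A (i \<cdot>\<^bsub>A\<^esub> p) (j \<cdot>\<^bsub>A\<^esub> q) = ident A P"

locale abelian_category = linear_category R A
  for R :: "('r, 'x) ring_scheme" and A :: "('o, 'm, 'r) linear_cat" (structure) +
  assumes ex_zero_object: "\<exists>Z. is_zero_object A Z"
    and ex_biproduct: "X \<in> Ob A \<Longrightarrow> Y \<in> Ob A \<Longrightarrow> \<exists>P i j p q. is_biproduct A X Y P i j p q"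
    and ex_kernel: "f \<in> Ar A \<Longrightarrow> \<exists>k. is_kernel A k f"
    and ex_cokernel: "f \<in> Ar A \<Longrightarrow> \<exists>c. is_cokernel A c f"
    and mono_is_kernel: "is_mono A m \<Longrightarrow> \<exists>f. is_kernel A m f"
    and epi_is_cokernel: "is_epi A e \<Longrightarrow> \<exists>f. is_cokernel A e f"

text \<open>\<open>0 \<rightarrow> X \<rightarrow> Y \<rightarrow> Z \<rightarrow> 0\<close> with maps \<open>f : X \<rightarrow> Y\<close> and \<open>g : Y \<rightarrow> Z\<close>.\<close>

definition short_exact :: "('o, 'm, 'r) linear_cat \<Rightarrow> 'm \<Rightarrow> 'm \<Rightarrow> bool" where
  "short_exact A f g \<longleftrightarrow> is_kernel A f g \<and> is_cokernel A g f"

definition is_image :: "('o, 'm, 'r) linear_cat \<Rightarrow> 'm \<Rightarrow> 'm \<Rightarrow> bool" where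
  "is_image A m f \<longleftrightarrow> (\<exists>c. is_cokernel A c f \<and> is_kernel A m c)"

text \<open>Exactness of \<open>f\<close> followed by \<open>g\<close> at the object in the middle:
  the image of \<open>f\<close> is the kernel of \<open>g\<close>.\<close>

definition exact_at :: "('o, 'm, 'r) linear_cat \<Rightarrow> 'm \<Rightarrow> 'm \<Rightarrow> bool" where
  "exact_at A f g \<longleftrightarrow> (\<exists>m. is_image A m f \<and> is_kernel A m g)"

locale linear_functor = A: linear_category R A + B: linear_category R B + is_functor A B F
  for R :: "('r, 'x) ring_scheme" and A :: "('o, 'm, 'r) linear_cat"
    and B :: "('p, 'n, 'r) linear_cat" and F :: "('o, 'm, 'p, 'n) cfunctor" +
  assumes fAr_hadd: "f \<in> Hom A X Y \<Longrightarrow> g \<in> Hom A X Y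
      \<Longrightarrow> fAr F (hadd A f g) = hadd B (fAr F f) (fAr F g)"
    and fAr_hsmult: "a \<in> carrier R \<Longrightarrow> f \<in> Ar A
      \<Longrightarrow> fAr F (hsmult A a f) = hsmult B a (fAr F f)"

locale exact_functor = A: abelian_category R A + B: abelian_category R B + linear_functor R A B F
  for R :: "('r, 'x) ring_scheme" and A :: "('o, 'm, 'r) linear_cat"
    and B :: "('p, 'n, 'r) linear_cat" and F :: "('o, 'm, 'p, 'n) cfunctor" +
  assumes fAr_short_exact: "short_exact A f g \<Longrightarrow> short_exact B (fAr F f) (fAr F g)"

definition linear_equivalence ::
    "('r, 'x) ring_scheme \<Rightarrow> ('o, 'm, 'r) linear_cat \<Rightarrow> ('p, 'n, 'r) linear_cat \<Rightarrow>
     ('o, 'm, 'p, 'n) cfunctor \<Rightarrow> bool" where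
  "linear_equivalence R A B E \<longleftrightarrow> linear_functor R A B E \<and>
     (\<exists>G. linear_functor R B A G \<and>
        isomorphic_functors A A (functor_comp G E) id_functor \<and>
        isomorphic_functors B B (functor_comp E G) id_functor)"

section \<open>Serre quotients\<close>

definition functor_kernel ::
    "('o, 'm, 'y) category_scheme \<Rightarrow> ('p, 'n, 'z) category_scheme \<Rightarrow>
     ('o, 'm, 'p, 'n) cfunctor \<Rightarrow> 'o set" where
  "functor_kernel A B F = {X \<in> Ob A. is_zero_object B (fOb F X)}"

text \<open>For a Serre subcategory with object class \<open>I\<close>, the quotient \<open>A/I\<close> is the localisation of
  \<open>A\<close> at the arrows with kernel and cokernel in \<open>I\<close>, by calculus of right fractions. A roof
  \<open>(s, f)\<close> from \<open>X\<close> to \<open>Y\<close> consists of \<open>s : X' \<rightarrow> X\<close>, inverted in \<open>A/I\<close>, and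
  \<open>f : X' \<rightarrow> Y\<close>; it stands for \<open>f s\<^sup>-\<^sup>1\<close>.\<close>

definition iso_mod :: "('o, 'm, 'r) linear_cat \<Rightarrow> 'o set \<Rightarrow> 'm set" where
  "iso_mod A I = {s \<in> Ar A. (\<exists>k. is_kernel A k s \<and> src A k \<in> I) \<and>
                            (\<exists>c. is_cokernel A c s \<and> tgt A c \<in> I)}"

definition roofs :: "('o, 'm, 'r) linear_cat \<Rightarrow> 'o set \<Rightarrow> 'o \<Rightarrow> 'o \<Rightarrow> ('m \<times> 'm) set" where
  "roofs A I X Y = {(s, f). s \<in> iso_mod A I \<and> f \<in> Ar A \<and> src A s = src A f \<and>
                            tgt A s = X \<and> tgt A f = Y}"

definition roof_rel ::
    "('o, 'm, 'r) linear_cat \<Rightarrow> 'o set \<Rightarrow> 'o \<Rightarrow> 'o \<Rightarrow> (('m \<times> 'm) \<times> ('m \<times> 'm)) set" where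
  "roof_rel A I X Y = {((s, f), (t, g)). (s, f) \<in> roofs A I X Y \<and> (t, g) \<in> roofs A I X Y \<and>
     (\<exists>W. \<exists>u \<in> Hom A W (src A s). \<exists>v \<in> Hom A W (src A t).
        s \<cdot>\<^bsub>A\<^esub> u = t \<cdot>\<^bsub>A\<^esub> v \<and> s \<cdot>\<^bsub>A\<^esub> u \<in> iso_mod A I \<and> f \<cdot>\<^bsub>A\<^esub> u = g \<cdot>\<^bsub>A\<^esub> v)}"

text \<open>An arrow of \<open>A/I\<close> is a class of roofs together with its source and target. The operations
  are unions, over all choices of representatives and auxiliary data, of the resulting class:
  \<open>(g t\<^sup>-\<^sup>1) (f s\<^sup>-\<^sup>1) = (g v) (s u)\<^sup>-\<^sup>1\<close> whenever \<open>f u = t v\<close> with \<open>u\<close> inverted, and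
  \<open>f s\<^sup>-\<^sup>1 + g s\<^sup>-\<^sup>1 = (f + g) s\<^sup>-\<^sup>1\<close>.\<close>

definition serre_quotient ::
    "('o, 'm, 'r) linear_cat \<Rightarrow> 'o set \<Rightarrow> ('o, 'o \<times> ('m \<times> 'm) set \<times> 'o, 'r) linear_cat" where
  "serre_quotient A I =
     \<lparr>Ob = Ob A,
      Ar = {(X, \<Phi>, Y). X \<in> Ob A \<and> Y \<in> Ob A \<and> \<Phi> \<in> roofs A I X Y // roof_rel A I X Y},
      src = (\<lambda>(X, \<Phi>, Y). X),
      tgt = (\<lambda>(X, \<Phi>, Y). Y),
      ident = (\<lambda>X. (X, roof_rel A I X X `` {(ident A X, ident A X)}, X)),
      cmp = (\<lambda>(Y, \<Psi>, Z) (X, \<Phi>, _).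
        (X, \<Union> {roof_rel A I X Z `` {(s \<cdot>\<^bsub>A\<^esub> u, g \<cdot>\<^bsub>A\<^esub> v)} | s f t g u v.
               (s, f) \<in> \<Phi> \<and> (t, g) \<in> \<Psi> \<and> u \<in> iso_mod A I \<and> v \<in> Ar A \<and> src A u = src A v \<and>
               tgt A u = src A f \<and> tgt A v = src A t \<and> f \<cdot>\<^bsub>A\<^esub> u = t \<cdot>\<^bsub>A\<^esub> v}, Z)),
      hzero = (\<lambda>X Y. (X, roof_rel A I X Y `` {(ident A X, hzero A X Y)}, Y)),
      hadd = (\<lambda>(X, \<Phi>, Y) (_, \<Psi>, _).
        (X, \<Union> {roof_rel A I X Y `` {(s, hadd A f g)} | s f g. (s, f) \<in> \<Phi> \<and> (s, g) \<in> \<Psi>}, Y)),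
      hsmult = (\<lambda>a (X, \<Phi>, Y).
        (X, \<Union> {roof_rel A I X Y `` {(s, hsmult A a f)} | s f. (s, f) \<in> \<Phi>}, Y))\<rparr>"

definition serre_projection ::
    "('o, 'm, 'r) linear_cat \<Rightarrow> 'o set \<Rightarrow> ('o, 'm, 'o, 'o \<times> ('m \<times> 'm) set \<times> 'o) cfunctor" where
  "serre_projection A I =
     \<lparr>fOb = (\<lambda>X. X),
      fAr = (\<lambda>f. (src A f, roof_rel A I (src A f) (tgt A f) `` {(ident A (src A f), f)}, tgt A f))\<rparr>"

text \<open>The factorisation through \<open>A/I\<close> of an exact functor \<open>F : A \<rightarrow> B\<close> killing \<open>I\<close>:
  the class of \<open>(s, f)\<close> is sent to \<open>F f (F s)\<^sup>-\<^sup>1\<close>.\<close>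

definition serre_factor ::
    "('p, 'n, 'r) linear_cat \<Rightarrow> ('o, 'm, 'p, 'n) cfunctor \<Rightarrow>
     ('o, 'o \<times> ('m \<times> 'm) set \<times> 'o, 'p, 'n) cfunctor" where
  "serre_factor B F =
     \<lparr>fOb = fOb F,
      fAr = (\<lambda>(X, \<Phi>, Y). THE h. h \<in> Hom B (fOb F X) (fOb F Y) \<and>
               (\<forall>(s, f) \<in> \<Phi>. h \<cdot>\<^bsub>B\<^esub> fAr F s = fAr F f))\<rparr>"

section \<open>Cohomologies\<close>

text \<open>Contravariant functors on \<open>C\<close> are functors on \<^term>\<open>opp C\<close>.\<close>

record ('c, 'd, 'o, 'm, 'r) cohomology =
  target :: "('o, 'm, 'r) linear_cat"
  deg :: "nat \<Rightarrow> ('c, 'd, 'o, 'm) cfunctor"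

locale cohomology =
  fixes R :: "('r, 'x) ring_scheme" and C :: "('c, 'd, 'y) category_scheme"
    and H :: "('c, 'd, 'o, 'm, 'r, 'z) cohomology_scheme"
  assumes abelian_target: "abelian_category R (target H)"
    and functor_deg: "is_functor (opp C) (target H) (deg H i)"

definition push_forward ::
    "('p, 'n, 'r) linear_cat \<Rightarrow> ('o, 'm, 'p, 'n) cfunctor \<Rightarrow>
     ('c, 'd, 'o, 'm, 'r) cohomology \<Rightarrow> ('c, 'd, 'p, 'n, 'r) cohomology" where
  "push_forward B G H = \<lparr>target = B, deg = (\<lambda>i. functor_comp G (deg H i))\<rparr>"

definition cohomology_iso ::
    "('c, 'd, 'y) category_scheme \<Rightarrow> ('c, 'd, 'o, 'm, 'r) cohomology \<Rightarrow>
     ('c, 'd, 'o, 'm, 'r) cohomology \<Rightarrow> bool" where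
  "cohomology_iso C H H' \<longleftrightarrow> target H = target H' \<and>
     (\<forall>i. isomorphic_functors (opp C) (target H) (deg H i) (deg H' i))"

text \<open>\<open>F\<close> is (a choice of) the functor \<open>F\<^sub>H\<close> attached to \<open>H\<close> by the universal property of \<open>U\<close>.\<close>

definition classifies ::
    "('r, 'x) ring_scheme \<Rightarrow> ('c, 'd, 'y) category_scheme \<Rightarrow> ('c, 'd, 'o, 'm, 'r) cohomology \<Rightarrow>
     ('c, 'd, 'p, 'n, 'r) cohomology \<Rightarrow> ('o, 'm, 'p, 'n) cfunctor \<Rightarrow> bool" where
  "classifies R C U H F \<longleftrightarrow> exact_functor R (target U) (target H) F \<and>
     cohomology_iso C H (push_forward (target H) F U)"

locale universal_cohomology = cohomology R C U
  for R :: "('r, 'x) ring_scheme" and C :: "('c, 'd, 'y) category_scheme"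
    and U :: "('c, 'd, 'o, 'm, 'r) cohomology" +
  assumes ex_classifies:
      "cohomology R C (H :: ('c, 'd, 'o, 'm, 'r) cohomology) \<Longrightarrow> \<exists>F. classifies R C U H F"
    and unique_classifies:
      "cohomology R C (H :: ('c, 'd, 'o, 'm, 'r) cohomology) \<Longrightarrow> classifies R C U H F \<Longrightarrow>
       classifies R C U H F' \<Longrightarrow> isomorphic_functors (target U) (target H) F F'"

text \<open>\<open>H'\<close> is a realisation of \<open>H\<close> along \<open>G\<close>.\<close>

definition realisation ::
    "('r, 'x) ring_scheme \<Rightarrow> ('c, 'd, 'y) category_scheme \<Rightarrow> ('c, 'd, 'p, 'n, 'r) cohomology \<Rightarrow>
     ('c, 'd, 'o, 'm, 'r) cohomology \<Rightarrow> ('o, 'm, 'p, 'n) cfunctor \<Rightarrow> bool" where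
  "realisation R C H' H G \<longleftrightarrow> exact_functor R (target H) (target H') G \<and>
     is_faithful (target H) G \<and> cohomology_iso C H' (push_forward (target H') G H)"

section \<open>Relative cohomologies\<close>

text \<open>A distinguished pair \<open>(X, Y)\<close> is represented by a distinguished mono \<open>i : Y \<rightarrow> X\<close>. Closure
  under composition says that with \<open>(X, Y)\<close> and \<open>(Y, Z)\<close> also \<open>(X, Z)\<close> is a distinguished pair.\<close>

locale distinguished_monos = category C
  for C :: "('c, 'd, 'y) category_scheme" (structure) +
  fixes D :: "'d set"
  assumes D_mono: "i \<in> D \<Longrightarrow> is_mono C i"
    and D_cmp: "i \<in> D \<Longrightarrow> j \<in> D \<Longrightarrow> tgt C j = src C i \<Longrightarrow> i \<cdot> j \<in> D"

text \<open>A morphism of pairs \<open>(i, f, i')\<close> is an arrow \<open>f\<close> between the ambient objects which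
  restricts to the subobjects.\<close>

definition pair_category ::
    "('c, 'd, 'y) category_scheme \<Rightarrow> 'd set \<Rightarrow> ('d, 'd \<times> 'd \<times> 'd) category" where
  "pair_category C D =
     \<lparr>Ob = D,
      Ar = {(i, f, i'). i \<in> D \<and> i' \<in> D \<and> f \<in> Hom C (tgt C i) (tgt C i') \<and>
              (\<exists>g \<in> Hom C (src C i) (src C i'). f \<cdot>\<^bsub>C\<^esub> i = i' \<cdot>\<^bsub>C\<^esub> g)},
      src = (\<lambda>(i, f, i'). i),
      tgt = (\<lambda>(i, f, i'). i'),
      ident = (\<lambda>i. (i, ident C (tgt C i), i)),
      cmp = (\<lambda>(i', g, i'') (i, f, _). (i, g \<cdot>\<^bsub>C\<^esub> f, i''))\<rparr>"

text \<open>A triple \<open>(X, Y, Z)\<close> is given by \<open>i : Y \<rightarrow> X\<close> and \<open>j : Z \<rightarrow> Y\<close>.\<close>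

definition triples :: "('c, 'd, 'y) category_scheme \<Rightarrow> 'd set \<Rightarrow> ('d \<times> 'd) set" where
  "triples C D = {(i, j). i \<in> D \<and> j \<in> D \<and> tgt C j = src C i}"

text \<open>\<open>bd H n i j\<close> is the boundary \<open>H\<^sup>n(Y, Z) \<rightarrow> H\<^sup>n\<^sup>+\<^sup>1(X, Y)\<close> of the triple \<open>(i, j)\<close>.\<close>

record ('d, 'o, 'm, 'r) rel_cohomology = "('d, 'd \<times> 'd \<times> 'd, 'o, 'm, 'r) cohomology" +
  bd :: "nat \<Rightarrow> 'd \<Rightarrow> 'd \<Rightarrow> 'm"

text \<open>The long exact sequence is
  \<open>H\<^sup>n(X, Y) \<rightarrow> H\<^sup>n(X, Z) \<rightarrow> H\<^sup>n(Y, Z) \<rightarrow> H\<^sup>n\<^sup>+\<^sup>1(X, Y) \<rightarrow> H\<^sup>n\<^sup>+\<^sup>1(X, Z)\<close>; its first two maps are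
  induced by the identity of \<open>X\<close>, viewed as \<open>(X, Z) \<rightarrow> (X, Y)\<close>, and by \<open>i : (Y, Z) \<rightarrow> (X, Z)\<close>.
  No condition is imposed at the initial term \<open>H\<^sup>0(X, Y)\<close>.\<close>

locale relative_cohomology = cohomology R "pair_category C D" H
  for R :: "('r, 'x) ring_scheme" and C :: "('c, 'd, 'y) category_scheme" and D :: "'d set"
    and H :: "('d, 'o, 'm, 'r) rel_cohomology" +
  assumes bd_in_Hom: "(i, j) \<in> triples C D
      \<Longrightarrow> bd H n i j \<in> Hom (target H) (fOb (deg H n) j) (fOb (deg H (Suc n)) i)"
    and bd_natural: "(i, j) \<in> triples C D \<Longrightarrow> (i', j') \<in> triples C D \<Longrightarrow>
      (i, f, i') \<in> Ar (pair_category C D) \<Longrightarrow> (j, g, j') \<in> Ar (pair_category C D) \<Longrightarrow>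
      f \<cdot>\<^bsub>C\<^esub> i = i' \<cdot>\<^bsub>C\<^esub> g \<Longrightarrow>
      fAr (deg H (Suc n)) (i, f, i') \<cdot>\<^bsub>target H\<^esub> bd H n i' j'
        = bd H n i j \<cdot>\<^bsub>target H\<^esub> fAr (deg H n) (j, g, j')"
    and exact_XZ: "(i, j) \<in> triples C D \<Longrightarrow> exact_at (target H)
      (fAr (deg H n) (i \<cdot>\<^bsub>C\<^esub> j, ident C (tgt C i), i)) (fAr (deg H n) (j, i, i \<cdot>\<^bsub>C\<^esub> j))"
    and exact_YZ: "(i, j) \<in> triples C D \<Longrightarrow> exact_at (target H)
      (fAr (deg H n) (j, i, i \<cdot>\<^bsub>C\<^esub> j)) (bd H n i j)"
    and exact_XY: "(i, j) \<in> triples C D \<Longrightarrow> exact_at (target H)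
      (bd H n i j) (fAr (deg H (Suc n)) (i \<cdot>\<^bsub>C\<^esub> j, ident C (tgt C i), i))"

definition rel_push_forward ::
    "('p, 'n, 'r) linear_cat \<Rightarrow> ('o, 'm, 'p, 'n) cfunctor \<Rightarrow>
     ('d, 'o, 'm, 'r) rel_cohomology \<Rightarrow> ('d, 'p, 'n, 'r) rel_cohomology" where
  "rel_push_forward B G H =
     \<lparr>target = B, deg = (\<lambda>n. functor_comp G (deg H n)), bd = (\<lambda>n i j. fAr G (bd H n i j))\<rparr>"

definition rel_cohomology_iso ::
    "('c, 'd, 'y) category_scheme \<Rightarrow> 'd set \<Rightarrow> ('d, 'o, 'm, 'r) rel_cohomology \<Rightarrow>
     ('d, 'o, 'm, 'r) rel_cohomology \<Rightarrow> bool" where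
  "rel_cohomology_iso C D H H' \<longleftrightarrow> target H = target H' \<and>
     (\<exists>\<theta>. (\<forall>n. nat_iso (opp (pair_category C D)) (target H) (deg H n) (deg H' n) (\<theta> n)) \<and>
          (\<forall>n. \<forall>(i, j) \<in> triples C D.
             \<theta> (Suc n) i \<cdot>\<^bsub>target H\<^esub> bd H n i j = bd H' n i j \<cdot>\<^bsub>target H\<^esub> \<theta> n j))"

definition rel_classifies ::
    "('r, 'x) ring_scheme \<Rightarrow> ('c, 'd, 'y) category_scheme \<Rightarrow> 'd set \<Rightarrow>
     ('d, 'o, 'm, 'r) rel_cohomology \<Rightarrow> ('d, 'p, 'n, 'r) rel_cohomology \<Rightarrow>
     ('o, 'm, 'p, 'n) cfunctor \<Rightarrow> bool" where
  "rel_classifies R C D U H F \<longleftrightarrow> exact_functor R (target U) (target H) F \<and>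
     rel_cohomology_iso C D H (rel_push_forward (target H) F U)"

locale universal_relative_cohomology = relative_cohomology R C D U
  for R :: "('r, 'x) ring_scheme" and C :: "('c, 'd, 'y) category_scheme" and D :: "'d set"
    and U :: "('d, 'o, 'm, 'r) rel_cohomology" +
  assumes ex_rel_classifies:
      "relative_cohomology R C D (H :: ('d, 'o, 'm, 'r) rel_cohomology) \<Longrightarrow>
       \<exists>F. rel_classifies R C D U H F"
    and unique_rel_classifies:
      "relative_cohomology R C D (H :: ('d, 'o, 'm, 'r) rel_cohomology) \<Longrightarrow>
       rel_classifies R C D U H F \<Longrightarrow> rel_classifies R C D U H F' \<Longrightarrow>
       isomorphic_functors (target U) (target H) F F'"

definition rel_realisation ::
    "('r, 'x) ring_scheme \<Rightarrow> ('c, 'd, 'y) category_scheme \<Rightarrow> 'd set \<Rightarrow>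
     ('d, 'p, 'n, 'r) rel_cohomology \<Rightarrow> ('d, 'o, 'm, 'r) rel_cohomology \<Rightarrow>
     ('o, 'm, 'p, 'n) cfunctor \<Rightarrow> bool" where
  "rel_realisation R C D H' H G \<longleftrightarrow> exact_functor R (target H) (target H') G \<and>
     is_faithful (target H) G \<and> rel_cohomology_iso C D H' (rel_push_forward (target H') G H)"

section \<open>Quotients attached to cohomologies\<close>

text \<open>These notions only involve the abelian category in which the universal theory \<open>U\<close> takes
  its values and a choice \<open>F\<close> of the classifying functors, so they are shared by the absolute
  and the relative case.\<close>

definition Ker_coh ::
    "('c, 'd, 'o, 'm, 'r, 'y) cohomology_scheme \<Rightarrow>
     (('c, 'd, 'p, 'n, 'r, 'z) cohomology_scheme \<Rightarrow> ('o, 'm, 'p, 'n) cfunctor) \<Rightarrow>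
     ('c, 'd, 'p, 'n, 'r, 'z) cohomology_scheme \<Rightarrow> 'o set" where
  "Ker_coh U F H = functor_kernel (target U) (target H) (F H)"

definition coh_quotient ::
    "('c, 'd, 'o, 'm, 'r, 'y) cohomology_scheme \<Rightarrow>
     (('c, 'd, 'p, 'n, 'r, 'z) cohomology_scheme \<Rightarrow> ('o, 'm, 'p, 'n) cfunctor) \<Rightarrow>
     ('c, 'd, 'p, 'n, 'r, 'z) cohomology_scheme \<Rightarrow>
     ('o, 'o \<times> ('m \<times> 'm) set \<times> 'o, 'r) linear_cat" where
  "coh_quotient U F H = serre_quotient (target U) (Ker_coh U F H)"

definition coh_projection ::
    "('c, 'd, 'o, 'm, 'r, 'y) cohomology_scheme \<Rightarrow>
     (('c, 'd, 'p, 'n, 'r, 'z) cohomology_scheme \<Rightarrow> ('o, 'm, 'p, 'n) cfunctor) \<Rightarrow>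
     ('c, 'd, 'p, 'n, 'r, 'z) cohomology_scheme \<Rightarrow>
     ('o, 'm, 'o, 'o \<times> ('m \<times> 'm) set \<times> 'o) cfunctor" where
  "coh_projection U F H = serre_projection (target U) (Ker_coh U F H)"

text \<open>(\<open>\<partial>\<close>-)equivalence of \<open>H\<close> and \<open>H'\<close>: an equivalence \<open>\<A>(H) \<cong> \<A>(H')\<close> under \<open>\<A>(\<C>)\<close>.\<close>

definition coh_equivalent ::
    "('r, 'x) ring_scheme \<Rightarrow> ('c, 'd, 'o, 'm, 'r, 'y) cohomology_scheme \<Rightarrow>
     (('c, 'd, 'p, 'n, 'r, 'z) cohomology_scheme \<Rightarrow> ('o, 'm, 'p, 'n) cfunctor) \<Rightarrow>
     ('c, 'd, 'p, 'n, 'r, 'z) cohomology_scheme \<Rightarrow>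
     ('c, 'd, 'p, 'n, 'r, 'z) cohomology_scheme \<Rightarrow> bool" where
  "coh_equivalent R U F H H' \<longleftrightarrow>
     (\<exists>E. linear_equivalence R (coh_quotient U F H) (coh_quotient U F H') E \<and>
          isomorphic_functors (target U) (coh_quotient U F H')
            (functor_comp E (coh_projection U F H)) (coh_projection U F H'))"

text \<open>For empty \<open>S\<close> the intersection is taken inside \<open>\<A>(\<C>)\<close>, i.e. it consists of all objects.\<close>

definition common_Ker ::
    "('c, 'd, 'o, 'm, 'r, 'y) cohomology_scheme \<Rightarrow>
     (('c, 'd, 'p, 'n, 'r, 'z) cohomology_scheme \<Rightarrow> ('o, 'm, 'p, 'n) cfunctor) \<Rightarrow>
     ('c, 'd, 'p, 'n, 'r, 'z) cohomology_scheme set \<Rightarrow> 'o set" where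
  "common_Ker U F S = {X \<in> Ob (target U). \<forall>H \<in> S. X \<in> Ker_coh U F H}"

definition class_quotient ::
    "('c, 'd, 'o, 'm, 'r, 'y) cohomology_scheme \<Rightarrow>
     (('c, 'd, 'p, 'n, 'r, 'z) cohomology_scheme \<Rightarrow> ('o, 'm, 'p, 'n) cfunctor) \<Rightarrow>
     ('c, 'd, 'p, 'n, 'r, 'z) cohomology_scheme set \<Rightarrow>
     ('o, 'o \<times> ('m \<times> 'm) set \<times> 'o, 'r) linear_cat" where
  "class_quotient U F S = serre_quotient (target U) (common_Ker U F S)"

definition class_projection ::
    "('c, 'd, 'o, 'm, 'r, 'y) cohomology_scheme \<Rightarrow>
     (('c, 'd, 'p, 'n, 'r, 'z) cohomology_scheme \<Rightarrow> ('o, 'm, 'p, 'n) cfunctor) \<Rightarrow>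
     ('c, 'd, 'p, 'n, 'r, 'z) cohomology_scheme set \<Rightarrow>
     ('o, 'm, 'o, 'o \<times> ('m \<times> 'm) set \<times> 'o) cfunctor" where
  "class_projection U F S = serre_projection (target U) (common_Ker U F S)"

text \<open>The functor \<open>r\<^sub>H\<close> and the canonical functor \<open>\<A>\<^sub>S(\<C>) \<rightarrow> \<A>(H)\<close>: the factorisations through
  \<^const>\<open>class_projection\<close> of \<open>F\<^sub>H\<close> and of \<^const>\<open>coh_projection\<close>.\<close>

definition realisation_functor ::
    "(('c, 'd, 'p, 'n, 'r, 'z) cohomology_scheme \<Rightarrow> ('o, 'm, 'p, 'n) cfunctor) \<Rightarrow>
     ('c, 'd, 'p, 'n, 'r, 'z) cohomology_scheme \<Rightarrow>
     ('o, 'o \<times> ('m \<times> 'm) set \<times> 'o, 'p, 'n) cfunctor" where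
  "realisation_functor F H = serre_factor (target H) (F H)"

definition canonical_functor ::
    "('c, 'd, 'o, 'm, 'r, 'y) cohomology_scheme \<Rightarrow>
     (('c, 'd, 'p, 'n, 'r, 'z) cohomology_scheme \<Rightarrow> ('o, 'm, 'p, 'n) cfunctor) \<Rightarrow>
     ('c, 'd, 'p, 'n, 'r, 'z) cohomology_scheme \<Rightarrow>
     ('o, 'o \<times> ('m \<times> 'm) set \<times> 'o, 'o, 'o \<times> ('m \<times> 'm) set \<times> 'o) cfunctor" where
  "canonical_functor U F H = serre_factor (coh_quotient U F H) (coh_projection U F H)"

definition class_cohomology ::
    "('c, 'd, 'o, 'm, 'r) cohomology \<Rightarrow>
     (('c, 'd, 'p, 'n, 'r) cohomology \<Rightarrow> ('o, 'm, 'p, 'n) cfunctor) \<Rightarrow>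
     ('c, 'd, 'p, 'n, 'r) cohomology set \<Rightarrow>
     ('c, 'd, 'o, 'o \<times> ('m \<times> 'm) set \<times> 'o, 'r) cohomology" where
  "class_cohomology U F S = push_forward (class_quotient U F S) (class_projection U F S) U"

definition class_rel_cohomology ::
    "('d, 'o, 'm, 'r) rel_cohomology \<Rightarrow>
     (('d, 'p, 'n, 'r) rel_cohomology \<Rightarrow> ('o, 'm, 'p, 'n) cfunctor) \<Rightarrow>
     ('d, 'p, 'n, 'r) rel_cohomology set \<Rightarrow>
     ('d, 'o, 'o \<times> ('m \<times> 'm) set \<times> 'o, 'r) rel_cohomology" where
  "class_rel_cohomology U F S = rel_push_forward (class_quotient U F S) (class_projection U F S) U"

end

theory Submission
  imports Defs
begin

text \<open>
  All three conditions say that \<open>Ker F\<^sub>H\<close> is the same for all \<open>H \<in> S\<close>, i.e. that it equals the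
  intersection \<open>I\<close>. An equivalence under \<open>\<A>(\<C>)\<close>, a faithful \<open>r\<^sub>H\<close> and an invertible
  \<open>\<A>\<^sub>S(\<C>) \<rightarrow> \<A>(H)\<close> all reflect zero objects, and the zero objects of a Serre quotient are the
  objects of the subcategory divided out. Conversely, if \<open>I = Ker F\<close> for an exact functor
  \<open>F : A \<rightarrow> B\<close>, one needs that \<open>A/I\<close> is abelian and \<open>A/I \<rightarrow> B\<close> is exact and faithful. As
  \<open>s\<close> is inverted in \<open>A/I\<close> iff \<open>F s\<close> is invertible, and arrows identified by \<open>F\<close> are equalised by
  such an \<open>s\<close>, the roofs modulo equivalence from \<open>X\<close> to \<open>Y\<close> correspond to the arrows
  \<open>h : F X \<rightarrow> F Y\<close> of \<open>B\<close> with \<open>h (F s) = F f\<close> for some roof \<open>(s, f)\<close>. So the axioms for \<open>A/I\<close>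
  are inherited from \<open>B\<close>; the set of such \<open>h\<close> is self-dual, which gives cokernels from kernels.
\<close>

section \<open>Categories and linear categories\<close>

text \<open>The first obstacle is the intersection I: it is not presented as the kernel of one exact
  functor, so before \<open>Ker F_H = I\<close> is known there is no B whose arrows describe A/I. In
  the directions that prove equal kernels, the linear structure of A/I is read off from the
  condition at hand (exactness of r_H and a linear equivalence both include it), and a single fact
  is extracted from bare roofs: a zero object of A/I is isomorphic, already in A, to an object of I.
  Every F_H preserves that isomorphism, so the object itself lies in I. In the converse directions
  A/I is the quotient by Ker F_H, and F_H serves as F.

  The second obstacle is that the operations of the quotient are unions over all choices of roofs
  and auxiliary arrows. Tagging each class of roofs with the arrow of B that it represents settles
  well-definedness: every choice gives the class tagged by the composite or sum formed in B. The
  roofs needed on the way come from two kernels of differences, a base change and an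
  equaliser.\<close>

lemma in_Hom [simp]: "f \<in> Hom C X Y \<longleftrightarrow> f \<in> Ar C \<and> src C f = X \<and> tgt C f = Y"
  by (simp add: Hom_def)

context category
begin

declare src_in_Ob [simp] tgt_in_Ob [simp]

lemma ident_left [simp]: "\<lbrakk>f \<in> Ar C; tgt C f = X\<rbrakk> \<Longrightarrow> ident C X \<cdot> f = f"
  using cmp_ident_left by blast

lemma ident_right [simp]: "\<lbrakk>f \<in> Ar C; src C f = X\<rbrakk> \<Longrightarrow> f \<cdot> ident C X = f"
  using cmp_ident_right by blast

lemma ident_simps [simp]:
  assumes "X \<in> Ob C"
  shows "ident C X \<in> Ar C" "src C (ident C X) = X" "tgt C (ident C X) = X"
  using ident_in_Hom [OF assms] by simp_all

lemma cmp_simps [simp]: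
  assumes "f \<in> Ar C" "g \<in> Ar C" "tgt C f = src C g"
  shows "g \<cdot> f \<in> Ar C" "src C (g \<cdot> f) = src C f" "tgt C (g \<cdot> f) = tgt C g"
  using cmp_in_Hom [of f "src C f" "src C g" g "tgt C g"] assms by simp_all

lemma assoc:
  assumes "f \<in> Ar C" "g \<in> Ar C" "h \<in> Ar C" "tgt C f = src C g" "tgt C g = src C h"
  shows "(h \<cdot> g) \<cdot> f = h \<cdot> g \<cdot> f"
  by (rule cmp_assoc) (use assms in auto)

text \<open>Rewriting inside a composite that is bracketed to the right.\<close>

lemma cmp_eq_prefix:
  assumes "h \<cdot> g = k" "f \<in> Ar C" "g \<in> Ar C" "h \<in> Ar C" "tgt C f = src C g" "tgt C g = src C h"
  shows "h \<cdot> g \<cdot> f = k \<cdot> f"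
  using assms assoc by metis

lemma monoD:
  assumes "is_mono C m" "m \<cdot> f = m \<cdot> g" "f \<in> Ar C" "g \<in> Ar C" "src C f = src C g"
    "tgt C f = src C m" "tgt C g = src C m"
  shows "f = g"
  using assms unfolding is_mono_def by auto

lemma epiD:
  assumes "is_epi C e" "f \<cdot> e = g \<cdot> e" "f \<in> Ar C" "g \<in> Ar C" "tgt C f = tgt C g"
    "src C f = tgt C e" "src C g = tgt C e"
  shows "f = g"
  using assms unfolding is_epi_def by auto

lemma is_isoI:
  assumes "f \<in> Hom C X Y" "g \<in> Hom C Y X" "g \<cdot> f = ident C X" "f \<cdot> g = ident C Y"
  shows "is_iso C f"
  using assms unfolding is_iso_def by auto

lemma is_isoE:
  assumes "is_iso C f"
  obtains g where "g \<in> Ar C" "src C g = tgt C f" "tgt C g = src C f"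
    "g \<cdot> f = ident C (src C f)" "f \<cdot> g = ident C (tgt C f)"
  using assms unfolding is_iso_def by auto

lemma iso_Ar: "is_iso C f \<Longrightarrow> f \<in> Ar C"
  by (simp add: is_iso_def)

lemma iso_ident [simp]: "X \<in> Ob C \<Longrightarrow> is_iso C (ident C X)"
    by (intro is_isoI [of _ X X "ident C X"]) simp_all

lemma iso_cmp:
  assumes f: "is_iso C f" and g: "is_iso C g" and fg: "tgt C f = src C g"
  shows "is_iso C (g \<cdot> f)"
proof -
  obtain f' where f': "f' \<in> Ar C" "src C f' = tgt C f" "tgt C f' = src C f"
    "f' \<cdot> f = ident C (src C f)" "f \<cdot> f' = ident C (tgt C f)"
    using f by (elim is_isoE)
  obtain g' where g': "g' \<in> Ar C" "src C g' = tgt C g" "tgt C g' = src C g"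
    "g' \<cdot> g = ident C (src C g)" "g \<cdot> g' = ident C (tgt C g)"
    using g by (elim is_isoE)
  note [simp] = iso_Ar [OF f] iso_Ar [OF g] f' g' fg
  have "g' \<cdot> g \<cdot> f = f" "f \<cdot> f' \<cdot> g' = g'"
    using cmp_eq_prefix [OF g'(4), of f] cmp_eq_prefix [OF f'(5), of g'] fg by simp_all
  then show ?thesis
    by (intro is_isoI [of _ "src C f" "tgt C g" "f' \<cdot> g'"]) (simp_all add: assoc)
qed

lemma iso_mono:
  assumes "is_iso C f"
  shows "is_mono C f"
  unfolding is_mono_def
proof (intro conjI allI ballI impI)
  obtain f' where f': "f' \<in> Ar C" "src C f' = tgt C f" "tgt C f' = src C f"
    "f' \<cdot> f = ident C (src C f)"
    using assms by (elim is_isoE)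
  show [simp]: "f \<in> Ar C"
    by (rule iso_Ar [OF assms])
  fix W g h
  assume gh: "g \<in> Hom C W (src C f)" "h \<in> Hom C W (src C f)" "f \<cdot> g = f \<cdot> h"
  have "x = f' \<cdot> f \<cdot> x" if "x \<in> Hom C W (src C f)" for x
    using cmp_eq_prefix [OF f'(4), of x] f'(1-3) that by simp
  then show "g = h"
    using gh by metis
qed

lemma iso_of_cmp_left:
  assumes v: "v \<in> Ar C" "tgt C v = src C t" and t: "is_iso C t" and tv: "is_iso C (t \<cdot> v)"
  shows "is_iso C v"
proof -
  note [simp] = v iso_Ar [OF t]
  obtain t' where t': "t' \<in> Ar C" "src C t' = tgt C t" "tgt C t' = src C t"
    "t' \<cdot> t = ident C (src C t)" "t \<cdot> t' = ident C (tgt C t)"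
    using t by (elim is_isoE)
  then have "is_iso C t'"
    by (intro is_isoI [of t' "tgt C t" "src C t" t]) simp_all
  have "is_iso C (t' \<cdot> t \<cdot> v)"
    using iso_cmp [OF tv \<open>is_iso C t'\<close>] t' by simp
  moreover have "t' \<cdot> t \<cdot> v = v"
    using cmp_eq_prefix [OF t'(4), of v] t' v by simp
  ultimately show ?thesis
    by simp
qed

text \<open>Isomorphisms are epi. In this form the lemma shows that an equation h (F s) = F f with F
  s invertible determines h, which is how equalities of fractions are proved below.\<close>

lemma epi_iso_cancel:
  assumes e: "is_iso C e" and fg: "f \<cdot> e = g \<cdot> e" and f: "f \<in> Ar C" "src C f = tgt C e"
    and g: "g \<in> Ar C" "src C g = tgt C e"
  shows "f = g"
proof -
  obtain e' where e': "e' \<in> Ar C" "src C e' = tgt C e" "tgt C e' = src C e"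
    "e \<cdot> e' = ident C (tgt C e)"
    using e by (elim is_isoE)
  have "x = (x \<cdot> e) \<cdot> e'" if "x \<in> Ar C" "src C x = tgt C e" for x
    using assoc [of e' e x] e' iso_Ar [OF e] that by simp
  then show ?thesis
    using fg f g by metis
qed

text \<open>The arrow is f s^-1, described by its equation so that no inverse of s has to be
  named.\<close>

lemma ex_fraction:
  assumes s: "is_iso C s" and f: "f \<in> Ar C" "src C f = src C s"
  obtains h where "h \<in> Ar C" "src C h = tgt C s" "tgt C h = tgt C f" "h \<cdot> s = f"
proof -
  obtain s' where s': "s' \<in> Ar C" "src C s' = tgt C s" "tgt C s' = src C s"
    "s' \<cdot> s = ident C (src C s)"
    using s by (elim is_isoE)
  have "(f \<cdot> s') \<cdot> s = f"
    using assoc [of s s' f] s' f iso_Ar [OF s] by simp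
  with s' f show ?thesis
    by (intro that [of "f \<cdot> s'"]) simp_all
qed

end

text \<open>\<open>opp\<close> forgets the additive structure; this opposite keeps it, so that facts
  about linear, abelian and exact structure can be dualised. Taking it twice gives back
  \<open>A\<close> on the nose.\<close>

definition lopp :: "('o, 'm, 'r) linear_cat \<Rightarrow> ('o, 'm, 'r) linear_cat" where
  "lopp A = \<lparr>Ob = Ob A, Ar = Ar A, src = tgt A, tgt = src A, ident = ident A,
     cmp = (\<lambda>g f. f \<cdot>\<^bsub>A\<^esub> g), hzero = (\<lambda>X Y. hzero A Y X), hadd = hadd A, hsmult = hsmult A\<rparr>"

lemma lopp_simps [simp]:
  "Ob (lopp A) = Ob A" "Ar (lopp A) = Ar A" "src (lopp A) = tgt A" "tgt (lopp A) = src A"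
  "ident (lopp A) = ident A" "g \<cdot>\<^bsub>lopp A\<^esub> f = f \<cdot>\<^bsub>A\<^esub> g" "hzero (lopp A) X Y = hzero A Y X"
  "hadd (lopp A) = hadd A" "hsmult (lopp A) = hsmult A"
  by (simp_all add: lopp_def)

lemma Hom_lopp: "Hom (lopp A) X Y = Hom A Y X"
  by (auto simp: Hom_def)

lemma is_kernel_lopp [simp]: "is_kernel (lopp A) k f \<longleftrightarrow> is_cokernel A k f"
  by (simp add: is_kernel_def is_cokernel_def conj_commute conj_left_commute)

lemma is_cokernel_lopp [simp]: "is_cokernel (lopp A) c f \<longleftrightarrow> is_kernel A c f"
  by (simp add: is_kernel_def is_cokernel_def conj_commute conj_left_commute)

lemma is_mono_lopp [simp]: "is_mono (lopp A) f \<longleftrightarrow> is_epi A f"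
  by (simp add: is_mono_def is_epi_def Hom_lopp del: in_Hom)

lemma is_epi_lopp [simp]: "is_epi (lopp A) f \<longleftrightarrow> is_mono A f"
  by (simp add: is_mono_def is_epi_def Hom_lopp del: in_Hom)

lemma is_iso_lopp [simp]: "is_iso (lopp A) f \<longleftrightarrow> is_iso A f"
  by (auto simp add: is_iso_def)

lemma is_zero_object_lopp [simp]: "is_zero_object (lopp A) Z \<longleftrightarrow> is_zero_object A Z"
  by (auto simp add: is_zero_object_def conj_commute)

lemma is_biproduct_lopp:
  "is_biproduct (lopp A) X Y P p q i j \<longleftrightarrow> is_biproduct A X Y P i j p q"
  by (auto simp add: is_biproduct_def)

lemma short_exact_lopp: "short_exact (lopp A) g f \<longleftrightarrow> short_exact A f g"
  by (auto simp: short_exact_def)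

lemma Hom_module_lopp: "Hom_module (lopp A) X Y = Hom_module A Y X"
  by (simp add: Hom_module_def Hom_lopp)

section \<open>Arithmetic of arrows and zero objects\<close>

context linear_category
begin

lemma hzero_simps [simp]:
  assumes "X \<in> Ob A" "Y \<in> Ob A"
  shows "hzero A X Y \<in> Ar A" "src A (hzero A X Y) = X" "tgt A (hzero A X Y) = Y"
proof -
  interpret M: module R "Hom_module A X Y" by (rule module_Hom [OF assms])
  show "hzero A X Y \<in> Ar A" "src A (hzero A X Y) = X" "tgt A (hzero A X Y) = Y"
    using M.zero_closed by (simp_all add: Hom_module_def)
qed

lemma hadd_simps [simp]:
  assumes "f \<in> Ar A" "g \<in> Ar A" "src A f = src A g" "tgt A f = tgt A g"
  shows "hadd A f g \<in> Ar A" "src A (hadd A f g) = src A g" "tgt A (hadd A f g) = tgt A g"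
proof -
  interpret M: module R "Hom_module A (src A f) (tgt A f)" by (rule module_Hom) (use assms in auto)
  show "hadd A f g \<in> Ar A" "src A (hadd A f g) = src A g" "tgt A (hadd A f g) = tgt A g"
    using M.a_closed [of f g] assms by (simp_all add: Hom_module_def)
qed

lemma hsmult_simps [simp]:
  assumes "a \<in> carrier R" "f \<in> Ar A"
  shows "hsmult A a f \<in> Ar A" "src A (hsmult A a f) = src A f" "tgt A (hsmult A a f) = tgt A f"
proof -
  interpret M: module R "Hom_module A (src A f) (tgt A f)" by (rule module_Hom) (use assms in auto)
  show "hsmult A a f \<in> Ar A" "src A (hsmult A a f) = src A f" "tgt A (hsmult A a f) = tgt A f"
    using M.smult_closed [of a f] assms by (simp_all add: Hom_module_def)
qed

lemma hadd_group:
  assumes "f \<in> Hom A X Y" "g \<in> Hom A X Y" "h \<in> Hom A X Y"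
  shows "hadd A (hadd A f g) h = hadd A f (hadd A g h)" "hadd A f g = hadd A g f"
    "hadd A (hzero A X Y) f = f" "hadd A f (hzero A X Y) = f"
    "hadd A (hsmult A (\<ominus>\<^bsub>R\<^esub> \<one>\<^bsub>R\<^esub>) f) f = hzero A X Y"
proof -
  interpret M: module R "Hom_module A X Y" by (rule module_Hom) (use assms in auto)
  show "hadd A (hadd A f g) h = hadd A f (hadd A g h)" "hadd A f g = hadd A g f"
    "hadd A (hzero A X Y) f = f" "hadd A f (hzero A X Y) = f"
    using M.a_assoc [of f g h] M.a_comm [of f g] M.l_zero [of f] M.r_zero [of f] assms
    by (simp_all add: Hom_module_def)
  show "hadd A (hsmult A (\<ominus>\<^bsub>R\<^esub> \<one>\<^bsub>R\<^esub>) f) f = hzero A X Y"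
    using M.smult_l_minus [of "\<one>\<^bsub>R\<^esub>" f] M.smult_one [of f] M.l_neg [of f] assms
    by (simp add: Hom_module_def)
qed

lemma hsmult_module:
  assumes "f \<in> Hom A X Y" "g \<in> Hom A X Y" "a \<in> carrier R" "b \<in> carrier R"
  shows "hsmult A (a \<oplus>\<^bsub>R\<^esub> b) f = hadd A (hsmult A a f) (hsmult A b f)"
    "hsmult A a (hadd A f g) = hadd A (hsmult A a f) (hsmult A a g)"
    "hsmult A (a \<otimes>\<^bsub>R\<^esub> b) f = hsmult A a (hsmult A b f)"
    "hsmult A \<one>\<^bsub>R\<^esub> f = f"
proof -
  interpret M: module R "Hom_module A X Y" by (rule module_Hom) (use assms in auto)
  show "hsmult A (a \<oplus>\<^bsub>R\<^esub> b) f = hadd A (hsmult A a f) (hsmult A b f)"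
    "hsmult A a (hadd A f g) = hadd A (hsmult A a f) (hsmult A a g)"
    "hsmult A (a \<otimes>\<^bsub>R\<^esub> b) f = hsmult A a (hsmult A b f)"
    "hsmult A \<one>\<^bsub>R\<^esub> f = f"
    using M.smult_l_distr [of a b f] M.smult_r_distr [of a f g] M.smult_assoc1 [of a b f]
      M.smult_one [of f] assms
    by (simp_all add: Hom_module_def)
qed

lemma hsmult_zero:
  assumes "f \<in> Ar A"
  shows "hsmult A \<zero>\<^bsub>R\<^esub> f = hzero A (src A f) (tgt A f)"
proof -
  interpret M: module R "Hom_module A (src A f) (tgt A f)" by (rule module_Hom) (use assms in auto)
  show ?thesis
    using M.smult_l_null [of f] assms by (simp add: Hom_module_def)
qed

lemma cmp_hadd:
  shows "\<lbrakk>f \<in> Ar A; g \<in> Ar A; g' \<in> Ar A; src A g = src A g'; tgt A g = tgt A g'; tgt A f = src A g\<rbrakk>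
      \<Longrightarrow> hadd A g g' \<cdot> f = hadd A (g \<cdot> f) (g' \<cdot> f)"
    "\<lbrakk>f \<in> Ar A; f' \<in> Ar A; g \<in> Ar A; src A f = src A f'; tgt A f = tgt A f'; tgt A f = src A g\<rbrakk>
      \<Longrightarrow> g \<cdot> hadd A f f' = hadd A (g \<cdot> f) (g \<cdot> f')"
  using cmp_hadd_left [of f "src A f" "src A g" g "tgt A g" g']
    cmp_hadd_right [of f "src A f" "src A g" f' g "tgt A g"] by simp_all

lemma cmp_hsmult:
  assumes "a \<in> carrier R" "f \<in> Ar A" "g \<in> Ar A" "tgt A f = src A g"
  shows "hsmult A a g \<cdot> f = hsmult A a (g \<cdot> f)" "g \<cdot> hsmult A a f = hsmult A a (g \<cdot> f)"
  using cmp_hsmult_left [of a f "src A f" "src A g" g "tgt A g"]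
    cmp_hsmult_right [of a f "src A f" "src A g" g "tgt A g"] assms by simp_all

text \<open>A zero arrow is its own multiple by the scalar 0, and scalars can be pulled out of
  composites; bilinearity over R thus already contains the absorption of zero arrows.\<close>

lemma cmp_hzero [simp]:
  assumes "f \<in> Ar A" "X \<in> Ob A"
  shows "hzero A (tgt A f) X \<cdot> f = hzero A (src A f) X"
    "f \<cdot> hzero A X (src A f) = hzero A X (tgt A f)"
proof -
  let ?z = "hzero A (tgt A f) X" and ?w = "hzero A X (src A f)"
  have "hsmult A \<zero>\<^bsub>R\<^esub> ?z = ?z" "hsmult A \<zero>\<^bsub>R\<^esub> ?w = ?w"
    using assms by (simp_all add: hsmult_zero)
  then show "?z \<cdot> f = hzero A (src A f) X" "f \<cdot> ?w = hzero A X (tgt A f)"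
    using cmp_hsmult(1) [of "\<zero>\<^bsub>R\<^esub>" f ?z] cmp_hsmult(2) [of "\<zero>\<^bsub>R\<^esub>" ?w f]
      hsmult_zero [of "?z \<cdot> f"] hsmult_zero [of "f \<cdot> ?w"] assms by simp_all
qed

lemma cmp_hzero_left [simp]:
  "\<lbrakk>f \<in> Ar A; X \<in> Ob A; tgt A f = Y\<rbrakk> \<Longrightarrow> hzero A Y X \<cdot> f = hzero A (src A f) X"
  using cmp_hzero by blast

lemma cmp_hzero_right [simp]:
  "\<lbrakk>f \<in> Ar A; X \<in> Ob A; src A f = Y\<rbrakk> \<Longrightarrow> f \<cdot> hzero A X Y = hzero A X (tgt A f)"
  using cmp_hzero by blast

text \<open>The record \<open>linear_cat\<close> has no field for negation, so minus g is the
  multiple of g by the scalar minus one.\<close>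

definition hdiff :: "'m \<Rightarrow> 'm \<Rightarrow> 'm" where
  "hdiff f g = hadd A f (hsmult A (\<ominus>\<^bsub>R\<^esub> \<one>\<^bsub>R\<^esub>) g)"

lemma hdiff_simps [simp]:
  assumes "f \<in> Ar A" "g \<in> Ar A" "src A f = src A g" "tgt A f = tgt A g"
  shows "hdiff f g \<in> Ar A" "src A (hdiff f g) = src A g" "tgt A (hdiff f g) = tgt A g"
  using assms by (simp_all add: hdiff_def)

lemma hdiff_eq_hzero_iff:
  assumes "f \<in> Hom A X Y" "g \<in> Hom A X Y"
  shows "hdiff f g = hzero A X Y \<longleftrightarrow> f = g"
proof
  let ?n = "hsmult A (\<ominus>\<^bsub>R\<^esub> \<one>\<^bsub>R\<^esub>) g"
  assume "hdiff f g = hzero A X Y"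
  then have "hadd A (hadd A f ?n) g = g"
    using hadd_group(3) [OF assms(2) assms(2) assms(2)] by (simp add: hdiff_def)
  moreover have "hadd A (hadd A f ?n) g = f"
    using hadd_group(1) [of f X Y ?n g] hadd_group(5) [OF assms(2) assms(2) assms(2)]
      hadd_group(4) [OF assms(1) assms(1) assms(1)] assms by simp
  ultimately show "f = g"
    by simp
next
  assume "f = g"
  then show "hdiff f g = hzero A X Y"
    using hadd_group(5) [OF assms(2) assms(2) assms(2)]
      hadd_group(2) [of g X Y "hsmult A (\<ominus>\<^bsub>R\<^esub> \<one>\<^bsub>R\<^esub>) g" g] assms
    by (simp add: hdiff_def)
qed

lemma cmp_hdiff:
  shows "\<lbrakk>f \<in> Ar A; g \<in> Ar A; g' \<in> Ar A; src A g = src A g'; tgt A g = tgt A g'; tgt A f = src A g\<rbrakk>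
      \<Longrightarrow> hdiff g g' \<cdot> f = hdiff (g \<cdot> f) (g' \<cdot> f)"
    "\<lbrakk>f \<in> Ar A; f' \<in> Ar A; g \<in> Ar A; src A f = src A f'; tgt A f = tgt A f'; tgt A f = src A g\<rbrakk>
      \<Longrightarrow> g \<cdot> hdiff f f' = hdiff (g \<cdot> f) (g \<cdot> f')"
  by (simp_all add: hdiff_def cmp_hadd cmp_hsmult)

lemma linear_category_lopp: "linear_category R (lopp A)"
proof (intro linear_category.intro linear_category_axioms.intro)
  show "category (lopp A)"
    by (rule category.intro) (auto simp: assoc)
qed (auto simp: Hom_module_lopp cmp_hadd cmp_hsmult intro: module_Hom R.cring_axioms)

text \<open>Turns a universal property into one equation between arrows, which linear functors
  preserve and faithful ones reflect.\<close>

lemma is_zero_object_iff: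
  "is_zero_object A Z \<longleftrightarrow> Z \<in> Ob A \<and> ident A Z = hzero A Z Z"
proof
  assume "is_zero_object A Z"
  then have "Z \<in> Ob A" "\<exists>!f. f \<in> Hom A Z Z"
    unfolding is_zero_object_def by blast+
  moreover from this have "ident A Z \<in> Hom A Z Z" "hzero A Z Z \<in> Hom A Z Z"
    by simp_all
  ultimately show "Z \<in> Ob A \<and> ident A Z = hzero A Z Z"
    by blast
next
  assume Z: "Z \<in> Ob A \<and> ident A Z = hzero A Z Z"
  have "f = hzero A X Z" if "f \<in> Hom A X Z" for f X
  proof -
    have "f = ident A Z \<cdot> f"
      using that by simp
    then show ?thesis
      using that Z by auto
  qed
  moreover have "f = hzero A Z X" if "f \<in> Hom A Z X" for f X
  proof -
    have "f = f \<cdot> ident A Z"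
      using that by simp
    then show ?thesis
      using that Z by auto
  qed
  moreover have "hzero A X Z \<in> Hom A X Z" "hzero A Z X \<in> Hom A Z X" if "X \<in> Ob A" for X
    using that Z by simp_all
  ultimately show "is_zero_object A Z"
    unfolding is_zero_object_def using Z by blast
qed

section \<open>Kernels and monomorphisms\<close>

lemma kernelD:
  assumes "is_kernel A k f"
  shows "k \<in> Ar A" "f \<in> Ar A" "tgt A k = src A f" "f \<cdot> k = hzero A (src A k) (tgt A f)"
  using assms by (auto simp: is_kernel_def)

lemma kernel_ex1_lift:
  assumes "is_kernel A k f" "h \<in> Hom A W (src A f)" "f \<cdot> h = hzero A W (tgt A f)"
  shows "\<exists>!u. u \<in> Hom A W (src A k) \<and> k \<cdot> u = h"
proof -
  have "h \<in> Ar A" "tgt A h = src A f" "src A h = W" "f \<cdot> h = hzero A (src A h) (tgt A f)"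
    using assms by simp_all
  then show ?thesis
    using assms(1) unfolding is_kernel_def by blast
qed

lemma kernel_lift:
  assumes "is_kernel A k f" "h \<in> Hom A W (src A f)" "f \<cdot> h = hzero A W (tgt A f)"
  obtains u where "u \<in> Ar A" "src A u = W" "tgt A u = src A k" "k \<cdot> u = h"
  using kernel_ex1_lift [OF assms] by auto

lemma kernel_mono:
  assumes k: "is_kernel A k f"
  shows "is_mono A k"
  unfolding is_mono_def
proof (intro conjI allI ballI impI)
  show [simp]: "k \<in> Ar A"
    using k by (rule kernelD)
  fix W g h
  assume gh: "g \<in> Hom A W (src A k)" "h \<in> Hom A W (src A k)" "k \<cdot> g = k \<cdot> h"
  have "f \<cdot> k \<cdot> g = hzero A W (tgt A f)"
    using cmp_eq_prefix [OF kernelD(4) [OF k], of g] gh kernelD(1-3) [OF k] by simp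
  then have "\<exists>!u. u \<in> Hom A W (src A k) \<and> k \<cdot> u = k \<cdot> g"
    using kernelD(1-3) [OF k] gh by (intro kernel_ex1_lift [OF k]) simp_all
  with gh show "g = h"
    by metis
qed

text \<open>Uniqueness of lifts is the mono property, so only their existence remains to be
  supplied.\<close>

lemma kernelI:
  assumes k: "is_mono A k" and f: "f \<in> Ar A" "tgt A k = src A f"
    and 0: "f \<cdot> k = hzero A (src A k) (tgt A f)"
    and lift: "\<And>W h. h \<in> Hom A W (src A f) \<Longrightarrow> f \<cdot> h = hzero A W (tgt A f) \<Longrightarrow>
      \<exists>u \<in> Hom A W (src A k). k \<cdot> u = h"
  shows "is_kernel A k f"
  unfolding is_kernel_def
proof (intro conjI ballI impI)
  show "k \<in> Ar A"
    using k by (simp add: is_mono_def)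
  fix h
  assume "h \<in> Ar A" and h: "tgt A h = src A f \<and> f \<cdot> h = hzero A (src A h) (tgt A f)"
  then obtain u where u: "u \<in> Hom A (src A h) (src A k)" "k \<cdot> u = h"
    using lift [of h "src A h"] by auto
  moreover have "u' = u" if "u' \<in> Hom A (src A h) (src A k) \<and> k \<cdot> u' = h" for u'
    using monoD [OF k, of u' u] u that by auto
  ultimately show "\<exists>!u. u \<in> Hom A (src A h) (src A k) \<and> k \<cdot> u = h"
    by blast
qed (use f 0 in auto)

lemma mono_zeroD:
  assumes m: "is_mono A m" and h: "h \<in> Hom A W (src A m)" "m \<cdot> h = hzero A W (tgt A m)"
  shows "h = hzero A W (src A m)"
proof -
  have [simp]: "m \<in> Ar A"
    using m by (simp add: is_mono_def)
  have "W \<in> Ob A"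
    using h(1) by auto
  then show ?thesis
    using monoD [OF m, of h "hzero A W (src A m)"] h by simp
qed

text \<open>By linearity, two arrows with the same composite may be replaced by their difference,
  whose composite is zero.\<close>

lemma mono_zeroI:
  assumes m: "m \<in> Ar A"
    and 0: "\<And>W h. h \<in> Hom A W (src A m) \<Longrightarrow> m \<cdot> h = hzero A W (tgt A m) \<Longrightarrow> h = hzero A W (src A m)"
  shows "is_mono A m"
  unfolding is_mono_def
proof (intro conjI allI ballI impI)
  fix W f g
  assume fg: "f \<in> Hom A W (src A m)" "g \<in> Hom A W (src A m)" "m \<cdot> f = m \<cdot> g"
  then have "m \<cdot> hdiff f g = hzero A W (tgt A m)"
    using cmp_hdiff(2) [of f g m] m hdiff_eq_hzero_iff [of "m \<cdot> f" W "tgt A m" "m \<cdot> g"] by simp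
  then have "hdiff f g = hzero A W (src A m)"
    by (intro 0) (use fg in simp_all)
  then show "f = g"
    using hdiff_eq_hzero_iff fg by blast
qed (rule m)

text \<open>An arrow killed by \<open>f\<close> factors through \<open>k\<close>, and
  \<open>k\<close> is zero because the identity of its source is. With its converse below, this
  translates the condition on kernels in \<open>iso_mod\<close> into the mono property.\<close>

lemma mono_of_zero_kernel:
  assumes k: "is_kernel A k f" and z: "is_zero_object A (src A k)"
  shows "is_mono A f"
proof (rule mono_zeroI)
  note [simp] = kernelD(1-3) [OF k]
  show "f \<in> Ar A"
    by simp
  fix W h
  assume h: "h \<in> Hom A W (src A f)" "f \<cdot> h = hzero A W (tgt A f)"
  then obtain u where u: "u \<in> Ar A" "src A u = W" "tgt A u = src A k" "k \<cdot> u = h"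
    using kernel_lift [OF k] by metis
  have "k = k \<cdot> ident A (src A k)"
    by simp
  also have "\<dots> = hzero A (src A k) (src A f)"
    using z unfolding is_zero_object_iff by simp
  finally show "h = hzero A W (src A f)"
    using u cmp_hzero_left [of u "src A f" "src A k"] by simp
qed

lemma zero_kernel_of_mono:
  assumes k: "is_kernel A k f" and f: "is_mono A f"
  shows "is_zero_object A (src A k)"
proof -
  note [simp] = kernelD(1-3) [OF k]
  have "k = hzero A (src A k) (src A f)"
    using mono_zeroD [OF f, of k "src A k"] kernelD(4) [OF k] by simp
  moreover have "k \<cdot> hzero A (src A k) (src A k) = hzero A (src A k) (src A f)"
    by simp
  ultimately have "k \<cdot> ident A (src A k) = k \<cdot> hzero A (src A k) (src A k)"
    by simp
  then show ?thesis
    using monoD [OF kernel_mono [OF k], of "ident A (src A k)" "hzero A (src A k) (src A k)"]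
    by (simp add: is_zero_object_iff)
qed

lemma kernel_unique:
  assumes k: "is_kernel A k f" and k': "is_kernel A k' f"
  obtains u where "is_iso A u" "src A u = src A k'" "tgt A u = src A k" "k \<cdot> u = k'"
proof -
  note [simp] = kernelD(1-3) [OF k] kernelD(1-3) [OF k']
  obtain u where u: "u \<in> Ar A" "src A u = src A k'" "tgt A u = src A k" "k \<cdot> u = k'"
    using kernel_lift [OF k, of k' "src A k'"] kernelD(4) [OF k'] by auto
  obtain v where v: "v \<in> Ar A" "src A v = src A k" "tgt A v = src A k'" "k' \<cdot> v = k"
    using kernel_lift [OF k', of k "src A k"] kernelD(4) [OF k] by auto
  have "k \<cdot> u \<cdot> v = k \<cdot> ident A (src A k)"
    using cmp_eq_prefix [OF u(4), of v] u v by simp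
  then have uv: "u \<cdot> v = ident A (src A k)"
    using monoD [OF kernel_mono [OF k], of "u \<cdot> v" "ident A (src A k)"] u v by simp
  have "k' \<cdot> v \<cdot> u = k' \<cdot> ident A (src A k')"
    using cmp_eq_prefix [OF v(4), of u] u v by simp
  then have "v \<cdot> u = ident A (src A k')"
    using monoD [OF kernel_mono [OF k'], of "v \<cdot> u" "ident A (src A k')"] u v by simp
  then have "is_iso A u"
    using uv u v by (intro is_isoI [of u "src A k'" "src A k" v]) simp_all
  then show ?thesis
    using that u by blast
qed

lemma mono_cmp:
  assumes m: "is_mono A m" and n: "is_mono A n" and mn: "tgt A m = src A n"
  shows "is_mono A (n \<cdot> m)"
  unfolding is_mono_def
proof (intro conjI allI ballI impI)
  have [simp]: "m \<in> Ar A" "n \<in> Ar A"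
    using m n by (simp_all add: is_mono_def)
  show "n \<cdot> m \<in> Ar A"
    using mn by simp
  fix W f g
  assume fg: "f \<in> Hom A W (src A (n \<cdot> m))" "g \<in> Hom A W (src A (n \<cdot> m))" "(n \<cdot> m) \<cdot> f = (n \<cdot> m) \<cdot> g"
  then have "n \<cdot> m \<cdot> f = n \<cdot> m \<cdot> g"
    using mn by (simp add: assoc)
  then have "m \<cdot> f = m \<cdot> g"
    using monoD [OF n, of "m \<cdot> f" "m \<cdot> g"] fg mn by simp
  then show "f = g"
    using monoD [OF m, of f g] fg mn by simp
qed

lemma mono_of_cmp:
  assumes nm: "is_mono A (n \<cdot> m)" and m: "m \<in> Ar A" and n: "n \<in> Ar A" "tgt A m = src A n"
  shows "is_mono A m"
  unfolding is_mono_def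
proof (intro conjI allI ballI impI)
  note [simp] = m n
  fix W f g
  assume fg: "f \<in> Hom A W (src A m)" "g \<in> Hom A W (src A m)" "m \<cdot> f = m \<cdot> g"
  then have "(n \<cdot> m) \<cdot> f = (n \<cdot> m) \<cdot> g"
    by (simp add: assoc)
  then show "f = g"
    using monoD [OF nm, of f g] fg by simp
qed (rule m)

lemma kernel_cmp_iso:
  assumes k: "is_kernel A k f" and u: "is_iso A u" "tgt A u = src A k"
  shows "is_kernel A (k \<cdot> u) f"
proof (rule kernelI)
  note [simp] = kernelD(1-3) [OF k] iso_Ar [OF u(1)] u(2)
  show "is_mono A (k \<cdot> u)"
    by (intro mono_cmp iso_mono kernel_mono [OF k] u)
  show "f \<cdot> k \<cdot> u = hzero A (src A (k \<cdot> u)) (tgt A f)"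
    using cmp_eq_prefix [OF kernelD(4) [OF k], of u] by simp
  fix W h
  assume "h \<in> Hom A W (src A f)" "f \<cdot> h = hzero A W (tgt A f)"
  then obtain v where v: "v \<in> Ar A" "src A v = W" "tgt A v = src A k" "k \<cdot> v = h"
    using kernel_lift [OF k] by metis
  obtain u'
    where u': "u' \<in> Ar A" "src A u' = tgt A u" "tgt A u' = src A u" "u \<cdot> u' = ident A (tgt A u)"
    using u(1) by (elim is_isoE)
  have "u \<cdot> u' \<cdot> v = v"
    using cmp_eq_prefix [OF u'(4), of v] u' v by simp
  then have "(k \<cdot> u) \<cdot> u' \<cdot> v = h"
    using u' v by (simp add: assoc)
  then show "\<exists>w \<in> Hom A W (src A (k \<cdot> u)). (k \<cdot> u) \<cdot> w = h"
    using u' v by (intro bexI [of _ "u' \<cdot> v"]) simp_all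
qed (use kernelD [OF k] iso_Ar [OF u(1)] u in simp_all)

lemma kernel_mono_cmp:
  assumes k: "is_kernel A k f" and m: "is_mono A m" "src A m = tgt A f"
  shows "is_kernel A k (m \<cdot> f)"
proof (rule kernelI)
  have [simp]: "m \<in> Ar A"
    using m by (simp add: is_mono_def)
  note [simp] = kernelD(1-3) [OF k] m(2)
  show "is_mono A k"
    by (rule kernel_mono [OF k])
  show "(m \<cdot> f) \<cdot> k = hzero A (src A k) (tgt A (m \<cdot> f))"
    using kernelD(4) [OF k] by (simp add: assoc)
  fix W h
  assume h: "h \<in> Hom A W (src A (m \<cdot> f))" "(m \<cdot> f) \<cdot> h = hzero A W (tgt A (m \<cdot> f))"
  then have "f \<cdot> h = hzero A W (tgt A f)"
    by (intro mono_zeroD [OF m(1), of "f \<cdot> h" W, unfolded m(2)]) (simp_all add: assoc)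
  then show "\<exists>u \<in> Hom A W (src A k). k \<cdot> u = h"
    using kernel_ex1_lift [OF k, of h W] h by (auto simp del: in_Hom)
qed (use m kernelD [OF k] in \<open>simp_all add: is_mono_def\<close>)

text \<open>Here \<open>h\<close> is the fraction f s^-1. An arrow killed by it is moved by s^-1 to
  one killed by \<open>f\<close>, so the kernel of \<open>h\<close> is that of \<open>f\<close>
  followed by \<open>s\<close>.\<close>

lemma kernel_cmp_iso_right:
  assumes k: "is_kernel A k f" and s: "is_iso A s" "src A s = src A f"
    and h: "h \<in> Ar A" "src A h = tgt A s" "h \<cdot> s = f"
  shows "is_kernel A (s \<cdot> k) h"
proof (rule kernelI)
  note [simp] = kernelD(1-3) [OF k] iso_Ar [OF s(1)] s(2) h(1,2)
  have tf: "tgt A h = tgt A f"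
    using h by auto
  show "is_mono A (s \<cdot> k)"
    by (intro mono_cmp iso_mono kernel_mono [OF k] s) simp
  show "h \<cdot> s \<cdot> k = hzero A (src A (s \<cdot> k)) (tgt A h)"
    using cmp_eq_prefix [OF h(3), of k] kernelD(4) [OF k] tf by simp
  fix W g
  assume g: "g \<in> Hom A W (src A h)" "h \<cdot> g = hzero A W (tgt A h)"
  obtain s'
    where s': "s' \<in> Ar A" "src A s' = tgt A s" "tgt A s' = src A s" "s \<cdot> s' = ident A (tgt A s)"
    using s(1) by (elim is_isoE)
  have ss: "s \<cdot> s' \<cdot> g = g"
    using cmp_eq_prefix [OF s'(4), of g] s' g by simp
  then have "f \<cdot> s' \<cdot> g = hzero A W (tgt A f)"
    using assoc [of "s' \<cdot> g" s h] h g s' tf by simp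
  then obtain v where v: "v \<in> Ar A" "src A v = W" "tgt A v = src A k" "k \<cdot> v = s' \<cdot> g"
    using kernel_lift [OF k, of "s' \<cdot> g" W] s' g by auto
  then have "(s \<cdot> k) \<cdot> v = g"
    using ss by (simp add: assoc)
  then show "\<exists>u \<in> Hom A W (src A (s \<cdot> k)). (s \<cdot> k) \<cdot> u = g"
    using v by (intro bexI [of _ v]) simp_all
qed (use kernelD [OF k] iso_Ar [OF s(1)] s h in simp_all)

text \<open>The identity of X is killed by the zero arrow, so it lifts to a right inverse of the
  mono \<open>k\<close>, which is then two-sided.\<close>

lemma kernel_hzero_iso:
  assumes k: "is_kernel A k (hzero A X Y)" and XY: "X \<in> Ob A" "Y \<in> Ob A"
  shows "is_iso A k"
proof -
  note [simp] = kernelD(1-3) [OF k] XY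
  have tk: "tgt A k = X"
    using kernelD(3) [OF k] XY by simp
  obtain u where u: "u \<in> Ar A" "src A u = X" "tgt A u = src A k" "k \<cdot> u = ident A X"
    using kernel_lift [OF k, of "ident A X" X] XY by auto
  have "k \<cdot> u \<cdot> k = k \<cdot> ident A (src A k)"
    using cmp_eq_prefix [OF u(4), of k] u tk by simp
  then have "u \<cdot> k = ident A (src A k)"
    using monoD [OF kernel_mono [OF k], of "u \<cdot> k" "ident A (src A k)"] u tk by simp
  then show ?thesis
    using u tk by (intro is_isoI [of k "src A k" X u]) simp_all
qed

text \<open>Here \<open>q \<cdot> k\<close> is the base change of \<open>s\<close> along \<open>f\<close>.\<close>

lemma pullback_iso:
  assumes P: "is_biproduct A X Y P i j p q" and s: "is_iso A s" "src A s = X"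
    and f: "f \<in> Hom A Y (tgt A s)" and k: "is_kernel A k (hdiff (s \<cdot> p) (f \<cdot> q))"
  shows "is_iso A (q \<cdot> k)"
proof -
  have P': "P \<in> Ob A" "i \<in> Ar A" "src A i = X" "tgt A i = P" "j \<in> Ar A" "src A j = Y" "tgt A j = P"
    "p \<in> Ar A" "src A p = P" "tgt A p = X" "q \<in> Ar A" "src A q = P" "tgt A q = Y"
    "p \<cdot> i = ident A X" "q \<cdot> j = ident A Y" "q \<cdot> i = hzero A X Y" "p \<cdot> j = hzero A Y X"
    "hadd A (i \<cdot> p) (j \<cdot> q) = ident A P"
    using P unfolding is_biproduct_def by auto
  have [simp]: "X \<in> Ob A" "Y \<in> Ob A"
    using src_in_Ob [of i] src_in_Ob [of j] P' by simp_all
  have f' [simp]: "f \<in> Ar A" "src A f = Y" "tgt A f = tgt A s"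
    using f by simp_all
  let ?d = "hdiff (s \<cdot> p) (f \<cdot> q)"
  note [simp] = P'(1-13) s(2) iso_Ar [OF s(1)]
  have k' [simp]: "k \<in> Ar A" "tgt A k = P"
    using kernelD [OF k] by simp_all
  obtain s' where s': "s' \<in> Ar A" "src A s' = tgt A s" "tgt A s' = src A s"
    "s' \<cdot> s = ident A X" "s \<cdot> s' = ident A (tgt A s)"
    using s by (elim is_isoE) auto
  note [simp] = s'(1-3)
  have "hdiff ((s \<cdot> p) \<cdot> k) ((f \<cdot> q) \<cdot> k) = hzero A (src A k) (tgt A s)"
    using kernelD(4) [OF k] cmp_hdiff(1) [of k "s \<cdot> p" "f \<cdot> q"] by simp
  then have "(s \<cdot> p) \<cdot> k = (f \<cdot> q) \<cdot> k"
    using hdiff_eq_hzero_iff [of "(s \<cdot> p) \<cdot> k" "src A k" "tgt A s" "(f \<cdot> q) \<cdot> k"] by simp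
  then have comm: "s \<cdot> p \<cdot> k = f \<cdot> q \<cdot> k"
    by (simp add: assoc)
  \<comment> \<open>The arrow from Y to the biproduct with components s^-1 f and the identity, that
    is, the graph of s^-1 f. It lies in the kernel, and its lift is the inverse of
    \<open>q \<cdot> k\<close>.\<close>
  let ?h = "hadd A (i \<cdot> s' \<cdot> f) j"
  have ph: "p \<cdot> ?h = s' \<cdot> f"
    using cmp_hadd(2) [of "i \<cdot> s' \<cdot> f" j p] cmp_eq_prefix [OF P'(14), of "s' \<cdot> f"] P'(17)
      hadd_group(4) [of "s' \<cdot> f" Y X "s' \<cdot> f" "s' \<cdot> f"] by simp
  have qh: "q \<cdot> ?h = ident A Y"
    using cmp_hadd(2) [of "i \<cdot> s' \<cdot> f" j q] cmp_eq_prefix [OF P'(16), of "s' \<cdot> f"] P'(15)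
      hadd_group(3) [of "ident A Y" Y Y "ident A Y" "ident A Y"] by simp
  have "s \<cdot> s' \<cdot> f = f"
    using cmp_eq_prefix [OF s'(5), of f] by simp
  then have "(s \<cdot> p) \<cdot> ?h = (f \<cdot> q) \<cdot> ?h"
    using ph qh by (simp add: assoc)
  then have "?d \<cdot> ?h = hzero A Y (tgt A ?d)"
    using cmp_hdiff(1) [of ?h "s \<cdot> p" "f \<cdot> q"]
      hdiff_eq_hzero_iff [of "(s \<cdot> p) \<cdot> ?h" Y "tgt A s" "(f \<cdot> q) \<cdot> ?h"] by simp
  then obtain w where w: "w \<in> Ar A" "src A w = Y" "tgt A w = src A k" "k \<cdot> w = ?h"
    using kernel_lift [OF k, of ?h Y] by auto
  have "hadd A ((i \<cdot> p) \<cdot> k) ((j \<cdot> q) \<cdot> k) = k"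
    using cmp_hadd(1) [of k "i \<cdot> p" "j \<cdot> q"] P'(18) by simp
  then have ipjq: "hadd A (i \<cdot> p \<cdot> k) (j \<cdot> q \<cdot> k) = k"
    by (simp add: assoc)
  have "s' \<cdot> f \<cdot> q \<cdot> k = p \<cdot> k"
    using comm cmp_eq_prefix [OF s'(4), of "p \<cdot> k"] by simp
  then have "?h \<cdot> q \<cdot> k = k"
    using cmp_hadd(1) [of "q \<cdot> k" "i \<cdot> s' \<cdot> f" j] ipjq by (simp add: assoc)
  then have "k \<cdot> w \<cdot> q \<cdot> k = k \<cdot> ident A (src A k)"
    using cmp_eq_prefix [OF w(4), of "q \<cdot> k"] w by simp
  then have "w \<cdot> q \<cdot> k = ident A (src A k)"
    using monoD [OF kernel_mono [OF k], of "w \<cdot> q \<cdot> k" "ident A (src A k)"] w by simp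
  moreover have "(q \<cdot> k) \<cdot> w = ident A Y"
    using qh w by (simp add: assoc)
  ultimately show ?thesis
    using w by (intro is_isoI [of _ "src A k" Y w]) simp_all
qed

end

section \<open>Cokernels, by passing to the opposite category\<close>

lemma lopp_lopp [simp]: "lopp (lopp A) = A"
  by (simp add: lopp_def)

context linear_category
begin

lemma cokernelD:
  assumes "is_cokernel A c f"
  shows "c \<in> Ar A" "f \<in> Ar A" "src A c = tgt A f" "c \<cdot> f = hzero A (src A f) (tgt A c)"
  using assms by (auto simp: is_cokernel_def)

lemma cokernel_desc:
  assumes "is_cokernel A c f" "h \<in> Hom A (tgt A f) W" "h \<cdot> f = hzero A (src A f) W"
  obtains u where "u \<in> Ar A" "src A u = tgt A c" "tgt A u = W" "u \<cdot> c = h"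
  using linear_category.kernel_lift [OF linear_category_lopp, of c f h W] assms by auto

lemma cokernel_epi: "is_cokernel A c f \<Longrightarrow> is_epi A c"
  using linear_category.kernel_mono [OF linear_category_lopp] by simp

lemma epi_of_zero_cokernel:
  "is_cokernel A c f \<Longrightarrow> is_zero_object A (tgt A c) \<Longrightarrow> is_epi A f"
  using linear_category.mono_of_zero_kernel [OF linear_category_lopp] by simp

lemma zero_cokernel_of_epi:
  "is_cokernel A c f \<Longrightarrow> is_epi A f \<Longrightarrow> is_zero_object A (tgt A c)"
  using linear_category.zero_kernel_of_mono [OF linear_category_lopp] by simp

lemma cokernel_unique:
  assumes "is_cokernel A c f" "is_cokernel A c' f"
  obtains u where "is_iso A u" "src A u = tgt A c" "tgt A u = tgt A c'" "u \<cdot> c = c'"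
  using linear_category.kernel_unique [OF linear_category_lopp, of c f c'] assms by auto

lemma iso_cmp_cokernel:
  "is_cokernel A c f \<Longrightarrow> is_iso A u \<Longrightarrow> src A u = tgt A c \<Longrightarrow> is_cokernel A (u \<cdot> c) f"
  using linear_category.kernel_cmp_iso [OF linear_category_lopp, of c f u] by simp

lemma kernel_cancel_mono:
  assumes k: "is_kernel A k (m \<cdot> f)" and m: "is_mono A m" "src A m = tgt A f" and f: "f \<in> Ar A"
  shows "is_kernel A k f"
proof (rule kernelI)
  have [simp]: "m \<in> Ar A"
    using m by (simp add: is_mono_def)
  note [simp] = f m(2)
  have k' [simp]: "k \<in> Ar A" "tgt A k = src A f"
    using kernelD [OF k] by simp_all
  show "is_mono A k"
    by (rule kernel_mono [OF k])
  have "m \<cdot> f \<cdot> k = hzero A (src A k) (tgt A m)"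
    using kernelD(4) [OF k] by (simp add: assoc)
  then show "f \<cdot> k = hzero A (src A k) (tgt A f)"
    by (intro mono_zeroD [OF m(1), of "f \<cdot> k" "src A k", unfolded m(2)]) simp_all
  fix W h
  assume h: "h \<in> Hom A W (src A f)" "f \<cdot> h = hzero A W (tgt A f)"
  moreover from this have "W \<in> Ob A"
    by auto
  ultimately have "(m \<cdot> f) \<cdot> h = hzero A W (tgt A (m \<cdot> f))"
    by (simp add: assoc)
  then show "\<exists>u \<in> Hom A W (src A k). k \<cdot> u = h"
    using kernel_ex1_lift [OF k, of h W] h by (auto simp del: in_Hom)
qed (use f kernelD [OF k] m in \<open>simp_all add: is_mono_def\<close>)

end

section \<open>Abelian categories\<close>

context abelian_category
begin

text \<open>The axioms are self-dual or come in dual pairs. Statements on cokernels and epis can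
  therefore be obtained from those on kernels and monos.\<close>

lemma abelian_category_lopp: "abelian_category R (lopp A)"
proof (intro abelian_category.intro abelian_category_axioms.intro linear_category_lopp)
  show "\<exists>Z. is_zero_object (lopp A) Z"
    using ex_zero_object by simp
  show "\<exists>P i j p q. is_biproduct (lopp A) X Y P i j p q"
    if "X \<in> Ob (lopp A)" "Y \<in> Ob (lopp A)" for X Y
    using ex_biproduct [of X Y] that is_biproduct_lopp [of A] by (metis lopp_simps(1))
qed (auto simp: ex_kernel ex_cokernel intro: mono_is_kernel epi_is_cokernel)

text \<open>Write \<open>m\<close> as the kernel of some f. Since f m = 0 and \<open>m\<close> is
  epi, f is zero, and the kernel of a zero arrow is invertible.\<close>

lemma mono_epi_iso:
  assumes m: "is_mono A m" and e: "is_epi A m"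
  shows "is_iso A m"
proof -
  obtain f where k: "is_kernel A m f"
    using mono_is_kernel [OF m] by blast
  note [simp] = kernelD(1-3) [OF k]
  have "f = hzero A (tgt A m) (tgt A f)"
    by (rule epiD [OF e]) (simp_all add: kernelD(4) [OF k])
  then have "is_kernel A m (hzero A (tgt A m) (tgt A f))"
    by (rule subst) (rule k)
  then show ?thesis
    by (rule kernel_hzero_iso) simp_all
qed

text \<open>The mono is the kernel of some f by axiom. As f kills \<open>m\<close>, it factors
  through the cokernel \<open>c\<close>, so whatever \<open>c\<close> kills is killed by f and lifts
  to \<open>m\<close>.\<close>

lemma kernel_of_cokernel:
  assumes m: "is_mono A m" and c: "is_cokernel A c m"
  shows "is_kernel A m c"
proof (rule kernelI [OF m])
  note [simp] = cokernelD(1-3) [OF c]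
  show "c \<cdot> m = hzero A (src A m) (tgt A c)"
    by (rule cokernelD [OF c])
  fix W h
  assume h: "h \<in> Hom A W (src A c)" "c \<cdot> h = hzero A W (tgt A c)"
  obtain f where k: "is_kernel A m f"
    using mono_is_kernel [OF m] by blast
  note [simp] = kernelD(2,3) [OF k]
  obtain f' where f': "f' \<in> Ar A" "src A f' = tgt A c" "tgt A f' = tgt A f" "f' \<cdot> c = f"
    using cokernel_desc [OF c, of f "tgt A f"] kernelD [OF k] by auto
  moreover from h have "W \<in> Ob A"
    by auto
  ultimately have "f \<cdot> h = hzero A W (tgt A f)"
    using assoc [of h c f'] h by simp
  then show "\<exists>u \<in> Hom A W (src A m). m \<cdot> u = h"
    using kernel_ex1_lift [OF k, of h W] h by (auto simp del: in_Hom)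
qed (use cokernelD [OF c] in simp_all)

lemma cokernel_of_kernel:
  "is_epi A e \<Longrightarrow> is_kernel A k e \<Longrightarrow> is_cokernel A e k"
  using abelian_category.kernel_of_cokernel [OF abelian_category_lopp, of e k] by simp

text \<open>The image \<open>m\<close> is the kernel of the cokernel \<open>c\<close>; the work is
  to show that \<open>e\<close> is epi. If g e = 0, then e factors through the kernel k of g, so f
  factors through the mono m k. The cokernel d of m k then kills f, hence factors through
  \<open>c\<close>, hence kills \<open>m\<close>. As m k is the kernel of d, \<open>m\<close>
  factors through m k, so k has a right inverse and g = 0.\<close>

lemma image_factorisation:
  assumes f: "f \<in> Ar A"
  obtains m e c where "is_cokernel A c f" "is_kernel A m c" "is_mono A m" "is_epi A e"
    "tgt A e = src A m" "src A e = src A f" "tgt A m = tgt A f" "m \<cdot> e = f"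
proof -
  obtain c where c: "is_cokernel A c f"
    using ex_cokernel [OF f] by blast
  note c' [simp] = cokernelD(1-3) [OF c]
  obtain m where m: "is_kernel A m c"
    using ex_kernel [of c] by auto
  note m' [simp] = kernelD(1-3) [OF m]
  obtain e where e: "e \<in> Ar A" "src A e = src A f" "tgt A e = src A m" "m \<cdot> e = f"
    using kernel_lift [OF m, of f "src A f"] cokernelD(4) [OF c] by auto
  note [simp] = e(1-3)
  \<comment> \<open>Epi is tested as mono in the opposite category, where it suffices to cancel
    against zero.\<close>
  have "is_mono (lopp A) e"
  proof (rule linear_category.mono_zeroI [OF linear_category_lopp])
    fix W g
    assume "g \<in> Hom (lopp A) W (src (lopp A) e)" and
      "e \<cdot>\<^bsub>lopp A\<^esub> g = hzero (lopp A) W (tgt (lopp A) e)"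
    then have g [simp]: "g \<in> Ar A" "src A g = src A m" "tgt A g = W" and
      ge: "g \<cdot> e = hzero A (src A f) W"
      by simp_all
    have W [simp]: "W \<in> Ob A"
      using tgt_in_Ob [OF g(1)] by simp
    obtain k where k: "is_kernel A k g"
      using ex_kernel [of g] by auto
    note [simp] = kernelD(1-3) [OF k]
    obtain e' where e': "e' \<in> Ar A" "src A e' = src A f" "tgt A e' = src A k" "k \<cdot> e' = e"
      using kernel_lift [OF k, of e "src A f"] ge by auto
    have mk: "is_mono A (m \<cdot> k)"
      by (intro mono_cmp kernel_mono [OF k] kernel_mono [OF m]) simp
    obtain d where d: "is_cokernel A d (m \<cdot> k)"
      using ex_cokernel [of "m \<cdot> k"] by auto
    have d' [simp]: "d \<in> Ar A" "src A d = tgt A f"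
      using cokernelD [OF d] by simp_all
    have "d \<cdot> f = (d \<cdot> m \<cdot> k) \<cdot> e'"
      using e' e(4) by (simp add: assoc)
    also have "\<dots> = hzero A (src A f) (tgt A d)"
      using cokernelD(4) [OF d] e' by simp
    finally obtain b where b: "b \<in> Ar A" "src A b = tgt A c" "tgt A b = tgt A d" "b \<cdot> c = d"
      using cokernel_desc [OF c, of d "tgt A d"] by auto
    have "d \<cdot> m = hzero A (src A m) (tgt A d)"
      using assoc [of m c b] b kernelD(4) [OF m] by simp
    then obtain v where v: "v \<in> Ar A" "src A v = src A m" "tgt A v = src A k" "(m \<cdot> k) \<cdot> v = m"
      using kernel_lift [OF kernel_of_cokernel [OF mk d], of m "src A m"] by auto
    then have "m \<cdot> k \<cdot> v = m \<cdot> ident A (src A m)"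
    by (simp add: assoc)
    then have "k \<cdot> v = ident A (src A m)"
      using monoD [OF kernel_mono [OF m], of "k \<cdot> v" "ident A (src A m)"] v by simp
    then have "g = g \<cdot> k \<cdot> v"
    by simp
    also have "\<dots> = hzero A (src A m) W"
      using cmp_eq_prefix [OF kernelD(4) [OF k], of v] v by simp
    finally show "g = hzero (lopp A) W (src (lopp A) e)"
      by simp
  qed simp
  then show ?thesis
    using c m kernel_mono [OF m] e kernelD [OF m] by (intro that [of c m e]) simp_all
qed

end

section \<open>Exact functors\<close>

context is_functor
begin

lemma fAr_simps [simp]:
  assumes "f \<in> Ar A"
  shows "fAr F f \<in> Ar B" "src B (fAr F f) = fOb F (src A f)" "tgt B (fAr F f) = fOb F (tgt A f)"
  using fAr_in_Hom [OF assms] by simp_all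

declare fOb_in_Ob [simp]

lemma fAr_comp:
  "\<lbrakk>f \<in> Ar A; g \<in> Ar A; tgt A f = src A g\<rbrakk> \<Longrightarrow> fAr F (g \<cdot>\<^bsub>A\<^esub> f) = fAr F g \<cdot>\<^bsub>B\<^esub> fAr F f"
  using fAr_cmp [of f "src A f" "src A g" g "tgt A g"] by simp

lemma fAr_iso:
  assumes "is_iso A f"
  shows "is_iso B (fAr F f)"
proof -
  note [simp] = A.iso_Ar [OF assms]
  obtain g where g: "g \<in> Ar A" "src A g = tgt A f" "tgt A g = src A f"
    "g \<cdot>\<^bsub>A\<^esub> f = ident A (src A f)" "f \<cdot>\<^bsub>A\<^esub> g = ident A (tgt A f)"
    using assms by (elim A.is_isoE)
  show ?thesis
    using g fAr_comp [of f g] fAr_comp [of g f]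
    by (intro B.is_isoI [of _ "fOb F (src A f)" "fOb F (tgt A f)" "fAr F g"])
      (simp_all add: fAr_ident)
qed

end

context linear_functor
begin

lemma fAr_hzero:
  assumes "X \<in> Ob A" "Y \<in> Ob A"
  shows "fAr F (hzero A X Y) = hzero B (fOb F X) (fOb F Y)"
proof -
  let ?z = "hzero A X Y"
  have "hsmult A \<zero>\<^bsub>R\<^esub> ?z = ?z"
    using assms by (simp add: A.hsmult_zero)
  then have "fAr F ?z = hsmult B \<zero>\<^bsub>R\<^esub> (fAr F ?z)"
    using fAr_hsmult [of "\<zero>\<^bsub>R\<^esub>" ?z] assms by simp
  also have "\<dots> = hzero B (fOb F X) (fOb F Y)"
    using assms by (simp add: B.hsmult_zero)
  finally show ?thesis .
qed

lemma fAr_hdiff: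
  assumes "f \<in> Ar A" "g \<in> Ar A" "src A f = src A g" "tgt A f = tgt A g"
  shows "fAr F (A.hdiff f g) = B.hdiff (fAr F f) (fAr F g)"
  using assms fAr_hadd [of f "src A f" "tgt A f" "hsmult A (\<ominus>\<^bsub>R\<^esub> \<one>\<^bsub>R\<^esub>) g"]
  by (simp add: A.hdiff_def B.hdiff_def fAr_hsmult)

lemma fOb_zero: "is_zero_object A Z \<Longrightarrow> is_zero_object B (fOb F Z)"
  using fAr_ident [of Z] fAr_hzero [of Z Z]
  by (auto simp: A.is_zero_object_iff B.is_zero_object_iff)

text \<open>Biproducts are encoded by equations between composites and sums, which any linear
  functor respects. This is applied both to \<open>F\<close> and to the projection onto the
  quotient.\<close>

lemma fAr_biproduct:
  assumes "is_biproduct A X Y P i j p q" "X \<in> Ob A" "Y \<in> Ob A"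
  shows "is_biproduct B (fOb F X) (fOb F Y) (fOb F P) (fAr F i) (fAr F j) (fAr F p) (fAr F q)"
proof -
  have [simp]: "P \<in> Ob A" "i \<in> Ar A" "src A i = X" "tgt A i = P" "j \<in> Ar A" "src A j = Y"
    "tgt A j = P" "p \<in> Ar A" "src A p = P" "tgt A p = X" "q \<in> Ar A" "src A q = P" "tgt A q = Y" and
    eqs: "p \<cdot>\<^bsub>A\<^esub> i = ident A X" "q \<cdot>\<^bsub>A\<^esub> j = ident A Y" "q \<cdot>\<^bsub>A\<^esub> i = hzero A X Y"
    "p \<cdot>\<^bsub>A\<^esub> j = hzero A Y X" "hadd A (i \<cdot>\<^bsub>A\<^esub> p) (j \<cdot>\<^bsub>A\<^esub> q) = ident A P"
    using assms unfolding is_biproduct_def by auto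
  show ?thesis
    unfolding is_biproduct_def
    using fAr_hadd [of "i \<cdot>\<^bsub>A\<^esub> p" P P "j \<cdot>\<^bsub>A\<^esub> q"] fAr_comp [of i p] fAr_comp [of j q] fAr_comp [of i q]
      fAr_comp [of j p] fAr_comp [of p i] fAr_comp [of q j] assms(2,3)
    by (simp add: eqs fAr_ident fAr_hzero)
qed

end

context exact_functor
begin

text \<open>Exactness is stated through short exact sequences, a self-dual notion, so the same
  \<open>F\<close> is exact between the opposites.\<close>

lemma exact_functor_lopp: "exact_functor R (lopp A) (lopp B) F"
proof (intro exact_functor.intro linear_functor.intro is_functor.intro is_functor_axioms.intro
    linear_functor_axioms.intro exact_functor_axioms.intro A.abelian_category_lopp
    B.abelian_category_lopp A.linear_category_lopp B.linear_category_lopp)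
  show "category (lopp A)" "category (lopp B)"
    using A.linear_category_lopp B.linear_category_lopp by (simp_all add: linear_category_def)
qed (auto simp: fAr_ident fAr_comp fAr_hadd fAr_hsmult short_exact_lopp intro: fAr_short_exact)

text \<open>A mono together with its cokernel is a short exact sequence, and \<open>F\<close> sends
  its first arrow to a kernel.\<close>

lemma fAr_mono:
  assumes m: "is_mono A m"
  shows "is_mono B (fAr F m)"
proof -
  obtain c where c: "is_cokernel A c m"
    using A.ex_cokernel [of m] m by (auto simp: is_mono_def)
  then have "short_exact B (fAr F m) (fAr F c)"
    using A.kernel_of_cokernel [OF m c] by (intro fAr_short_exact) (simp add: short_exact_def)
  then show ?thesis
    using B.kernel_mono by (auto simp: short_exact_def)
qed

lemma fAr_epi: "is_epi A e \<Longrightarrow> is_epi B (fAr F e)"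
  using exact_functor.fAr_mono [OF exact_functor_lopp, of e] by simp

text \<open>Exactness only speaks of short exact sequences, so the kernel of an arbitrary f = m e is
  first recognised as the kernel of the epi part e. There \<open>k\<close> and e form such a
  sequence, and composing with the mono \<open>fAr F m\<close> does not change the kernel.\<close>

lemma fAr_kernel:
  assumes k: "is_kernel A k f"
  shows "is_kernel B (fAr F k) (fAr F f)"
proof -
  obtain m e where me: "is_mono A m" "is_epi A e" "tgt A e = src A m" "m \<cdot>\<^bsub>A\<^esub> e = f"
    using A.image_factorisation [OF A.kernelD(2) [OF k]] by metis
  have [simp]: "m \<in> Ar A" "e \<in> Ar A"
    using me by (simp_all add: is_mono_def is_epi_def)
  have ke: "is_kernel A k e"
    by (rule A.kernel_cancel_mono [of _ m]) (use k me in simp_all)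
  then have "short_exact B (fAr F k) (fAr F e)"
    using A.cokernel_of_kernel [OF me(2) ke] by (intro fAr_short_exact) (simp add: short_exact_def)
  then have "is_kernel B (fAr F k) (fAr F m \<cdot>\<^bsub>B\<^esub> fAr F e)"
    using fAr_mono [OF me(1)] me by (intro B.kernel_mono_cmp) (simp_all add: short_exact_def)
  then show ?thesis
    using fAr_comp [of e m] me by simp
qed

lemma fAr_cokernel: "is_cokernel A c f \<Longrightarrow> is_cokernel B (fAr F c) (fAr F f)"
  using exact_functor.fAr_kernel [OF exact_functor_lopp, of c f] by simp

text \<open>\<open>F\<close> carries kernel and cokernel of \<open>s\<close> to those of
  \<open>fAr F s\<close>, and in an abelian category an arrow with zero kernel and zero cokernel is
  invertible. Membership in \<open>iso_mod\<close> thereby becomes a condition in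
  \<open>B\<close>.\<close>

lemma iso_mod_iff:
  "s \<in> iso_mod A (functor_kernel A B F) \<longleftrightarrow> s \<in> Ar A \<and> is_iso B (fAr F s)"
proof
  assume s: "s \<in> iso_mod A (functor_kernel A B F)"
  then obtain k c where "is_kernel A k s" "is_zero_object B (fOb F (src A k))"
    "is_cokernel A c s" "is_zero_object B (fOb F (tgt A c))"
    by (auto simp: iso_mod_def functor_kernel_def)
  then have "is_mono B (fAr F s)" "is_epi B (fAr F s)"
    using B.mono_of_zero_kernel [OF fAr_kernel] B.epi_of_zero_cokernel [OF fAr_cokernel]
      A.kernelD A.cokernelD by auto
  then show "s \<in> Ar A \<and> is_iso B (fAr F s)"
    using s B.mono_epi_iso by (auto simp: iso_mod_def)
next
  assume s: "s \<in> Ar A \<and> is_iso B (fAr F s)"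
  then obtain k c where k: "is_kernel A k s" and c: "is_cokernel A c s"
    using A.ex_kernel A.ex_cokernel by blast
  have "is_epi B (fAr F s)"
    using s by
      (metis is_iso_lopp is_mono_lopp category.iso_mono linear_category_def B.linear_category_lopp)
  then have "is_zero_object B (fOb F (src A k))" "is_zero_object B (fOb F (tgt A c))"
    using B.zero_kernel_of_mono [OF fAr_kernel [OF k]] B.zero_cokernel_of_epi
      [OF fAr_cokernel [OF c]]
      B.iso_mono s A.kernelD [OF k] A.cokernelD [OF c] by auto
  then show "s \<in> iso_mod A (functor_kernel A B F)"
    using s k c A.kernelD [OF k] A.cokernelD [OF c] by (auto simp: iso_mod_def functor_kernel_def)
qed

text \<open>The base change of s along f, built as the kernel of s p - f q on the biproduct.
  \<open>F\<close> preserves this construction, and in \<open>B\<close> the base change of an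
  isomorphism is an isomorphism.\<close>

lemma ore:
  assumes s: "s \<in> Ar A" "is_iso B (fAr F s)" and f: "f \<in> Ar A" "tgt A f = tgt A s"
  obtains u v where "u \<in> Ar A" "v \<in> Ar A" "src A u = src A v" "tgt A u = src A f"
    "tgt A v = src A s" "f \<cdot>\<^bsub>A\<^esub> u = s \<cdot>\<^bsub>A\<^esub> v" "is_iso B (fAr F u)"
proof -
  note [simp] = s(1) f
  obtain P i j p q where P: "is_biproduct A (src A s) (src A f) P i j p q"
    using A.ex_biproduct [of "src A s" "src A f"] by auto
  have P' [simp]: "P \<in> Ob A" "p \<in> Ar A" "src A p = P" "tgt A p = src A s" "q \<in> Ar A" "src A q = P"
    "tgt A q = src A f"
    using P unfolding is_biproduct_def by auto
  obtain k where k: "is_kernel A k (A.hdiff (s \<cdot>\<^bsub>A\<^esub> p) (f \<cdot>\<^bsub>A\<^esub> q))"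
    using A.ex_kernel [of "A.hdiff (s \<cdot>\<^bsub>A\<^esub> p) (f \<cdot>\<^bsub>A\<^esub> q)"] by auto
  have [simp]: "k \<in> Ar A" "tgt A k = P"
    using A.kernelD [OF k] by simp_all
  have "is_iso B (fAr F q \<cdot>\<^bsub>B\<^esub> fAr F k)"
    using fAr_kernel [OF k]
    by (intro B.pullback_iso [OF fAr_biproduct [OF P] s(2), of "fAr F f"])
      (simp_all add: fAr_hdiff fAr_comp)
  moreover have "A.hdiff ((s \<cdot>\<^bsub>A\<^esub> p) \<cdot>\<^bsub>A\<^esub> k) ((f \<cdot>\<^bsub>A\<^esub> q) \<cdot>\<^bsub>A\<^esub> k) = hzero A (src A k) (tgt A s)"
    using A.kernelD(4) [OF k] A.cmp_hdiff(1) [of k "s \<cdot>\<^bsub>A\<^esub> p" "f \<cdot>\<^bsub>A\<^esub> q"] by simp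
  then have "(s \<cdot>\<^bsub>A\<^esub> p) \<cdot>\<^bsub>A\<^esub> k = (f \<cdot>\<^bsub>A\<^esub> q) \<cdot>\<^bsub>A\<^esub> k"
    using A.hdiff_eq_hzero_iff [of "(s \<cdot>\<^bsub>A\<^esub> p) \<cdot>\<^bsub>A\<^esub> k" "src A k" "tgt A s" "(f \<cdot>\<^bsub>A\<^esub> q) \<cdot>\<^bsub>A\<^esub> k"] by simp
  ultimately show ?thesis
    using that [of "q \<cdot>\<^bsub>A\<^esub> k" "p \<cdot>\<^bsub>A\<^esub> k"] by (simp add: A.assoc fAr_comp)
qed

text \<open>The equaliser is the kernel of f - g. As \<open>F\<close> sends the difference to zero,
  it sends the equaliser to the kernel of a zero arrow, which is invertible.\<close>

lemma ex_equaliser_inverted: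
  assumes fg: "fAr F f = fAr F g" and f: "f \<in> Ar A"
    and g: "g \<in> Ar A" "src A f = src A g" "tgt A f = tgt A g"
  obtains w where "w \<in> Ar A" "tgt A w = src A f" "f \<cdot>\<^bsub>A\<^esub> w = g \<cdot>\<^bsub>A\<^esub> w" "is_iso B (fAr F w)"
proof -
  note [simp] = f g
  obtain w where w: "is_kernel A w (A.hdiff f g)"
    using A.ex_kernel [of "A.hdiff f g"] by auto
  have [simp]: "w \<in> Ar A" "tgt A w = src A g"
    using A.kernelD [OF w] by simp_all
  have "fAr F (A.hdiff f g) = hzero B (fOb F (src A g)) (fOb F (tgt A g))"
    using fg B.hdiff_eq_hzero_iff [of "fAr F f" "fOb F (src A g)" "fOb F (tgt A g)" "fAr F g"]
    by (simp add: fAr_hdiff)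
  then have "is_iso B (fAr F w)"
    using B.kernel_hzero_iso [of "fAr F w" "fOb F (src A g)" "fOb F (tgt A g)"] fAr_kernel [OF w]
    by simp
  moreover have "A.hdiff (f \<cdot>\<^bsub>A\<^esub> w) (g \<cdot>\<^bsub>A\<^esub> w) = hzero A (src A w) (tgt A g)"
    using A.kernelD(4) [OF w] A.cmp_hdiff(1) [of w f g] by simp
  then have "f \<cdot>\<^bsub>A\<^esub> w = g \<cdot>\<^bsub>A\<^esub> w"
    using A.hdiff_eq_hzero_iff [of "f \<cdot>\<^bsub>A\<^esub> w" "src A w" "tgt A g" "g \<cdot>\<^bsub>A\<^esub> w"] by simp
  ultimately show ?thesis
    by (intro that [of w]) simp_all
qed

end

section \<open>Fractions\<close>

text \<open>The images in \<open>B\<close> of the arrows \<open>X \<rightarrow> Y\<close> of the localisation of \<open>A\<close> at the arrows inverted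
  by \<open>F\<close>.\<close>

definition fractions ::
    "('o, 'm, 'r) linear_cat \<Rightarrow> ('p, 'n, 'r) linear_cat \<Rightarrow> ('o, 'm, 'p, 'n) cfunctor \<Rightarrow>
     'o \<Rightarrow> 'o \<Rightarrow> 'n set" where
  "fractions A B F X Y = {h \<in> Hom B (fOb F X) (fOb F Y). \<exists>s f. s \<in> Ar A \<and> f \<in> Ar A \<and>
     src A s = src A f \<and> tgt A s = X \<and> tgt A f = Y \<and> is_iso B (fAr F s) \<and>
     h \<cdot>\<^bsub>B\<^esub> fAr F s = fAr F f}"

lemma fractionsI:
  assumes "h \<in> Hom B (fOb F X) (fOb F Y)" "s \<in> Ar A" "f \<in> Ar A" "src A s = src A f"
    "tgt A s = X" "tgt A f = Y" "is_iso B (fAr F s)" "h \<cdot>\<^bsub>B\<^esub> fAr F s = fAr F f"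
  shows "h \<in> fractions A B F X Y"
  using assms unfolding fractions_def by blast

lemma fractionsE:
  assumes "h \<in> fractions A B F X Y"
  obtains s f where "s \<in> Ar A" "f \<in> Ar A" "src A s = src A f" "tgt A s = X" "tgt A f = Y"
    "is_iso B (fAr F s)" "h \<cdot>\<^bsub>B\<^esub> fAr F s = fAr F f"
  using assms unfolding fractions_def by blast

lemma fractions_Hom:
  assumes "h \<in> fractions A B F X Y"
  shows "h \<in> Ar B" "src B h = fOb F X" "tgt B h = fOb F Y"
  using assms by (simp_all add: fractions_def)

context exact_functor
begin

lemma fractions_Ob:
  assumes "h \<in> fractions A B F X Y"
  shows "X \<in> Ob A" "Y \<in> Ob A"
  using assms by (auto elim: fractionsE)

lemma fAr_fraction: "f \<in> Ar A \<Longrightarrow> fAr F f \<in> fractions A B F (src A f) (tgt A f)"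
  by (rule fractionsI [of _ _ _ _ _ "ident A (src A f)" _ f]) (simp_all add: fAr_ident)

lemma hzero_fraction:
  "\<lbrakk>X \<in> Ob A; Y \<in> Ob A\<rbrakk> \<Longrightarrow> hzero B (fOb F X) (fOb F Y) \<in> fractions A B F X Y"
  using fAr_fraction [of "hzero A X Y"] by (simp add: fAr_hzero)

lemma ident_fraction: "X \<in> Ob A \<Longrightarrow> ident B (fOb F X) \<in> fractions A B F X X"
  using fAr_fraction [of "ident A X"] by (simp add: fAr_ident)

text \<open>The Ore condition moves the denominator of the second factor past the numerator of the
  first.\<close>

lemma cmp_fraction:
  assumes h: "h \<in> fractions A B F X Y" and h': "h' \<in> fractions A B F Y Z"
  shows "h' \<cdot>\<^bsub>B\<^esub> h \<in> fractions A B F X Z"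
proof -
  note [simp] = fractions_Hom [OF h] fractions_Hom [OF h']
  obtain s f where s: "s \<in> Ar A" "f \<in> Ar A" "src A s = src A f" "tgt A s = X" "tgt A f = Y"
    "is_iso B (fAr F s)" and hs: "h \<cdot>\<^bsub>B\<^esub> fAr F s = fAr F f"
    using h by (elim fractionsE)
  obtain t g where t: "t \<in> Ar A" "g \<in> Ar A" "src A t = src A g" "tgt A t = Y" "tgt A g = Z"
    "is_iso B (fAr F t)" and ht: "h' \<cdot>\<^bsub>B\<^esub> fAr F t = fAr F g"
    using h' by (elim fractionsE)
  note [simp] = s t
  obtain u v where uv: "u \<in> Ar A" "v \<in> Ar A" "src A u = src A v" "tgt A u = src A f"
    "tgt A v = src A t" "f \<cdot>\<^bsub>A\<^esub> u = t \<cdot>\<^bsub>A\<^esub> v" "is_iso B (fAr F u)"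
    by (rule ore [of t f]) ((rule that; assumption) | simp)+
  note [simp] = uv(1-5,7)
  have "(h' \<cdot>\<^bsub>B\<^esub> h) \<cdot>\<^bsub>B\<^esub> fAr F (s \<cdot>\<^bsub>A\<^esub> u) = h' \<cdot>\<^bsub>B\<^esub> fAr F f \<cdot>\<^bsub>B\<^esub> fAr F u"
    using B.cmp_eq_prefix [OF hs, of "fAr F u"] by (simp add: B.assoc fAr_comp)
  also have "fAr F f \<cdot>\<^bsub>B\<^esub> fAr F u = fAr F t \<cdot>\<^bsub>B\<^esub> fAr F v"
    using uv(6) fAr_comp [of u f] fAr_comp [of v t] by simp
  also have "h' \<cdot>\<^bsub>B\<^esub> fAr F t \<cdot>\<^bsub>B\<^esub> fAr F v = fAr F (g \<cdot>\<^bsub>A\<^esub> v)"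
    using B.cmp_eq_prefix [OF ht, of "fAr F v"] by (simp add: fAr_comp)
  finally show ?thesis
    by (intro fractionsI [of _ _ _ _ _ "s \<cdot>\<^bsub>A\<^esub> u" _ "g \<cdot>\<^bsub>A\<^esub> v"]) (simp_all add: fAr_comp B.iso_cmp)
qed

text \<open>Two denominators share their target, so the Ore condition applies to one against the
  other; both roofs are pulled back to the resulting apex.\<close>

lemma common_denominator:
  assumes h: "h \<in> fractions A B F X Y" and h': "h' \<in> fractions A B F X Z"
  obtains s f g where "s \<in> Ar A" "f \<in> Ar A" "g \<in> Ar A" "src A f = src A s" "src A g = src A s"
    "tgt A s = X" "tgt A f = Y" "tgt A g = Z" "is_iso B (fAr F s)" "h \<cdot>\<^bsub>B\<^esub> fAr F s = fAr F f"
    "h' \<cdot>\<^bsub>B\<^esub> fAr F s = fAr F g"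
proof -
  note [simp] = fractions_Hom [OF h] fractions_Hom [OF h']
  obtain s f where s: "s \<in> Ar A" "f \<in> Ar A" "src A s = src A f" "tgt A s = X" "tgt A f = Y"
    "is_iso B (fAr F s)" and hs: "h \<cdot>\<^bsub>B\<^esub> fAr F s = fAr F f"
    using h by (elim fractionsE)
  obtain t g where t: "t \<in> Ar A" "g \<in> Ar A" "src A t = src A g" "tgt A t = X" "tgt A g = Z"
    "is_iso B (fAr F t)" and ht: "h' \<cdot>\<^bsub>B\<^esub> fAr F t = fAr F g"
    using h' by (elim fractionsE)
  note [simp] = s t
  obtain u v where uv: "u \<in> Ar A" "v \<in> Ar A" "src A u = src A v" "tgt A u = src A s"
    "tgt A v = src A t" "s \<cdot>\<^bsub>A\<^esub> u = t \<cdot>\<^bsub>A\<^esub> v" "is_iso B (fAr F u)"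
    by (rule ore [of t s]) ((rule that; assumption) | simp)+
  note [simp] = uv(1-5,7)
  have 1: "h \<cdot>\<^bsub>B\<^esub> fAr F (s \<cdot>\<^bsub>A\<^esub> u) = fAr F (f \<cdot>\<^bsub>A\<^esub> u)"
    using B.cmp_eq_prefix [OF hs, of "fAr F u"] by (simp add: fAr_comp)
  have 2: "h' \<cdot>\<^bsub>B\<^esub> fAr F (t \<cdot>\<^bsub>A\<^esub> v) = fAr F (g \<cdot>\<^bsub>A\<^esub> v)"
    using B.cmp_eq_prefix [OF ht, of "fAr F v"] by (simp add: fAr_comp)
  show ?thesis
    by (rule that [of "s \<cdot>\<^bsub>A\<^esub> u" "f \<cdot>\<^bsub>A\<^esub> u" "g \<cdot>\<^bsub>A\<^esub> v"])
      (use 1 2 [folded uv(6)] in \<open>simp_all add: fAr_comp B.iso_cmp\<close>)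
qed

lemma hadd_fraction:
  assumes h: "h \<in> fractions A B F X Y" and h': "h' \<in> fractions A B F X Y"
  shows "hadd B h h' \<in> fractions A B F X Y"
proof -
  note [simp] = fractions_Hom [OF h] fractions_Hom [OF h']
  obtain s f g where s: "s \<in> Ar A" "f \<in> Ar A" "g \<in> Ar A" "src A f = src A s" "src A g = src A s"
    "tgt A s = X" "tgt A f = Y" "tgt A g = Y" "is_iso B (fAr F s)" "h \<cdot>\<^bsub>B\<^esub> fAr F s = fAr F f"
    "h' \<cdot>\<^bsub>B\<^esub> fAr F s = fAr F g"
    using common_denominator [OF h h'] by metis
  then show ?thesis
    using fAr_hadd [of f "src A s" Y g]
    by (intro fractionsI [of _ _ _ _ _ s _ "hadd A f g"]) (simp_all add: B.cmp_hadd)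
qed

lemma hsmult_fraction:
  assumes h: "h \<in> fractions A B F X Y" and a: "a \<in> carrier R"
  shows "hsmult B a h \<in> fractions A B F X Y"
proof -
  note [simp] = fractions_Hom [OF h] a
  obtain s f where s: "s \<in> Ar A" "f \<in> Ar A" "src A s = src A f" "tgt A s = X" "tgt A f = Y"
    "is_iso B (fAr F s)" "h \<cdot>\<^bsub>B\<^esub> fAr F s = fAr F f"
    using h by (elim fractionsE)
  then show ?thesis
    by (intro fractionsI [of _ _ _ _ _ s _ "hsmult A a f"]) (simp_all add: B.cmp_hsmult fAr_hsmult)
qed

text \<open>An arrow of the form t^-1 g is also a right fraction: if g u = t v with u inverted, then
  h u = v in \<open>B\<close> after cancelling the image of \<open>t\<close>. This is the source of
  the self-duality of \<open>fractions\<close>.\<close>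

lemma left_fraction:
  assumes h: "h \<in> Hom B (fOb F X) (fOb F Y)" and t: "t \<in> Ar A" "src A t = Y" "is_iso B (fAr F t)"
    and g: "g \<in> Ar A" "src A g = X" "tgt A g = tgt A t" and th: "fAr F t \<cdot>\<^bsub>B\<^esub> h = fAr F g"
  shows "h \<in> fractions A B F X Y"
proof -
  note [simp] = t g
  have [simp]: "h \<in> Ar B" "src B h = fOb F X" "tgt B h = fOb F Y"
    using h by simp_all
  obtain u v where uv: "u \<in> Ar A" "v \<in> Ar A" "src A u = src A v" "tgt A u = src A g"
    "tgt A v = src A t" "g \<cdot>\<^bsub>A\<^esub> u = t \<cdot>\<^bsub>A\<^esub> v" "is_iso B (fAr F u)"
    by (rule ore [of t g]) ((rule that; assumption) | simp)+
  note [simp] = uv(1-5,7)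
  have "fAr F t \<cdot>\<^bsub>B\<^esub> h \<cdot>\<^bsub>B\<^esub> fAr F u = fAr F g \<cdot>\<^bsub>B\<^esub> fAr F u"
    using B.cmp_eq_prefix [OF th, of "fAr F u"] by simp
  also have "\<dots> = fAr F t \<cdot>\<^bsub>B\<^esub> fAr F v"
    using uv(6) fAr_comp [of u g] fAr_comp [of v t] by simp
  finally have "h \<cdot>\<^bsub>B\<^esub> fAr F u = fAr F v"
    by (rule B.monoD [OF B.iso_mono [OF t(3)]]) simp_all
  then show ?thesis
    by (intro fractionsI [of _ _ _ _ _ u _ v]) simp_all
qed

lemma fractions_lopp_subset: "fractions (lopp A) (lopp B) F Y X \<subseteq> fractions A B F X Y"
proof
  fix h
  assume h: "h \<in> fractions (lopp A) (lopp B) F Y X"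
  then obtain t g where "t \<in> Ar (lopp A)" "g \<in> Ar (lopp A)" "src (lopp A) t = src (lopp A) g"
    "tgt (lopp A) t = Y" "tgt (lopp A) g = X" "is_iso (lopp B) (fAr F t)"
    "h \<cdot>\<^bsub>lopp B\<^esub> fAr F t = fAr F g"
    by (elim fractionsE)
  then show "h \<in> fractions A B F X Y"
    using fractions_Hom [OF h] by (intro left_fraction [of h X Y t g]) simp_all
qed

text \<open>One inclusion holds because a right fraction of the opposite category is a left fraction
  of \<open>A\<close>; the other is the same statement for the opposite functor, as
  \<open>lopp\<close> is an involution.\<close>

lemma fractions_lopp [simp]: "fractions (lopp A) (lopp B) F Y X = fractions A B F X Y"
  using fractions_lopp_subset [of Y X]
    exact_functor.fractions_lopp_subset [OF exact_functor_lopp, of X Y] by auto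

text \<open>For a roof (s, g) of \<open>h\<close> the composite f g vanishes only after applying
  \<open>F\<close>. Refining the roof by an inverted w makes it vanish in \<open>A\<close>, where g
  w lifts to v through \<open>k\<close>; the lift of \<open>h\<close> is the fraction v (s
  w)^-1.\<close>

lemma fraction_kernel_lift:
  assumes k: "is_kernel A k f" and h: "h \<in> fractions A B F W (src A f)"
    and 0: "fAr F f \<cdot>\<^bsub>B\<^esub> h = hzero B (fOb F W) (fOb F (tgt A f))"
  shows "\<exists>u \<in> fractions A B F W (src A k). fAr F k \<cdot>\<^bsub>B\<^esub> u = h"
proof -
  note [simp] = A.kernelD(1-3) [OF k] fractions_Hom [OF h]
  obtain s g where s: "s \<in> Ar A" "g \<in> Ar A" "src A s = src A g" "tgt A s = W" "tgt A g = src A f"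
    "is_iso B (fAr F s)" and hs: "h \<cdot>\<^bsub>B\<^esub> fAr F s = fAr F g"
    using h by (elim fractionsE)
  note [simp] = s
  have "fAr F (f \<cdot>\<^bsub>A\<^esub> g) = fAr F f \<cdot>\<^bsub>B\<^esub> h \<cdot>\<^bsub>B\<^esub> fAr F s"
    using hs by (simp add: fAr_comp)
  also have "\<dots> = fAr F (hzero A (src A g) (tgt A f))"
    using B.cmp_eq_prefix [OF 0, of "fAr F s"] by (simp add: fAr_hzero)
  finally obtain w where w: "w \<in> Ar A" "tgt A w = src A g" "is_iso B (fAr F w)" and
    fgw: "(f \<cdot>\<^bsub>A\<^esub> g) \<cdot>\<^bsub>A\<^esub> w = hzero A (src A g) (tgt A f) \<cdot>\<^bsub>A\<^esub> w"
    by (rule ex_equaliser_inverted) ((rule that; assumption) | simp)+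
  note [simp] = w
  obtain v where v: "v \<in> Ar A" "src A v = src A w" "tgt A v = src A k" "k \<cdot>\<^bsub>A\<^esub> v = g \<cdot>\<^bsub>A\<^esub> w"
    by (rule A.kernel_lift [OF k, of "g \<cdot>\<^bsub>A\<^esub> w" "src A w"]) (use fgw in \<open>simp_all add: A.assoc\<close>)
  note [simp] = v(1-3)
  have sw: "is_iso B (fAr F (s \<cdot>\<^bsub>A\<^esub> w))"
    by (simp add: fAr_comp B.iso_cmp)
  obtain u where u: "u \<in> Ar B" "src B u = fOb F W" "tgt B u = fOb F (src A k)"
    "u \<cdot>\<^bsub>B\<^esub> fAr F (s \<cdot>\<^bsub>A\<^esub> w) = fAr F v"
    by (rule B.ex_fraction [OF sw, of "fAr F v"]) simp_all
  note [simp] = u(1-3)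
  have "fAr F k \<cdot>\<^bsub>B\<^esub> u \<cdot>\<^bsub>B\<^esub> fAr F (s \<cdot>\<^bsub>A\<^esub> w) = fAr F g \<cdot>\<^bsub>B\<^esub> fAr F w"
    using u(4) v(4) fAr_comp [of v k] fAr_comp [of w g] by simp
  also have "\<dots> = h \<cdot>\<^bsub>B\<^esub> fAr F (s \<cdot>\<^bsub>A\<^esub> w)"
    using B.cmp_eq_prefix [OF hs, of "fAr F w"] by (simp add: fAr_comp)
  finally have "(fAr F k \<cdot>\<^bsub>B\<^esub> u) \<cdot>\<^bsub>B\<^esub> fAr F (s \<cdot>\<^bsub>A\<^esub> w) = h \<cdot>\<^bsub>B\<^esub> fAr F (s \<cdot>\<^bsub>A\<^esub> w)"
    by (simp add: B.assoc)
  then have "fAr F k \<cdot>\<^bsub>B\<^esub> u = h"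
    by (rule B.epi_iso_cancel [OF sw]) simp_all
  moreover have "u \<in> fractions A B F W (src A k)"
    by (rule fractionsI [of _ _ _ _ _ "s \<cdot>\<^bsub>A\<^esub> w" _ v]) (use sw u(4) in simp_all)
  ultimately show ?thesis
    by blast
qed

text \<open>The lifting clause is stated separately since a kernel in \<open>B\<close> only gives
  lifts in \<open>B\<close>, which need not be fractions. For h = f s^-1 the kernel is that of f
  followed by s.\<close>

lemma ex_fraction_kernel:
  assumes h: "h \<in> fractions A B F X Y"
  shows "\<exists>N. \<exists>\<kappa> \<in> fractions A B F N X. is_kernel B \<kappa> h \<and>
    (\<forall>W. \<forall>g \<in> fractions A B F W X. h \<cdot>\<^bsub>B\<^esub> g = hzero B (fOb F W) (fOb F Y) \<longrightarrow>
      (\<exists>u \<in> fractions A B F W N. \<kappa> \<cdot>\<^bsub>B\<^esub> u = g))"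
proof -
  note [simp] = fractions_Hom [OF h]
  obtain s f where s: "s \<in> Ar A" "f \<in> Ar A" "src A s = src A f" "tgt A s = X" "tgt A f = Y"
    "is_iso B (fAr F s)" and hs: "h \<cdot>\<^bsub>B\<^esub> fAr F s = fAr F f"
    using h by (elim fractionsE)
  note [simp] = s
  obtain k where k: "is_kernel A k f"
    using A.ex_kernel [of f] by auto
  note [simp] = A.kernelD(1-3) [OF k]
  obtain s' where s': "s' \<in> Ar B" "src B s' = fOb F X" "tgt B s' = fOb F (src A f)"
    "s' \<cdot>\<^bsub>B\<^esub> fAr F s = ident B (fOb F (src A f))" "fAr F s \<cdot>\<^bsub>B\<^esub> s' = ident B (fOb F X)"
    using s(6) by (elim B.is_isoE) simp
  note [simp] = s'(1-3)
  \<comment> \<open>The inverse of a denominator is itself a fraction, with numerator the identity.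
    It moves arrows into X over to the apex of the roof without leaving the fractions.\<close>
  have fs': "s' \<in> fractions A B F X (src A f)"
    by (rule fractionsI [of _ _ _ _ _ s _ "ident A (src A f)"])
      (use s'(4) in \<open>simp_all add: fAr_ident\<close>)
  have "\<exists>u \<in> fractions A B F W (src A k). fAr F (s \<cdot>\<^bsub>A\<^esub> k) \<cdot>\<^bsub>B\<^esub> u = g"
    if g: "g \<in> fractions A B F W X" and 0: "h \<cdot>\<^bsub>B\<^esub> g = hzero B (fOb F W) (fOb F Y)" for W g
  proof -
    note [simp] = fractions_Hom [OF g]
    have "fAr F f \<cdot>\<^bsub>B\<^esub> s' = h"
      using B.assoc [of s' "fAr F s" h] hs s'(5) by simp
    then have "fAr F f \<cdot>\<^bsub>B\<^esub> s' \<cdot>\<^bsub>B\<^esub> g = hzero B (fOb F W) (fOb F (tgt A f))"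
      using B.cmp_eq_prefix [of "fAr F f" s' h g] 0 by simp
    then obtain u where u: "u \<in> fractions A B F W (src A k)" "fAr F k \<cdot>\<^bsub>B\<^esub> u = s' \<cdot>\<^bsub>B\<^esub> g"
      using fraction_kernel_lift [OF k cmp_fraction [OF g fs']] by auto
    note [simp] = fractions_Hom [OF u(1)]
    have "fAr F (s \<cdot>\<^bsub>A\<^esub> k) \<cdot>\<^bsub>B\<^esub> u = fAr F s \<cdot>\<^bsub>B\<^esub> s' \<cdot>\<^bsub>B\<^esub> g"
      using u(2) by (simp add: fAr_comp B.assoc)
    also have "\<dots> = g"
      using B.cmp_eq_prefix [OF s'(5), of g] by simp
    finally show ?thesis
      using u(1) by blast
  qed
  moreover have "is_kernel B (fAr F (s \<cdot>\<^bsub>A\<^esub> k)) h"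
    using B.kernel_cmp_iso_right [OF fAr_kernel [OF k] s(6), of h] hs by (simp add: fAr_comp)
  moreover have "fAr F (s \<cdot>\<^bsub>A\<^esub> k) \<in> fractions A B F (src A k) X"
    using fAr_fraction [of "s \<cdot>\<^bsub>A\<^esub> k"] by simp
  ultimately show ?thesis
    by blast
qed

lemma ex_fraction_cokernel:
  assumes h: "h \<in> fractions A B F X Y"
  shows "\<exists>N. \<exists>\<gamma> \<in> fractions A B F Y N. is_cokernel B \<gamma> h \<and>
    (\<forall>W. \<forall>g \<in> fractions A B F Y W. g \<cdot>\<^bsub>B\<^esub> h = hzero B (fOb F X) (fOb F W) \<longrightarrow>
      (\<exists>u \<in> fractions A B F N W. u \<cdot>\<^bsub>B\<^esub> \<gamma> = g))"
  using exact_functor.ex_fraction_kernel [OF exact_functor_lopp, of h Y X] h by simp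

text \<open>Factor the numerator as f = m e. Since \<open>h\<close> is mono, so is the image of e,
  which is also epi, hence invertible. So \<open>h\<close> differs from the image of m by an
  isomorphism, and m is the kernel of the cokernel c of f; the arrow of which \<open>h\<close> is
  the kernel is the image of c.\<close>

lemma mono_fraction_is_kernel:
  assumes h: "h \<in> fractions A B F X Y" and m: "is_mono B h"
  shows "\<exists>Z. \<exists>f \<in> fractions A B F Y Z. is_kernel B h f \<and>
    (\<forall>W. \<forall>g \<in> fractions A B F W Y. f \<cdot>\<^bsub>B\<^esub> g = hzero B (fOb F W) (fOb F Z) \<longrightarrow>
      (\<exists>u \<in> fractions A B F W X. h \<cdot>\<^bsub>B\<^esub> u = g))"
proof -
  note [simp] = fractions_Hom [OF h] fractions_Ob [OF h]
  obtain s f where s: "s \<in> Ar A" "f \<in> Ar A" "src A s = src A f" "tgt A s = X" "tgt A f = Y"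
    "is_iso B (fAr F s)" and hs: "h \<cdot>\<^bsub>B\<^esub> fAr F s = fAr F f"
    using h by (elim fractionsE)
  note [simp] = s
  obtain m e c where c: "is_cokernel A c f" and km: "is_kernel A m c"
    and me: "is_mono A m" "is_epi A e"
    "tgt A e = src A m" "src A e = src A f" "tgt A m = Y" "m \<cdot>\<^bsub>A\<^esub> e = f"
    using A.image_factorisation [OF s(2)] s(5) by metis
  have [simp]: "m \<in> Ar A" "e \<in> Ar A" "c \<in> Ar A" "src A c = Y"
    using me A.cokernelD [OF c] by (simp_all add: is_mono_def is_epi_def)
  note [simp] = me(3-5)
  have Fme: "fAr F m \<cdot>\<^bsub>B\<^esub> fAr F e = fAr F f"
    using fAr_comp [of e m] me(6) by simp
  have "is_mono B (fAr F m \<cdot>\<^bsub>B\<^esub> fAr F e)"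
    unfolding Fme using B.mono_cmp [OF B.iso_mono [OF s(6)] m] hs by simp
  then have "is_mono B (fAr F e)"
    by (rule B.mono_of_cmp) simp_all
  then have e [simp]: "is_iso B (fAr F e)"
    by (rule B.mono_epi_iso) (rule fAr_epi [OF me(2)])
  \<comment> \<open>\<open>\<theta>\<close> is s e^-1 and \<open>\<eta>\<close> is e s^-1, formed in
    \<open>B\<close>; they are mutually inverse. The roof (e, s) shows that \<open>\<theta>\<close>
    is a fraction, so lifts through m can be turned into lifts through \<open>h\<close> by composing
    with it.\<close>
  obtain \<theta> where \<theta>: "\<theta> \<in> Ar B" "src B \<theta> = fOb F (src A m)" "tgt B \<theta> = fOb F X"
    "\<theta> \<cdot>\<^bsub>B\<^esub> fAr F e = fAr F s"
    by (rule B.ex_fraction [OF e, of "fAr F s"]) simp_all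
  obtain \<eta> where \<eta>: "\<eta> \<in> Ar B" "src B \<eta> = fOb F X" "tgt B \<eta> = fOb F (src A m)"
    "\<eta> \<cdot>\<^bsub>B\<^esub> fAr F s = fAr F e"
    by (rule B.ex_fraction [OF s(6), of "fAr F e"]) simp_all
  note [simp] = \<theta>(1-3) \<eta>(1-3)
  have fr\<theta>: "\<theta> \<in> fractions A B F (src A m) X"
    by (rule fractionsI [of _ _ _ _ _ e _ s]) (use \<theta>(4) in simp_all)
  have h\<theta>: "h \<cdot>\<^bsub>B\<^esub> \<theta> = fAr F m"
    by (rule B.epi_iso_cancel [OF e]) (use \<theta>(4) hs Fme in \<open>simp_all add: B.assoc\<close>)
  have m\<eta>: "fAr F m \<cdot>\<^bsub>B\<^esub> \<eta> = h"
    by (rule B.epi_iso_cancel [OF s(6)]) (use \<eta>(4) hs Fme in \<open>simp_all add: B.assoc\<close>)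
  have "\<eta> \<cdot>\<^bsub>B\<^esub> \<theta> = ident B (fOb F (src A m))"
    by (rule B.epi_iso_cancel [OF e]) (use \<theta>(4) \<eta>(4) in \<open>simp_all add: B.assoc\<close>)
  moreover have "\<theta> \<cdot>\<^bsub>B\<^esub> \<eta> = ident B (fOb F X)"
    by (rule B.epi_iso_cancel [OF s(6)]) (use \<theta>(4) \<eta>(4) in \<open>simp_all add: B.assoc\<close>)
  ultimately have "is_iso B \<eta>"
    by (intro B.is_isoI [of \<eta> "fOb F X" "fOb F (src A m)" \<theta>]) simp_all
  then have "is_kernel B h (fAr F c)"
    using B.kernel_cmp_iso [OF fAr_kernel [OF km], of \<eta>] m\<eta> by simp
  moreover have "\<exists>u \<in> fractions A B F W X. h \<cdot>\<^bsub>B\<^esub> u = g"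
    if g: "g \<in> fractions A B F W Y"
      and 0: "fAr F c \<cdot>\<^bsub>B\<^esub> g = hzero B (fOb F W) (fOb F (tgt A c))" for W g
  proof -
    obtain u where u: "u \<in> fractions A B F W (src A m)" "fAr F m \<cdot>\<^bsub>B\<^esub> u = g"
      using fraction_kernel_lift [OF km, of g W] g 0 by auto
    then show ?thesis
      using cmp_fraction [OF u(1) fr\<theta>] B.assoc [of u \<theta> h] h\<theta> fractions_Hom [OF u(1)]
      by (intro bexI [of _ "\<theta> \<cdot>\<^bsub>B\<^esub> u"]) simp_all
  qed
  moreover have "fAr F c \<in> fractions A B F Y (tgt A c)"
    using fAr_fraction [of c] by simp
  ultimately show ?thesis
    by blast
qed

lemma epi_fraction_is_cokernel:
  assumes h: "h \<in> fractions A B F X Y" and e: "is_epi B h"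
  shows "\<exists>Z. \<exists>f \<in> fractions A B F Z X. is_cokernel B h f \<and>
    (\<forall>W. \<forall>g \<in> fractions A B F X W. g \<cdot>\<^bsub>B\<^esub> f = hzero B (fOb F Z) (fOb F W) \<longrightarrow>
      (\<exists>u \<in> fractions A B F Y W. u \<cdot>\<^bsub>B\<^esub> h = g))"
  using exact_functor.mono_fraction_is_kernel [OF exact_functor_lopp, of h Y X] h e by simp

end

section \<open>The Serre quotient by the kernel of an exact functor\<close>

context exact_functor
begin

text \<open>The roofs that represent the arrow \<open>h\<close> of \<open>B\<close>. The two
  comparisons with \<open>roof_rel\<close> below show that, for fractions \<open>h\<close>, these
  are exactly the equivalence classes.\<close>

definition frac_class :: "'o \<Rightarrow> 'n \<Rightarrow> 'o \<Rightarrow> ('m \<times> 'm) set" where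
  "frac_class X h Y = {(s, f). s \<in> Ar A \<and> f \<in> Ar A \<and> src A s = src A f \<and> tgt A s = X \<and>
     tgt A f = Y \<and> is_iso B (fAr F s) \<and> h \<cdot>\<^bsub>B\<^esub> fAr F s = fAr F f}"

definition frac_arr :: "'o \<Rightarrow> 'n \<Rightarrow> 'o \<Rightarrow> 'o \<times> ('m \<times> 'm) set \<times> 'o" where
  "frac_arr X h Y = (X, frac_class X h Y, Y)"

abbreviation quotient :: "('o, 'o \<times> ('m \<times> 'm) set \<times> 'o, 'r) linear_cat" where
  "quotient \<equiv> serre_quotient A (functor_kernel A B F)"

lemma mem_frac_class:
  "(s, f) \<in> frac_class X h Y \<longleftrightarrow> s \<in> Ar A \<and> f \<in> Ar A \<and> src A s = src A f \<and> tgt A s = X \<and>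
     tgt A f = Y \<and> is_iso B (fAr F s) \<and> h \<cdot>\<^bsub>B\<^esub> fAr F s = fAr F f"
  by (simp add: frac_class_def)

lemma frac_class_nonempty: "h \<in> fractions A B F X Y \<Longrightarrow> frac_class X h Y \<noteq> {}"
  unfolding fractions_def frac_class_def by blast

lemma fractionI_class:
  "\<lbrakk>h \<in> Hom B (fOb F X) (fOb F Y); (s, f) \<in> frac_class X h Y\<rbrakk> \<Longrightarrow> h \<in> fractions A B F X Y"
  unfolding fractions_def frac_class_def by blast

lemma frac_class_unique:
  assumes "(s, f) \<in> frac_class X h Y" "(s, f) \<in> frac_class X h' Y"
    "h \<in> Hom B (fOb F X) (fOb F Y)" "h' \<in> Hom B (fOb F X) (fOb F Y)"
  shows "h = h'"
  by (rule B.epi_iso_cancel [of "fAr F s"]) (use assms in \<open>auto simp: mem_frac_class\<close>)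

lemma mem_roofs:
  "(s, f) \<in> roofs A (functor_kernel A B F) X Y \<longleftrightarrow> s \<in> Ar A \<and> f \<in> Ar A \<and> src A s = src A f \<and>
     tgt A s = X \<and> tgt A f = Y \<and> is_iso B (fAr F s)"
  by (auto simp: roofs_def iso_mod_iff)

lemma roof_fraction:
  assumes "(s, f) \<in> roofs A (functor_kernel A B F) X Y"
  obtains h where "h \<in> fractions A B F X Y" "(s, f) \<in> frac_class X h Y"
proof -
  have s: "s \<in> Ar A" "f \<in> Ar A" "src A s = src A f" "tgt A s = X" "tgt A f = Y" "is_iso B (fAr F s)"
    using assms by (simp_all add: mem_roofs)
  obtain h where "h \<in> Ar B" "src B h = fOb F X" "tgt B h = fOb F Y" "h \<cdot>\<^bsub>B\<^esub> fAr F s = fAr F f"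
    using B.ex_fraction [OF s(6), of "fAr F f"] s by auto
  then show ?thesis
    using s by (intro that [of h] fractionI_class [of h X Y s f]) (simp_all add: mem_frac_class)
qed

text \<open>The relation requires only s u = t v to be inverted, not v. As \<open>t\<close> is
  inverted too, v is inverted by cancellation, and can then be removed from the equation between
  numerators.\<close>

lemma roof_rel_imp_class:
  assumes st: "((s, f), (t, g)) \<in> roof_rel A (functor_kernel A B F) X Y"
    and s: "(s, f) \<in> frac_class X h Y" and h: "h \<in> Hom B (fOb F X) (fOb F Y)"
  shows "(t, g) \<in> frac_class X h Y"
proof -
  have t: "t \<in> Ar A" "g \<in> Ar A" "src A t = src A g" "tgt A t = X" "tgt A g = Y" "is_iso B (fAr F t)"
    using st by (simp_all add: roof_rel_def mem_roofs)
  have s': "s \<in> Ar A" "f \<in> Ar A" "src A s = src A f" "tgt A s = X" "tgt A f = Y"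
    "h \<cdot>\<^bsub>B\<^esub> fAr F s = fAr F f"
    using s by (simp_all add: mem_frac_class)
  obtain u v where uv: "u \<in> Ar A" "v \<in> Ar A" "src A u = src A v" "tgt A u = src A s"
    "tgt A v = src A t" "s \<cdot>\<^bsub>A\<^esub> u = t \<cdot>\<^bsub>A\<^esub> v" "is_iso B (fAr F (s \<cdot>\<^bsub>A\<^esub> u))" "f \<cdot>\<^bsub>A\<^esub> u = g \<cdot>\<^bsub>A\<^esub> v"
    using st unfolding roof_rel_def iso_mod_iff by auto
  note [simp] = t s'(1-5) uv(1-5) and h' [simp] = h [simplified]
  have "is_iso B (fAr F t \<cdot>\<^bsub>B\<^esub> fAr F v)"
    using uv(6,7) by (simp add: fAr_comp)
  then have v: "is_iso B (fAr F v)"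
    by (intro B.iso_of_cmp_left [of "fAr F v" "fAr F t"]) simp_all
  have "h \<cdot>\<^bsub>B\<^esub> fAr F t \<cdot>\<^bsub>B\<^esub> fAr F v = h \<cdot>\<^bsub>B\<^esub> fAr F s \<cdot>\<^bsub>B\<^esub> fAr F u"
    using uv(6) fAr_comp [of u s] fAr_comp [of v t] by simp
  also have "\<dots> = fAr F g \<cdot>\<^bsub>B\<^esub> fAr F v"
    using B.cmp_eq_prefix [OF s'(6), of "fAr F u"] uv(8) fAr_comp [of u f] fAr_comp [of v g] by simp
  finally have "(h \<cdot>\<^bsub>B\<^esub> fAr F t) \<cdot>\<^bsub>B\<^esub> fAr F v = fAr F g \<cdot>\<^bsub>B\<^esub> fAr F v"
    by (simp add: B.assoc)
  then have "h \<cdot>\<^bsub>B\<^esub> fAr F t = fAr F g"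
    by (rule B.epi_iso_cancel [OF v]) simp_all
  then show ?thesis
    by (simp add: mem_frac_class)
qed

text \<open>The Ore condition yields a common denominator s u = t v. The numerators f u and g v then
  have the same image under \<open>F\<close>, and one further refinement by an inverted w makes them
  equal in \<open>A\<close>.\<close>

lemma class_imp_roof_rel:
  assumes s: "(s, f) \<in> frac_class X h Y" and t: "(t, g) \<in> frac_class X h Y"
    and h: "h \<in> Hom B (fOb F X) (fOb F Y)"
  shows "((s, f), (t, g)) \<in> roof_rel A (functor_kernel A B F) X Y"
proof -
  have s' [simp]: "s \<in> Ar A" "f \<in> Ar A" "src A s = src A f" "tgt A s = X" "tgt A f = Y"
    "is_iso B (fAr F s)" and hs: "h \<cdot>\<^bsub>B\<^esub> fAr F s = fAr F f"
    using s by (simp_all add: mem_frac_class)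
  have t' [simp]: "t \<in> Ar A" "g \<in> Ar A" "src A t = src A g" "tgt A t = X" "tgt A g = Y"
    "is_iso B (fAr F t)" and ht: "h \<cdot>\<^bsub>B\<^esub> fAr F t = fAr F g"
    using t by (simp_all add: mem_frac_class)
  note h' [simp] = h [simplified]
  obtain u v where uv: "u \<in> Ar A" "v \<in> Ar A" "src A u = src A v" "tgt A u = src A s"
    "tgt A v = src A t" "s \<cdot>\<^bsub>A\<^esub> u = t \<cdot>\<^bsub>A\<^esub> v" "is_iso B (fAr F u)"
    by (rule ore [of t s]) ((rule that; assumption) | simp)+
  note [simp] = uv(1-5,7)
  have "fAr F (f \<cdot>\<^bsub>A\<^esub> u) = h \<cdot>\<^bsub>B\<^esub> fAr F (s \<cdot>\<^bsub>A\<^esub> u)"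
    using B.cmp_eq_prefix [OF hs, of "fAr F u"] by (simp add: fAr_comp)
  also have "\<dots> = fAr F (g \<cdot>\<^bsub>A\<^esub> v)"
    unfolding uv(6) using B.cmp_eq_prefix [OF ht, of "fAr F v"] by (simp add: fAr_comp)
  finally obtain w where w: "w \<in> Ar A" "tgt A w = src A v" "is_iso B (fAr F w)" and
    fw: "(f \<cdot>\<^bsub>A\<^esub> u) \<cdot>\<^bsub>A\<^esub> w = (g \<cdot>\<^bsub>A\<^esub> v) \<cdot>\<^bsub>A\<^esub> w"
    by (rule ex_equaliser_inverted) (auto simp: intro: that)
  note [simp] = w
  have "s \<cdot>\<^bsub>A\<^esub> u \<cdot>\<^bsub>A\<^esub> w = t \<cdot>\<^bsub>A\<^esub> v \<cdot>\<^bsub>A\<^esub> w"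
    using A.cmp_eq_prefix [OF uv(6), of w] by (simp add: A.assoc)
  moreover have "s \<cdot>\<^bsub>A\<^esub> u \<cdot>\<^bsub>A\<^esub> w \<in> iso_mod A (functor_kernel A B F)"
    by (simp add: iso_mod_iff fAr_comp B.iso_cmp)
  moreover have "f \<cdot>\<^bsub>A\<^esub> u \<cdot>\<^bsub>A\<^esub> w = g \<cdot>\<^bsub>A\<^esub> v \<cdot>\<^bsub>A\<^esub> w"
    using fw by (simp add: A.assoc)
  moreover have "u \<cdot>\<^bsub>A\<^esub> w \<in> Hom A (src A w) (src A s)" "v \<cdot>\<^bsub>A\<^esub> w \<in> Hom A (src A w) (src A t)"
    by simp_all
  moreover have "(s, f) \<in> roofs A (functor_kernel A B F) X Y"
    "(t, g) \<in> roofs A (functor_kernel A B F) X Y"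
    by (simp_all add: mem_roofs)
  ultimately show ?thesis
    unfolding roof_rel_def by blast
qed

lemma roof_rel_class:
  assumes "(s, f) \<in> frac_class X h Y" "h \<in> Hom B (fOb F X) (fOb F Y)"
  shows "roof_rel A (functor_kernel A B F) X Y `` {(s, f)} = frac_class X h Y"
  using roof_rel_imp_class [of s f _ _ X Y h] class_imp_roof_rel [of s f X h Y] assms by auto

lemma roofs_quotient:
  "roofs A (functor_kernel A B F) X Y // roof_rel A (functor_kernel A B F) X Y =
    {frac_class X h Y | h. h \<in> fractions A B F X Y}"
proof (intro equalityI subsetI)
  fix \<Phi>
  assume "\<Phi> \<in> roofs A (functor_kernel A B F) X Y // roof_rel A (functor_kernel A B F) X Y"
  then obtain s f where s: "(s, f) \<in> roofs A (functor_kernel A B F) X Y"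
    "\<Phi> = roof_rel A (functor_kernel A B F) X Y `` {(s, f)}"
    by (auto elim!: quotientE)
  then obtain h where h: "h \<in> fractions A B F X Y" "(s, f) \<in> frac_class X h Y"
    using roof_fraction by blast
  then show "\<Phi> \<in> {frac_class X h Y | h. h \<in> fractions A B F X Y}"
    using roof_rel_class [of s f X h Y] fractions_Hom [OF h(1)] s by auto
next
  fix \<Phi>
  assume "\<Phi> \<in> {frac_class X h Y | h. h \<in> fractions A B F X Y}"
  then obtain h where h: "h \<in> fractions A B F X Y" "\<Phi> = frac_class X h Y"
    by blast
  then obtain s f where s: "(s, f) \<in> frac_class X h Y"
    using frac_class_nonempty by fastforce
  then have "(s, f) \<in> roofs A (functor_kernel A B F) X Y"
    by (simp add: mem_frac_class mem_roofs)
  then show "\<Phi> \<in> roofs A (functor_kernel A B F) X Y // roof_rel A (functor_kernel A B F) X Y"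
    using quotientI [of "(s, f)" _ "roof_rel A (functor_kernel A B F) X Y"]
      roof_rel_class [OF s] fractions_Hom [OF h(1)] h by simp
qed

section \<open>The operations of the quotient computed on fractions\<close>

lemma quotient_simps [simp]:
  "Ob quotient = Ob A" "src quotient (frac_arr X h Y) = X" "tgt quotient (frac_arr X h Y) = Y"
  by (simp_all add: serre_quotient_def frac_arr_def)

lemma frac_arr_Ar [simp]: "h \<in> fractions A B F X Y \<Longrightarrow> frac_arr X h Y \<in> Ar quotient"
  using fractions_Ob [of h X Y] by (auto simp: serre_quotient_def frac_arr_def roofs_quotient)

lemma quotient_HomE:
  assumes "\<phi> \<in> Ar quotient" "src quotient \<phi> = X" "tgt quotient \<phi> = Y"
  obtains h where "h \<in> fractions A B F X Y" "\<phi> = frac_arr X h Y"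
  using assms by (auto simp: serre_quotient_def frac_arr_def roofs_quotient)

lemma frac_arr_inject [simp]:
  assumes h: "h \<in> fractions A B F X Y" and h': "h' \<in> fractions A B F X Y"
  shows "frac_arr X h Y = frac_arr X h' Y \<longleftrightarrow> h = h'"
proof
  assume "frac_arr X h Y = frac_arr X h' Y"
  then have "frac_class X h Y = frac_class X h' Y"
    by (simp add: frac_arr_def)
  moreover obtain s f where "(s, f) \<in> frac_class X h Y"
    using frac_class_nonempty [OF h] by fastforce
  ultimately show "h = h'"
    using frac_class_unique [of s f X h Y h'] fractions_Hom [OF h] fractions_Hom [OF h'] by simp
qed simp

text \<open>The pattern of every well-definedness proof: all choices give the same class, and at
  least one choice exists.\<close>

lemma Union_classes:
  assumes "\<And>\<Phi>. \<Phi> \<in> \<S> \<Longrightarrow> \<Phi> = \<Psi>" "\<S> \<noteq> {}"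
  shows "\<Union> \<S> = \<Psi>"
  using assms by blast

lemma cmp_quotient [simp]:
  assumes h: "h \<in> fractions A B F X Y" and h': "h' \<in> fractions A B F Y Z"
  shows "frac_arr Y h' Z \<cdot>\<^bsub>quotient\<^esub> frac_arr X h Y = frac_arr X (h' \<cdot>\<^bsub>B\<^esub> h) Z"
proof -
  note [simp] = fractions_Hom [OF h] fractions_Hom [OF h']
  let ?P = "\<lambda>s f t g u v. (s, f) \<in> frac_class X h Y \<and> (t, g) \<in> frac_class Y h' Z \<and>
     u \<in> iso_mod A (functor_kernel A B F) \<and> v \<in> Ar A \<and> src A u = src A v \<and>
     tgt A u = src A f \<and> tgt A v = src A t \<and> f \<cdot>\<^bsub>A\<^esub> u = t \<cdot>\<^bsub>A\<^esub> v"
  have "roof_rel A (functor_kernel A B F) X Z `` {(s \<cdot>\<^bsub>A\<^esub> u, g \<cdot>\<^bsub>A\<^esub> v)} = frac_class X (h' \<cdot>\<^bsub>B\<^esub> h) Z"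
    if P: "?P s f t g u v" for s f t g u v
  proof (rule roof_rel_class)
    have [simp]: "s \<in> Ar A" "f \<in> Ar A" "src A s = src A f" "tgt A s = X" "tgt A f = Y"
      "is_iso B (fAr F s)" and hs: "h \<cdot>\<^bsub>B\<^esub> fAr F s = fAr F f"
      using P by (simp_all add: mem_frac_class)
    have [simp]: "t \<in> Ar A" "g \<in> Ar A" "src A t = src A g" "tgt A t = Y" "tgt A g = Z"
      and ht: "h' \<cdot>\<^bsub>B\<^esub> fAr F t = fAr F g"
      using P by (simp_all add: mem_frac_class)
    have [simp]: "u \<in> Ar A" "v \<in> Ar A" "src A u = src A v" "tgt A u = src A f" "tgt A v = src A g"
      "is_iso B (fAr F u)" and fu: "f \<cdot>\<^bsub>A\<^esub> u = t \<cdot>\<^bsub>A\<^esub> v"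
      using P by (simp_all add: iso_mod_iff)
    have "(h' \<cdot>\<^bsub>B\<^esub> h) \<cdot>\<^bsub>B\<^esub> fAr F (s \<cdot>\<^bsub>A\<^esub> u) = h' \<cdot>\<^bsub>B\<^esub> fAr F f \<cdot>\<^bsub>B\<^esub> fAr F u"
      using B.cmp_eq_prefix [OF hs, of "fAr F u"] by (simp add: B.assoc fAr_comp)
    also have "fAr F f \<cdot>\<^bsub>B\<^esub> fAr F u = fAr F t \<cdot>\<^bsub>B\<^esub> fAr F v"
      using fu fAr_comp [of u f] fAr_comp [of v t] by simp
    also have "h' \<cdot>\<^bsub>B\<^esub> fAr F t \<cdot>\<^bsub>B\<^esub> fAr F v = fAr F (g \<cdot>\<^bsub>A\<^esub> v)"
      using B.cmp_eq_prefix [OF ht, of "fAr F v"] by (simp add: fAr_comp)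
    finally show "(s \<cdot>\<^bsub>A\<^esub> u, g \<cdot>\<^bsub>A\<^esub> v) \<in> frac_class X (h' \<cdot>\<^bsub>B\<^esub> h) Z"
      by (simp add: mem_frac_class fAr_comp B.iso_cmp)
  qed simp
  \<comment> \<open>Without an admissible choice the union would be empty instead of a class; the
    Ore condition supplies one.\<close>
  moreover have "\<exists>s f t g u v. ?P s f t g u v"
  proof -
    obtain s f t g where s: "(s, f) \<in> frac_class X h Y" and t: "(t, g) \<in> frac_class Y h' Z"
      using frac_class_nonempty [OF h] frac_class_nonempty [OF h'] by fastforce
    obtain u v where "u \<in> Ar A" "v \<in> Ar A" "src A u = src A v" "tgt A u = src A f"
      "tgt A v = src A t" "f \<cdot>\<^bsub>A\<^esub> u = t \<cdot>\<^bsub>A\<^esub> v" "is_iso B (fAr F u)"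
      by (rule ore [of t f]) ((rule that; assumption) | (use s t in \<open>simp add: mem_frac_class\<close>))+
    then show ?thesis
      using s t
      by (intro exI [of _ s] exI [of _ f] exI [of _ t] exI [of _ g] exI [of _ u] exI [of _ v])
        (simp add: iso_mod_iff)
  qed
  ultimately have
    "\<Union> {roof_rel A (functor_kernel A B F) X Z `` {(s \<cdot>\<^bsub>A\<^esub> u, g \<cdot>\<^bsub>A\<^esub> v)} | s f t g u v. ?P s f t g u v}
      = frac_class X (h' \<cdot>\<^bsub>B\<^esub> h) Z"
    by (intro Union_classes) blast+
  then show ?thesis
    by (simp add: serre_quotient_def frac_arr_def)
qed

lemma serre_projection_fOb [simp]: "fOb (serre_projection A (functor_kernel A B F)) X = X"
  by (simp add: serre_projection_def)

lemma serre_projection_fAr: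
  assumes "f \<in> Ar A"
  shows "fAr (serre_projection A (functor_kernel A B F)) f = frac_arr (src A f) (fAr F f) (tgt A f)"
proof -
  have "roof_rel A (functor_kernel A B F) (src A f) (tgt A f) `` {(ident A (src A f), f)} =
      frac_class (src A f) (fAr F f) (tgt A f)"
    by (rule roof_rel_class) (use assms in \<open>simp_all add: mem_frac_class fAr_ident\<close>)
  then show ?thesis
    by (simp add: serre_projection_def frac_arr_def)
qed

lemma ident_quotient [simp]:
  assumes "X \<in> Ob A"
  shows "ident quotient X = frac_arr X (ident B (fOb F X)) X"
proof -
  have "roof_rel A (functor_kernel A B F) X X `` {(ident A X, ident A X)} =
      frac_class X (ident B (fOb F X)) X"
    by (rule roof_rel_class) (use assms in \<open>simp_all add: mem_frac_class fAr_ident\<close>)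
  then show ?thesis
    by (simp add: serre_quotient_def frac_arr_def)
qed

lemma hzero_quotient [simp]:
  assumes "X \<in> Ob A" "Y \<in> Ob A"
  shows "hzero quotient X Y = frac_arr X (hzero B (fOb F X) (fOb F Y)) Y"
proof -
  have "roof_rel A (functor_kernel A B F) X Y `` {(ident A X, hzero A X Y)} =
      frac_class X (hzero B (fOb F X) (fOb F Y)) Y"
    by (rule roof_rel_class) (use assms in \<open>simp_all add: mem_frac_class fAr_ident fAr_hzero\<close>)
  then show ?thesis
    by (simp add: serre_quotient_def frac_arr_def)
qed

lemma hadd_quotient [simp]:
  assumes h: "h \<in> fractions A B F X Y" and h': "h' \<in> fractions A B F X Y"
  shows "hadd quotient (frac_arr X h Y) (frac_arr X h' Y) = frac_arr X (hadd B h h') Y"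
proof -
  note [simp] = fractions_Hom [OF h] fractions_Hom [OF h']
  have "roof_rel A (functor_kernel A B F) X Y `` {(s, hadd A f g)} = frac_class X (hadd B h h') Y"
    if "(s, f) \<in> frac_class X h Y" "(s, g) \<in> frac_class X h' Y" for s f g
    using that fAr_hadd [of f "src A f" Y g]
    by (intro roof_rel_class) (simp_all add: mem_frac_class B.cmp_hadd)
  \<comment> \<open>Addition only pairs roofs with equal denominator, so its union is nonempty
    because two fractions have a common denominator.\<close>
  moreover have "\<exists>s f g. (s, f) \<in> frac_class X h Y \<and> (s, g) \<in> frac_class X h' Y"
  proof -
    obtain s f g where "s \<in> Ar A" "f \<in> Ar A" "g \<in> Ar A" "src A f = src A s" "src A g = src A s"
      "tgt A s = X" "tgt A f = Y" "tgt A g = Y" "is_iso B (fAr F s)"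
      "h \<cdot>\<^bsub>B\<^esub> fAr F s = fAr F f" "h' \<cdot>\<^bsub>B\<^esub> fAr F s = fAr F g"
      using common_denominator [OF h h'] by metis
    then show ?thesis
      by (intro exI [of _ s] exI [of _ f] exI [of _ g]) (simp add: mem_frac_class)
  qed
  ultimately have "\<Union> {roof_rel A (functor_kernel A B F) X Y `` {(s, hadd A f g)} | s f g.
      (s, f) \<in> frac_class X h Y \<and> (s, g) \<in> frac_class X h' Y} = frac_class X (hadd B h h') Y"
    by (intro Union_classes) blast+
  then show ?thesis
    by (simp add: serre_quotient_def frac_arr_def)
qed

lemma hsmult_quotient [simp]:
  assumes h: "h \<in> fractions A B F X Y" and a: "a \<in> carrier R"
  shows "hsmult quotient a (frac_arr X h Y) = frac_arr X (hsmult B a h) Y"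
proof -
  note [simp] = fractions_Hom [OF h]
  have "roof_rel A (functor_kernel A B F) X Y `` {(s, hsmult A a f)} = frac_class X (hsmult B a h) Y"
    if "(s, f) \<in> frac_class X h Y" for s f
    using that a by (intro roof_rel_class) (simp_all add: mem_frac_class B.cmp_hsmult fAr_hsmult)
  moreover have "\<exists>s f. (s, f) \<in> frac_class X h Y"
    using frac_class_nonempty [OF h] by fastforce
  ultimately have "\<Union> {roof_rel A (functor_kernel A B F) X Y `` {(s, hsmult A a f)} | s f.
      (s, f) \<in> frac_class X h Y} = frac_class X (hsmult B a h) Y"
    by (intro Union_classes) blast+
  then show ?thesis
    by (simp add: serre_quotient_def frac_arr_def)
qed

lemmas fraction_closed = cmp_fraction hadd_fraction hsmult_fraction hzero_fraction ident_fraction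

section \<open>The quotient is an abelian category\<close>

lemma category_quotient: "category quotient"
proof (rule category.intro)
  fix \<phi> assume "\<phi> \<in> Ar quotient"
  then obtain X Y h where h: "h \<in> fractions A B F X Y" "\<phi> = frac_arr X h Y"
    using quotient_HomE by metis
  then show "src quotient \<phi> \<in> Ob quotient" "tgt quotient \<phi> \<in> Ob quotient"
    "\<phi> \<cdot>\<^bsub>quotient\<^esub> ident quotient (src quotient \<phi>) = \<phi>"
    "ident quotient (tgt quotient \<phi>) \<cdot>\<^bsub>quotient\<^esub> \<phi> = \<phi>"
    using fractions_Ob [OF h(1)] fractions_Hom [OF h(1)] by (simp_all add: ident_fraction)
next
  fix X assume "X \<in> Ob quotient"
  then show "ident quotient X \<in> Hom quotient X X"
    by (simp add: ident_fraction)
next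
  fix \<phi> \<psi> X Y Z assume "\<phi> \<in> Hom quotient X Y" "\<psi> \<in> Hom quotient Y Z"
  then obtain h h' where "h \<in> fractions A B F X Y" "\<phi> = frac_arr X h Y"
    "h' \<in> fractions A B F Y Z" "\<psi> = frac_arr Y h' Z"
    by (auto elim!: quotient_HomE)
  then show "\<psi> \<cdot>\<^bsub>quotient\<^esub> \<phi> \<in> Hom quotient X Z"
    by (simp add: cmp_fraction)
next
  fix \<phi> \<psi> \<chi> W X Y Z assume "\<phi> \<in> Hom quotient W X" "\<psi> \<in> Hom quotient X Y" "\<chi> \<in> Hom quotient Y Z"
  then obtain h h' h'' where h: "h \<in> fractions A B F W X" "\<phi> = frac_arr W h X"
    "h' \<in> fractions A B F X Y" "\<psi> = frac_arr X h' Y"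
    "h'' \<in> fractions A B F Y Z" "\<chi> = frac_arr Y h'' Z"
    by (auto elim!: quotient_HomE)
  then show "(\<chi> \<cdot>\<^bsub>quotient\<^esub> \<psi>) \<cdot>\<^bsub>quotient\<^esub> \<phi> = \<chi> \<cdot>\<^bsub>quotient\<^esub> \<psi> \<cdot>\<^bsub>quotient\<^esub> \<phi>"
    using fractions_Hom [OF h(1)] fractions_Hom [OF h(3)] fractions_Hom [OF h(5)]
      cmp_fraction [OF h(1,3)] cmp_fraction [OF h(3,5)] B.assoc [of h h' h''] by simp
qed

text \<open>The fractions from X to Y are closed under the module operations of \<open>B\<close>, so
  each law is inherited from the Hom module there.\<close>

lemma Hom_module_quotient:
  assumes "X \<in> Ob A" "Y \<in> Ob A"
  shows "Module.module R (Hom_module quotient X Y)"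
proof -
  interpret M: Module.module R "Hom_module B (fOb F X) (fOb F Y)"
    by (rule B.module_Hom) (use assms in simp_all)
  let ?M = "Hom_module quotient X Y"
  have E: "\<exists>h \<in> fractions A B F X Y. \<phi> = frac_arr X h Y" if "\<phi> \<in> carrier ?M" for \<phi>
    using that quotient_HomE [of \<phi> X Y] by (auto simp: Hom_module_def)
  have H: "h \<in> Hom B (fOb F X) (fOb F Y)" if "h \<in> fractions A B F X Y" for h
    using fractions_Hom [OF that] by simp
  note G = B.hadd_group [OF H H H] B.hsmult_module [OF H H]
  note S = Hom_module_def hadd_fraction hsmult_fraction hzero_fraction assms
  have "abelian_group ?M"
  proof (rule abelian_groupI)
    fix \<phi> \<psi> \<chi>
    assume "\<phi> \<in> carrier ?M" "\<psi> \<in> carrier ?M" "\<chi> \<in> carrier ?M"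
    then obtain h h' h'' where h: "h \<in> fractions A B F X Y" "\<phi> = frac_arr X h Y"
      "h' \<in> fractions A B F X Y" "\<psi> = frac_arr X h' Y"
      "h'' \<in> fractions A B F X Y" "\<chi> = frac_arr X h'' Y"
      using E by metis
    show "(\<phi> \<oplus>\<^bsub>?M\<^esub> \<psi>) \<oplus>\<^bsub>?M\<^esub> \<chi> = \<phi> \<oplus>\<^bsub>?M\<^esub> (\<psi> \<oplus>\<^bsub>?M\<^esub> \<chi>)"
      using h by (simp add: S G(1) [OF h(1,3,5)])
  next
    fix \<phi> \<psi>
    assume "\<phi> \<in> carrier ?M" "\<psi> \<in> carrier ?M"
    then obtain h h' where h: "h \<in> fractions A B F X Y" "\<phi> = frac_arr X h Y"
      "h' \<in> fractions A B F X Y" "\<psi> = frac_arr X h' Y"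
      using E by metis
    show "\<phi> \<oplus>\<^bsub>?M\<^esub> \<psi> \<in> carrier ?M" "\<phi> \<oplus>\<^bsub>?M\<^esub> \<psi> = \<psi> \<oplus>\<^bsub>?M\<^esub> \<phi>"
      using h by (simp_all add: S G(2) [OF h(1,3,3)])
  next
    fix \<phi>
    assume "\<phi> \<in> carrier ?M"
    then obtain h where h: "h \<in> fractions A B F X Y" "\<phi> = frac_arr X h Y"
      using E by metis
    show "\<zero>\<^bsub>?M\<^esub> \<oplus>\<^bsub>?M\<^esub> \<phi> = \<phi>"
      using h by (simp add: S G(3) [OF h(1,1,1)])
    show "\<exists>\<psi> \<in> carrier ?M. \<psi> \<oplus>\<^bsub>?M\<^esub> \<phi> = \<zero>\<^bsub>?M\<^esub>"
      using h by (intro bexI [of _ "frac_arr X (hsmult B (\<ominus>\<^bsub>R\<^esub> \<one>\<^bsub>R\<^esub>) h) Y"])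
        (simp_all add: S G(5) [OF h(1,1,1)])
  qed (simp add: S)
  then show ?thesis
  proof (rule moduleI [OF A.R.cring_axioms])
    fix a b \<phi> \<psi>
    assume a: "a \<in> carrier R" and "\<phi> \<in> carrier ?M"
    then obtain h where h: "h \<in> fractions A B F X Y" "\<phi> = frac_arr X h Y"
      using E by metis
    show "a \<odot>\<^bsub>?M\<^esub> \<phi> \<in> carrier ?M"
      using h a by (simp add: S)
    show "(a \<otimes>\<^bsub>R\<^esub> b) \<odot>\<^bsub>?M\<^esub> \<phi> = a \<odot>\<^bsub>?M\<^esub> (b \<odot>\<^bsub>?M\<^esub> \<phi>)"
      "(a \<oplus>\<^bsub>R\<^esub> b) \<odot>\<^bsub>?M\<^esub> \<phi> = a \<odot>\<^bsub>?M\<^esub> \<phi> \<oplus>\<^bsub>?M\<^esub> b \<odot>\<^bsub>?M\<^esub> \<phi>" if b: "b \<in> carrier R"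
      using h a b by (simp_all add: S G(6,8) [OF h(1,1) a b])
    assume "\<psi> \<in> carrier ?M"
    then obtain h' where h': "h' \<in> fractions A B F X Y" "\<psi> = frac_arr X h' Y"
      using E by metis
    show "a \<odot>\<^bsub>?M\<^esub> (\<phi> \<oplus>\<^bsub>?M\<^esub> \<psi>) = a \<odot>\<^bsub>?M\<^esub> \<phi> \<oplus>\<^bsub>?M\<^esub> a \<odot>\<^bsub>?M\<^esub> \<psi>"
      using h h' a by (simp_all add: S G(7) [OF h(1) h'(1) a a])
  next
    fix \<phi>
    assume "\<phi> \<in> carrier ?M"
    then obtain h where h: "h \<in> fractions A B F X Y" "\<phi> = frac_arr X h Y"
      using E by metis
    show "\<one>\<^bsub>R\<^esub> \<odot>\<^bsub>?M\<^esub> \<phi> = \<phi>"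
      using h by (simp add: S G(9) [OF h(1,1) A.R.one_closed A.R.one_closed])
  qed
qed

lemma linear_category_quotient: "linear_category R quotient"
proof (intro linear_category.intro linear_category_axioms.intro category_quotient A.R.cring_axioms)
  show "Module.module R (Hom_module quotient X Y)" if "X \<in> Ob quotient" "Y \<in> Ob quotient" for X Y
    using Hom_module_quotient that by simp
next
  fix \<phi> \<psi> \<psi>' X Y Z
  assume "\<phi> \<in> Hom quotient X Y" "\<psi> \<in> Hom quotient Y Z" "\<psi>' \<in> Hom quotient Y Z"
  then obtain h h' h'' where h: "h \<in> fractions A B F X Y" "\<phi> = frac_arr X h Y"
    "h' \<in> fractions A B F Y Z" "\<psi> = frac_arr Y h' Z"
    "h'' \<in> fractions A B F Y Z" "\<psi>' = frac_arr Y h'' Z"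
    by (auto elim!: quotient_HomE)
  then show "hadd quotient \<psi> \<psi>' \<cdot>\<^bsub>quotient\<^esub> \<phi> = hadd quotient (\<psi> \<cdot>\<^bsub>quotient\<^esub> \<phi>) (\<psi>' \<cdot>\<^bsub>quotient\<^esub> \<phi>)"
    using fractions_Hom [OF h(1)] fractions_Hom [OF h(3)] fractions_Hom [OF h(5)]
    by (simp add: fraction_closed B.cmp_hadd)
next
  fix \<phi> \<phi>' \<psi> X Y Z
  assume "\<phi> \<in> Hom quotient X Y" "\<phi>' \<in> Hom quotient X Y" "\<psi> \<in> Hom quotient Y Z"
  then obtain h h' h'' where h: "h \<in> fractions A B F X Y" "\<phi> = frac_arr X h Y"
    "h' \<in> fractions A B F X Y" "\<phi>' = frac_arr X h' Y"
    "h'' \<in> fractions A B F Y Z" "\<psi> = frac_arr Y h'' Z"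
    by (auto elim!: quotient_HomE)
  then show "\<psi> \<cdot>\<^bsub>quotient\<^esub> hadd quotient \<phi> \<phi>' = hadd quotient (\<psi> \<cdot>\<^bsub>quotient\<^esub> \<phi>) (\<psi> \<cdot>\<^bsub>quotient\<^esub> \<phi>')"
    using fractions_Hom [OF h(1)] fractions_Hom [OF h(3)] fractions_Hom [OF h(5)]
    by (simp add: fraction_closed B.cmp_hadd)
next
  fix a \<phi> \<psi> X Y Z
  assume a: "a \<in> carrier R" and "\<phi> \<in> Hom quotient X Y" "\<psi> \<in> Hom quotient Y Z"
  then obtain h h' where h: "h \<in> fractions A B F X Y" "\<phi> = frac_arr X h Y"
    "h' \<in> fractions A B F Y Z" "\<psi> = frac_arr Y h' Z"
    by (auto elim!: quotient_HomE)
  then show "hsmult quotient a \<psi> \<cdot>\<^bsub>quotient\<^esub> \<phi> = hsmult quotient a (\<psi> \<cdot>\<^bsub>quotient\<^esub> \<phi>)"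
    "\<psi> \<cdot>\<^bsub>quotient\<^esub> hsmult quotient a \<phi> = hsmult quotient a (\<psi> \<cdot>\<^bsub>quotient\<^esub> \<phi>)"
    using fractions_Hom [OF h(1)] fractions_Hom [OF h(3)] a
    by (simp_all add: fraction_closed B.cmp_hsmult)
qed

lemma linear_functor_projection:
  "linear_functor R A quotient (serre_projection A (functor_kernel A B F))"
    (is "linear_functor R A _ ?Q")
proof -
  note S = serre_projection_fAr fAr_fraction
  show ?thesis
  proof (intro linear_functor.intro linear_functor_axioms.intro is_functor.intro is_functor_axioms.intro
      A.linear_category_axioms linear_category_quotient category_quotient A.category_axioms)
    fix f assume f: "f \<in> Ar A"
    then show "fAr ?Q f \<in> Hom quotient (fOb ?Q (src A f)) (fOb ?Q (tgt A f))"
      by (simp add: S)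
    show "fAr ?Q (hsmult A a f) = hsmult quotient a (fAr ?Q f)" if "a \<in> carrier R" for a
      using that f by (simp add: S fAr_hsmult)
  next
    fix f g X Y Z
    assume "f \<in> Hom A X Y" "g \<in> Hom A Y Z"
    then show "fAr ?Q (g \<cdot>\<^bsub>A\<^esub> f) = fAr ?Q g \<cdot>\<^bsub>quotient\<^esub> fAr ?Q f"
      using fAr_fraction [of f] fAr_fraction [of g] by (auto simp: S fAr_comp)
  next
    fix f g X Y
    assume "f \<in> Hom A X Y" "g \<in> Hom A X Y"
    then show "fAr ?Q (hadd A f g) = hadd quotient (fAr ?Q f) (fAr ?Q g)"
      using fAr_fraction [of f] fAr_fraction [of g] fAr_hadd [of f X Y g] by (simp add: S)
  qed (simp_all add: S fAr_ident)
qed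

text \<open>Identity and zero arrow of X are the fractions tagged by those of F X, and tags are
  unique; so they agree in the quotient iff they agree in \<open>B\<close>.\<close>

lemma zero_object_quotient:
  "is_zero_object quotient X \<longleftrightarrow> X \<in> functor_kernel A B F"
proof -
  have "is_zero_object quotient X \<longleftrightarrow> X \<in> Ob A \<and> is_zero_object B (fOb F X)"
    unfolding linear_category.is_zero_object_iff [OF linear_category_quotient] B.is_zero_object_iff
    by (auto simp: ident_fraction hzero_fraction)
  then show ?thesis
    by (simp add: functor_kernel_def)
qed

lemma kernel_quotientI:
  assumes h: "h \<in> fractions A B F X Y" and \<kappa>: "\<kappa> \<in> fractions A B F N X" and k: "is_kernel B \<kappa> h"
    and lift: "\<And>W g. g \<in> fractions A B F W X \<Longrightarrow> h \<cdot>\<^bsub>B\<^esub> g = hzero B (fOb F W) (fOb F Y) \<Longrightarrow>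
      \<exists>u \<in> fractions A B F W N. \<kappa> \<cdot>\<^bsub>B\<^esub> u = g"
  shows "is_kernel quotient (frac_arr N \<kappa> X) (frac_arr X h Y)"
proof (rule linear_category.kernelI [OF linear_category_quotient])
  note [simp] = fractions_Hom [OF h] fractions_Hom [OF \<kappa>] fractions_Ob [OF h] fractions_Ob [OF \<kappa>]
  show "is_mono quotient (frac_arr N \<kappa> X)"
    unfolding is_mono_def
  proof (intro conjI allI ballI impI)
    fix W \<phi> \<psi>
    assume "\<phi> \<in> Hom quotient W (src quotient (frac_arr N \<kappa> X))"
      "\<psi> \<in> Hom quotient W (src quotient (frac_arr N \<kappa> X))" and
      eq: "frac_arr N \<kappa> X \<cdot>\<^bsub>quotient\<^esub> \<phi> = frac_arr N \<kappa> X \<cdot>\<^bsub>quotient\<^esub> \<psi>"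
    then obtain g g' where g: "g \<in> fractions A B F W N" "\<phi> = frac_arr W g N"
      "g' \<in> fractions A B F W N" "\<psi> = frac_arr W g' N"
      by (auto elim!: quotient_HomE)
    then have "\<kappa> \<cdot>\<^bsub>B\<^esub> g = \<kappa> \<cdot>\<^bsub>B\<^esub> g'"
      using eq \<kappa> cmp_fraction [OF g(1) \<kappa>] cmp_fraction [OF g(3) \<kappa>] by simp
    then have "g = g'"
      using B.monoD [OF B.kernel_mono [OF k], of g g'] fractions_Hom [OF g(1)] fractions_Hom
        [OF g(3)]
      by simp
    then show "\<phi> = \<psi>"
      using g by simp
  qed (use \<kappa> in simp)
  show "frac_arr X h Y \<cdot>\<^bsub>quotient\<^esub> frac_arr N \<kappa> X =
      hzero quotient (src quotient (frac_arr N \<kappa> X)) (tgt quotient (frac_arr X h Y))"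
    using h \<kappa> B.kernelD(4) [OF k] by simp
  fix W \<phi>
  assume "\<phi> \<in> Hom quotient W (src quotient (frac_arr X h Y))" and
    0: "frac_arr X h Y \<cdot>\<^bsub>quotient\<^esub> \<phi> = hzero quotient W (tgt quotient (frac_arr X h Y))"
  then obtain g where g: "g \<in> fractions A B F W X" "\<phi> = frac_arr W g X"
    by (auto elim!: quotient_HomE)
  then have "h \<cdot>\<^bsub>B\<^esub> g = hzero B (fOb F W) (fOb F Y)"
    using 0 h cmp_fraction [OF g(1) h] fractions_Ob [OF g(1)] hzero_fraction [of W Y] by simp
  then obtain u where "u \<in> fractions A B F W N" "\<kappa> \<cdot>\<^bsub>B\<^esub> u = g"
    using lift g(1) by blast
  then show "\<exists>\<psi> \<in> Hom quotient W (src quotient (frac_arr N \<kappa> X)). frac_arr N \<kappa> X \<cdot>\<^bsub>quotient\<^esub> \<psi> = \<phi>"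
    using g \<kappa> by (intro bexI [of _ "frac_arr W u N"]) simp_all
qed (use h in simp_all)

text \<open>The quotient is built from right roofs, so the quotient of the opposite category is not
  literally the opposite of the quotient. Duality is therefore used for fractions and for the
  criterion \<open>kernelI\<close>, while this translation is carried out by hand.\<close>

lemma cokernel_quotientI:
  assumes h: "h \<in> fractions A B F X Y" and \<gamma>: "\<gamma> \<in> fractions A B F Y N" and c: "is_cokernel B \<gamma> h"
    and desc: "\<And>W g. g \<in> fractions A B F Y W \<Longrightarrow> g \<cdot>\<^bsub>B\<^esub> h = hzero B (fOb F X) (fOb F W) \<Longrightarrow>
      \<exists>u \<in> fractions A B F N W. u \<cdot>\<^bsub>B\<^esub> \<gamma> = g"
  shows "is_cokernel quotient (frac_arr Y \<gamma> N) (frac_arr X h Y)"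
  unfolding is_kernel_lopp [symmetric]
proof (rule linear_category.kernelI
    [OF linear_category.linear_category_lopp [OF linear_category_quotient]])
  note [simp] = fractions_Hom [OF h] fractions_Hom [OF \<gamma>] fractions_Ob [OF h] fractions_Ob [OF \<gamma>]
  have "is_epi quotient (frac_arr Y \<gamma> N)"
    unfolding is_epi_def
  proof (intro conjI allI ballI impI)
    fix W \<phi> \<psi>
    assume "\<phi> \<in> Hom quotient (tgt quotient (frac_arr Y \<gamma> N)) W"
      "\<psi> \<in> Hom quotient (tgt quotient (frac_arr Y \<gamma> N)) W" and
      eq: "\<phi> \<cdot>\<^bsub>quotient\<^esub> frac_arr Y \<gamma> N = \<psi> \<cdot>\<^bsub>quotient\<^esub> frac_arr Y \<gamma> N"
    then obtain g g' where g: "g \<in> fractions A B F N W" "\<phi> = frac_arr N g W"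
      "g' \<in> fractions A B F N W" "\<psi> = frac_arr N g' W"
      by (auto elim!: quotient_HomE)
    then have "g \<cdot>\<^bsub>B\<^esub> \<gamma> = g' \<cdot>\<^bsub>B\<^esub> \<gamma>"
      using eq \<gamma> cmp_fraction [OF \<gamma> g(1)] cmp_fraction [OF \<gamma> g(3)] by simp
    then have "g = g'"
      using B.epiD [OF B.cokernel_epi [OF c], of g g'] fractions_Hom [OF g(1)] fractions_Hom
        [OF g(3)]
      by simp
    then show "\<phi> = \<psi>"
      using g by simp
  qed (use \<gamma> in simp)
  then show "is_mono (lopp quotient) (frac_arr Y \<gamma> N)"
    by simp
  show "frac_arr X h Y \<cdot>\<^bsub>lopp quotient\<^esub> frac_arr Y \<gamma> N =
      hzero (lopp quotient) (src (lopp quotient) (frac_arr Y \<gamma> N))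
        (tgt (lopp quotient) (frac_arr X h Y))"
    using h \<gamma> B.cokernelD(4) [OF c] by simp
  fix W \<phi>
  assume "\<phi> \<in> Hom (lopp quotient) W (src (lopp quotient) (frac_arr X h Y))" and
    "frac_arr X h Y \<cdot>\<^bsub>lopp quotient\<^esub> \<phi> = hzero (lopp quotient) W (tgt (lopp quotient) (frac_arr X h Y))"
  then obtain g where g: "g \<in> fractions A B F Y W" "\<phi> = frac_arr Y g W" and
    0: "\<phi> \<cdot>\<^bsub>quotient\<^esub> frac_arr X h Y = hzero quotient X W"
    by (auto elim!: quotient_HomE)
  then have "g \<cdot>\<^bsub>B\<^esub> h = hzero B (fOb F X) (fOb F W)"
    using 0 h cmp_fraction [OF h g(1)] fractions_Ob [OF g(1)] hzero_fraction [of X W] by simp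
  then obtain u where "u \<in> fractions A B F N W" "u \<cdot>\<^bsub>B\<^esub> \<gamma> = g"
    using desc g(1) by blast
  then show "\<exists>\<psi> \<in> Hom (lopp quotient) W (src (lopp quotient) (frac_arr Y \<gamma> N)).
      frac_arr Y \<gamma> N \<cdot>\<^bsub>lopp quotient\<^esub> \<psi> = \<phi>"
    using g \<gamma> by (intro bexI [of _ "frac_arr N u W"]) simp_all
qed (use h in simp_all)

lemma ex_kernel_quotient:
  assumes h: "h \<in> fractions A B F X Y"
  shows "\<exists>N. \<exists>\<kappa> \<in> fractions A B F N X. is_kernel B \<kappa> h \<and>
    is_kernel quotient (frac_arr N \<kappa> X) (frac_arr X h Y)"
  using ex_fraction_kernel [OF h] kernel_quotientI [OF h] by meson

lemma ex_cokernel_quotient: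
  assumes h: "h \<in> fractions A B F X Y"
  shows "\<exists>N. \<exists>\<gamma> \<in> fractions A B F Y N. is_cokernel B \<gamma> h \<and>
    is_cokernel quotient (frac_arr Y \<gamma> N) (frac_arr X h Y)"
  using ex_fraction_cokernel [OF h] cokernel_quotientI [OF h] by meson

text \<open>In the quotient, mono is tested only against fractions, which may be fewer than the
  arrows of \<open>B\<close>. The kernel decides: one fraction is the kernel of \<open>h\<close> in
  both categories, and its source is zero in the quotient iff its image is zero in
  \<open>B\<close>.\<close>

lemma mono_of_mono_quotient:
  assumes h: "h \<in> fractions A B F X Y" and m: "is_mono quotient (frac_arr X h Y)"
  shows "is_mono B h"
proof -
  obtain N \<kappa> where \<kappa>: "\<kappa> \<in> fractions A B F N X" "is_kernel B \<kappa> h"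
    "is_kernel quotient (frac_arr N \<kappa> X) (frac_arr X h Y)"
    using ex_kernel_quotient [OF h] by blast
  have "is_zero_object quotient N"
    using linear_category.zero_kernel_of_mono [OF linear_category_quotient \<kappa>(3) m] by simp
  then have "is_zero_object B (src B \<kappa>)"
    using fractions_Hom [OF \<kappa>(1)] unfolding zero_object_quotient by (simp add: functor_kernel_def)
  then show ?thesis
    by (rule B.mono_of_zero_kernel [OF \<kappa>(2)])
qed

lemma epi_of_epi_quotient:
  assumes h: "h \<in> fractions A B F X Y" and e: "is_epi quotient (frac_arr X h Y)"
  shows "is_epi B h"
proof -
  obtain N \<gamma> where \<gamma>: "\<gamma> \<in> fractions A B F Y N" "is_cokernel B \<gamma> h"
    "is_cokernel quotient (frac_arr Y \<gamma> N) (frac_arr X h Y)"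
    using ex_cokernel_quotient [OF h] by blast
  have "is_zero_object quotient N"
    using linear_category.zero_cokernel_of_epi [OF linear_category_quotient \<gamma>(3) e] by simp
  then have "is_zero_object B (tgt B \<gamma>)"
    using fractions_Hom [OF \<gamma>(1)] unfolding zero_object_quotient by (simp add: functor_kernel_def)
  then show ?thesis
    by (rule B.epi_of_zero_cokernel [OF \<gamma>(2)])
qed

lemma abelian_category_quotient: "abelian_category R quotient"
proof (intro abelian_category.intro abelian_category_axioms.intro linear_category_quotient)
  obtain Z where "is_zero_object A Z"
    using A.ex_zero_object by blast
  then show "\<exists>Z. is_zero_object quotient Z"
    using fOb_zero [of Z] zero_object_quotient [of Z]
    by (auto simp: functor_kernel_def A.is_zero_object_iff)
next
  fix X Y assume XY: "X \<in> Ob quotient" "Y \<in> Ob quotient"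
  then obtain P i j p q where "is_biproduct A X Y P i j p q"
    using A.ex_biproduct [of X Y] by auto
  from linear_functor.fAr_biproduct [OF linear_functor_projection this] XY
  show "\<exists>P i j p q. is_biproduct quotient X Y P i j p q"
    unfolding serre_projection_fOb quotient_simps by blast
next
  fix \<phi> assume "\<phi> \<in> Ar quotient"
  then obtain X Y h where h: "h \<in> fractions A B F X Y" "\<phi> = frac_arr X h Y"
    using quotient_HomE by metis
  show "\<exists>k. is_kernel quotient k \<phi>" "\<exists>c. is_cokernel quotient c \<phi>"
    using ex_kernel_quotient [OF h(1)] ex_cokernel_quotient [OF h(1)] h(2) by blast+
next
  fix \<phi> assume m: "is_mono quotient \<phi>"
  then obtain X Y h where h: "h \<in> fractions A B F X Y" "\<phi> = frac_arr X h Y"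
    using quotient_HomE unfolding is_mono_def by metis
  then have "is_mono B h"
    using m mono_of_mono_quotient by blast
  then obtain Z f where f: "f \<in> fractions A B F Y Z" "is_kernel B h f"
    "\<And>W g. g \<in> fractions A B F W Y \<Longrightarrow> f \<cdot>\<^bsub>B\<^esub> g = hzero B (fOb F W) (fOb F Z) \<Longrightarrow>
      \<exists>u \<in> fractions A B F W X. h \<cdot>\<^bsub>B\<^esub> u = g"
    using mono_fraction_is_kernel [OF h(1)] by blast
  show "\<exists>\<psi>. is_kernel quotient \<phi> \<psi>"
    using kernel_quotientI [OF f(1) h(1) f(2,3)] h(2) by blast
next
  fix \<phi> assume e: "is_epi quotient \<phi>"
  then obtain X Y h where h: "h \<in> fractions A B F X Y" "\<phi> = frac_arr X h Y"
    using quotient_HomE unfolding is_epi_def by metis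
  then have "is_epi B h"
    using e epi_of_epi_quotient by blast
  then obtain Z f where f: "f \<in> fractions A B F Z X" "is_cokernel B h f"
    "\<And>W g. g \<in> fractions A B F X W \<Longrightarrow> g \<cdot>\<^bsub>B\<^esub> f = hzero B (fOb F Z) (fOb F W) \<Longrightarrow>
      \<exists>u \<in> fractions A B F Y W. u \<cdot>\<^bsub>B\<^esub> h = g"
    using epi_fraction_is_cokernel [OF h(1)] by blast
  show "\<exists>\<psi>. is_cokernel quotient \<phi> \<psi>"
    using cokernel_quotientI [OF f(1) h(1) f(2,3)] h(2) by blast
qed

section \<open>The factorisation through the quotient\<close>

lemma serre_factor_fOb [simp]: "fOb (serre_factor B F) X = fOb F X"
  by (simp add: serre_factor_def)

text \<open>A single roof (s, f) of the class already determines the described arrow, since the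
  image of s is invertible. The factorisation thus reads off the tag of a class.\<close>

lemma serre_factor_frac_arr [simp]:
  assumes h: "h \<in> fractions A B F X Y"
  shows "fAr (serre_factor B F) (frac_arr X h Y) = h"
proof -
  obtain s f where s: "(s, f) \<in> frac_class X h Y"
    using frac_class_nonempty [OF h] by fastforce
  have "(THE h'. h' \<in> Hom B (fOb F X) (fOb F Y) \<and>
      (\<forall>(s, f) \<in> frac_class X h Y. h' \<cdot>\<^bsub>B\<^esub> fAr F s = fAr F f)) = h"
  proof (rule the_equality)
    show "h \<in> Hom B (fOb F X) (fOb F Y) \<and> (\<forall>(s, f) \<in> frac_class X h Y. h \<cdot>\<^bsub>B\<^esub> fAr F s = fAr F f)"
      using fractions_Hom [OF h] by (auto simp: frac_class_def)
  next
    fix h'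
    assume h': "h' \<in> Hom B (fOb F X) (fOb F Y) \<and>
      (\<forall>(s, f) \<in> frac_class X h Y. h' \<cdot>\<^bsub>B\<^esub> fAr F s = fAr F f)"
    then have "(s, f) \<in> frac_class X h' Y"
      using s by (auto simp: mem_frac_class)
    then show "h' = h"
      using frac_class_unique [OF _ s] h' fractions_Hom [OF h] by auto
  qed
  then show ?thesis
    by (simp add: serre_factor_def frac_arr_def)
qed

lemma linear_functor_factor: "linear_functor R quotient B (serre_factor B F)"
  (is "linear_functor R _ B ?r")
proof (intro linear_functor.intro linear_functor_axioms.intro is_functor.intro is_functor_axioms.intro
      B.linear_category_axioms linear_category_quotient category_quotient B.category_axioms)
    fix \<phi> assume "\<phi> \<in> Ar quotient"
    then obtain X Y h where h: "h \<in> fractions A B F X Y" "\<phi> = frac_arr X h Y"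
      using quotient_HomE by metis
    then show "fAr ?r \<phi> \<in> Hom B (fOb ?r (src quotient \<phi>)) (fOb ?r (tgt quotient \<phi>))"
      using fractions_Hom [OF h(1)] by simp
    show "fAr ?r (hsmult quotient a \<phi>) = hsmult B a (fAr ?r \<phi>)" if "a \<in> carrier R" for a
      using that h by (simp add: hsmult_fraction)
  next
    fix \<phi> \<psi> X Y Z
    assume "\<phi> \<in> Hom quotient X Y" "\<psi> \<in> Hom quotient Y Z"
    then obtain h h' where "h \<in> fractions A B F X Y" "\<phi> = frac_arr X h Y"
      "h' \<in> fractions A B F Y Z" "\<psi> = frac_arr Y h' Z"
      by (auto elim!: quotient_HomE)
    then show "fAr ?r (\<psi> \<cdot>\<^bsub>quotient\<^esub> \<phi>) = fAr ?r \<psi> \<cdot>\<^bsub>B\<^esub> fAr ?r \<phi>"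
      by (simp add: cmp_fraction)
  next
    fix \<phi> \<psi> X Y
    assume "\<phi> \<in> Hom quotient X Y" "\<psi> \<in> Hom quotient X Y"
    then obtain h h' where "h \<in> fractions A B F X Y" "\<phi> = frac_arr X h Y"
      "h' \<in> fractions A B F X Y" "\<psi> = frac_arr X h' Y"
      by (auto elim!: quotient_HomE)
    then show "fAr ?r (hadd quotient \<phi> \<psi>) = hadd B (fAr ?r \<phi>) (fAr ?r \<psi>)"
      by (simp add: hadd_fraction)
  qed (simp_all add: ident_fraction)

text \<open>A kernel in the quotient is compared with the one built from fractions, which is a
  kernel in \<open>B\<close> as well. They differ by an isomorphism of the quotient, which the
  functor preserves; cokernels are treated alike.\<close>

lemma exact_functor_factor: "exact_functor R quotient B (serre_factor B F)"
  (is "exact_functor R _ B ?r")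
proof (intro exact_functor.intro exact_functor_axioms.intro linear_functor_factor
    abelian_category_quotient B.abelian_category_axioms)
  interpret Q: abelian_category R quotient
    by (rule abelian_category_quotient)
  interpret r: linear_functor R quotient B ?r
    by (rule linear_functor_factor)
  fix \<phi> \<psi>
  assume "short_exact quotient \<phi> \<psi>"
  then have k: "is_kernel quotient \<phi> \<psi>" and c: "is_cokernel quotient \<psi> \<phi>"
    by (simp_all add: short_exact_def)
  show "short_exact B (fAr ?r \<phi>) (fAr ?r \<psi>)"
    unfolding short_exact_def
  proof
    obtain X Y h where h: "h \<in> fractions A B F X Y" "\<psi> = frac_arr X h Y"
      using quotient_HomE Q.kernelD(2) [OF k] by metis
    obtain N \<kappa>
      where \<kappa>: "\<kappa> \<in> fractions A B F N X" "is_kernel B \<kappa> h" "is_kernel quotient (frac_arr N \<kappa> X) \<psi>"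
      using ex_kernel_quotient [OF h(1)] h(2) by blast
    obtain \<theta> where \<theta>: "is_iso quotient \<theta>" "tgt quotient \<theta> = N" "frac_arr N \<kappa> X \<cdot>\<^bsub>quotient\<^esub> \<theta> = \<phi>"
      using Q.kernel_unique [OF \<kappa>(3) k] by (metis quotient_simps(2))
    have "fAr ?r \<phi> = \<kappa> \<cdot>\<^bsub>B\<^esub> fAr ?r \<theta>"
      using r.fAr_comp [of \<theta> "frac_arr N \<kappa> X"] \<theta> Q.iso_Ar \<kappa>(1) by simp
    then show "is_kernel B (fAr ?r \<phi>) (fAr ?r \<psi>)"
      using B.kernel_cmp_iso [OF \<kappa>(2) r.fAr_iso [OF \<theta>(1)]] Q.iso_Ar [OF \<theta>(1)] \<theta>(2) h
        fractions_Hom [OF \<kappa>(1)] by simp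
  next
    obtain X Y h where h: "h \<in> fractions A B F X Y" "\<phi> = frac_arr X h Y"
      using quotient_HomE Q.cokernelD(2) [OF c] by metis
    obtain N \<gamma> where \<gamma>: "\<gamma> \<in> fractions A B F Y N" "is_cokernel B \<gamma> h"
      "is_cokernel quotient (frac_arr Y \<gamma> N) \<phi>"
      using ex_cokernel_quotient [OF h(1)] h(2) by blast
    obtain \<theta> where \<theta>: "is_iso quotient \<theta>" "src quotient \<theta> = N" "\<theta> \<cdot>\<^bsub>quotient\<^esub> frac_arr Y \<gamma> N = \<psi>"
      using Q.cokernel_unique [OF \<gamma>(3) c] by (metis quotient_simps(3))
    have "fAr ?r \<psi> = fAr ?r \<theta> \<cdot>\<^bsub>B\<^esub> \<gamma>"
      using r.fAr_comp [of "frac_arr Y \<gamma> N" \<theta>] \<theta> Q.iso_Ar \<gamma>(1) by simp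
    then show "is_cokernel B (fAr ?r \<psi>) (fAr ?r \<phi>)"
      using B.iso_cmp_cokernel [OF \<gamma>(2) r.fAr_iso [OF \<theta>(1)]] Q.iso_Ar [OF \<theta>(1)] \<theta>(2) h
        fractions_Hom [OF \<gamma>(1)] by simp
  qed
qed

lemma faithful_factor: "is_faithful quotient (serre_factor B F)"
  unfolding is_faithful_def
proof (intro ballI inj_onI)
  fix X Y \<phi> \<psi>
  assume "\<phi> \<in> Hom quotient X Y" "\<psi> \<in> Hom quotient X Y" and
    eq: "fAr (serre_factor B F) \<phi> = fAr (serre_factor B F) \<psi>"
  then obtain h h' where "h \<in> fractions A B F X Y" "\<phi> = frac_arr X h Y"
    "h' \<in> fractions A B F X Y" "\<psi> = frac_arr X h' Y"
    by (auto elim!: quotient_HomE)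
  then show "\<phi> = \<psi>"
    using eq by simp
qed

lemma serre_factor_projection:
  "f \<in> Ar A \<Longrightarrow> fAr (serre_factor B F) (fAr (serre_projection A (functor_kernel A B F)) f) = fAr F f"
  by (simp add: serre_projection_fAr fAr_fraction)

end

section \<open>Transport along isomorphisms and zero objects of a quotient\<close>

lemma nat_iso_cong:
  assumes "nat_iso A B F G \<theta>" "category A"
    and "\<And>X. X \<in> Ob A \<Longrightarrow> fOb G' X = fOb G X" "\<And>f. f \<in> Ar A \<Longrightarrow> fAr G' f = fAr G f"
  shows "nat_iso A B F G' \<theta>"
  using assms by (simp add: nat_iso_def)

lemma isomorphic_functors_of_eq:
  assumes F: "is_functor A B F" and Ob: "\<And>X. X \<in> Ob A \<Longrightarrow> fOb G X = fOb F X"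
    and Ar: "\<And>f. f \<in> Ar A \<Longrightarrow> fAr G f = fAr F f"
  shows "isomorphic_functors A B F G"
proof -
  interpret is_functor A B F
    by (rule F)
  have "nat_iso A B F G (\<lambda>X. ident B (fOb F X))"
    by (simp add: nat_iso_def Ob Ar)
  then show ?thesis
    by (auto simp: isomorphic_functors_def)
qed

text \<open>Functors are total functions on the types, so a functor acting as the identity on all
  objects and arrows of \<open>K\<close> may still differ from \<open>id_functor\<close> outside;
  hence the pointwise hypotheses.\<close>

lemma linear_equivalence_identity:
  assumes K: "linear_category R K" and Ob: "\<And>X. X \<in> Ob K \<Longrightarrow> fOb E X = X"
    and Ar: "\<And>f. f \<in> Ar K \<Longrightarrow> fAr E f = f"
  shows "linear_equivalence R K K E"
proof -
  interpret K: linear_category R K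
    by (rule K)
  have E: "linear_functor R K K E'"
    if "\<And>X. X \<in> Ob K \<Longrightarrow> fOb E' X = X" "\<And>f. f \<in> Ar K \<Longrightarrow> fAr E' f = f" for E'
    by (intro linear_functor.intro linear_functor_axioms.intro is_functor.intro is_functor_axioms.intro
        K.linear_category_axioms K.category_axioms) (auto simp: that)
  have "linear_functor R K K id_functor"
    by (rule E) (simp_all add: id_functor_def)
  moreover have "isomorphic_functors K K (functor_comp id_functor E) id_functor"
    "isomorphic_functors K K (functor_comp E id_functor) id_functor"
    by (intro isomorphic_functors_of_eq linear_functor.axioms(3) [of R] E;
        simp add: Ob Ar id_functor_def functor_comp_def)+
  ultimately show ?thesis
    using E [of E] Ob Ar unfolding linear_equivalence_def by blast
qed

lemma (in linear_category) zero_object_iso: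
  assumes s: "is_iso A s"
  shows "is_zero_object A (src A s) \<longleftrightarrow> is_zero_object A (tgt A s)"
proof -
  obtain t where t: "t \<in> Ar A" "src A t = tgt A s" "tgt A t = src A s"
    "t \<cdot> s = ident A (src A s)" "s \<cdot> t = ident A (tgt A s)"
    using s by (elim is_isoE)
  note [simp] = iso_Ar [OF s] t(1-3)
  have "is_zero_object A Y"
    if "is_zero_object A X" "f \<in> Hom A X Y" "g \<in> Hom A Y X" "f \<cdot> g = ident A Y" for X Y f g
  proof -
    have "f = f \<cdot> ident A X"
      using that by simp
    also have "\<dots> = hzero A X Y"
      using that by (auto simp: is_zero_object_iff)
    finally have "ident A Y = hzero A X Y \<cdot> g"
      using that by simp
    then show ?thesis
      using that by (auto simp: is_zero_object_iff)
  qed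
  from this [of _ s _ t] this [of _ t _ s] show ?thesis
    using t by auto
qed

text \<open>Here \<open>I\<close> need not be the kernel of an exact functor, so no description by
  fractions is at hand and roofs are used directly. That the identity of X equals zero in the
  quotient gives an inverted u into X which is itself a zero arrow. Its cokernel object lies in
  \<open>I\<close>, and the cokernel of a zero arrow into X is an isomorphism from X.\<close>

lemma (in abelian_category) zero_object_serre_quotientD:
  assumes K: "linear_category R (serre_quotient A I)" and I: "\<And>Z. is_zero_object A Z \<Longrightarrow> Z \<in> I"
    and X: "is_zero_object (serre_quotient A I) X"
  obtains c where "is_iso A c" "src A c = X" "tgt A c \<in> I"
proof -
  have "X \<in> Ob (serre_quotient A I)" and
    eq: "ident (serre_quotient A I) X = hzero (serre_quotient A I) X X"
    using X linear_category.is_zero_object_iff [OF K] by simp_all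
  then have [simp]: "X \<in> Ob A"
    by (simp add: serre_quotient_def)
  obtain k c where k: "is_kernel A k (ident A X)" and c: "is_cokernel A c (ident A X)"
    using ex_kernel [of "ident A X"] ex_cokernel [of "ident A X"] by auto
  have "is_epi A (ident A X)"
    unfolding is_epi_def by auto
  then have "is_zero_object A (src A k)" "is_zero_object A (tgt A c)"
    using zero_kernel_of_mono [OF k] zero_cokernel_of_epi [OF c] iso_mono [of "ident A X"]
    by simp_all
  then have id: "ident A X \<in> iso_mod A I"
    using k c I unfolding iso_mod_def by auto
  \<comment> \<open>The roof with denominator the identity and numerator zero belongs to its own
    class; this needs the identity to be inverted, hence zero objects in \<open>I\<close>. Otherwise
    both classes could be empty and their equality would say nothing.\<close>
  have "((ident A X, hzero A X X), (ident A X, hzero A X X)) \<in> roof_rel A I X X"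
    unfolding roof_rel_def roofs_def using id
    by (auto intro!: exI [of _ X] bexI [of _ "ident A X"])
  moreover have
    "roof_rel A I X X `` {(ident A X, ident A X)} = roof_rel A I X X `` {(ident A X, hzero A X X)}"
    using eq by (simp add: serre_quotient_def)
  ultimately have "((ident A X, ident A X), (ident A X, hzero A X X)) \<in> roof_rel A I X X"
    by blast
  then obtain W u v where u: "u \<in> Hom A W X" "v \<in> Hom A W X" "ident A X \<cdot> u \<in> iso_mod A I"
    "ident A X \<cdot> u = hzero A X X \<cdot> v"
    unfolding roof_rel_def by auto
  have "src A v \<in> Ob A"
    using u(2) by (intro src_in_Ob) simp
  then have [simp]: "W \<in> Ob A"
    using u(2) by simp
  have "hzero A W X \<in> iso_mod A I"
    using u by simp
  then obtain c where c: "is_cokernel A c (hzero A W X)" "tgt A c \<in> I"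
    unfolding iso_mod_def by auto
  then have "is_iso A c"
    using linear_category.kernel_hzero_iso [OF linear_category_lopp, of c X W] by simp
  then show ?thesis
    using c cokernelD [OF c(1)] by (intro that [of c]) simp_all
qed

text \<open>The projection factored through itself is the identity on arrows. Rewritten in
  \<open>B\<close>, the description in \<open>serre_factor\<close> is the condition that ties a
  class to its tag, and one roof again ensures uniqueness.\<close>

lemma (in exact_functor) serre_factor_projection_identity:
  fixes Q defines "Q \<equiv> serre_projection A (functor_kernel A B F)"
  assumes "\<phi> \<in> Ar quotient"
  shows "fAr (serre_factor quotient Q) \<phi> = \<phi>"
proof -
  obtain X Y h where h: "h \<in> fractions A B F X Y" "\<phi> = frac_arr X h Y"
    using assms quotient_HomE by metis
  note [simp] = fractions_Hom [OF h(1)]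
  obtain s f where s: "(s, f) \<in> frac_class X h Y"
    using frac_class_nonempty [OF h(1)] by fastforce
  have iff: "\<psi> \<cdot>\<^bsub>quotient\<^esub> fAr Q s = fAr Q f \<longleftrightarrow> h' \<cdot>\<^bsub>B\<^esub> fAr F s = fAr F f"
    if "\<psi> = frac_arr X h' Y" "h' \<in> fractions A B F X Y" "s \<in> Ar A" "f \<in> Ar A"
      "src A s = src A f" "tgt A s = X" "tgt A f = Y" for \<psi> h' s f
    using that fAr_fraction [of s] fAr_fraction [of f] cmp_fraction [of "fAr F s" "src A f" X h' Y]
    by (simp add: Q_def serre_projection_fAr)
  have "(THE \<psi>. \<psi> \<in> Hom quotient X Y \<and>
      (\<forall>(s, f) \<in> frac_class X h Y. \<psi> \<cdot>\<^bsub>quotient\<^esub> fAr Q s = fAr Q f)) = \<phi>"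
  proof (rule the_equality)
    show "\<phi> \<in> Hom quotient X Y \<and> (\<forall>(s, f) \<in> frac_class X h Y. \<phi> \<cdot>\<^bsub>quotient\<^esub> fAr Q s = fAr Q f)"
      using h iff [of \<phi> h] by (auto simp: mem_frac_class)
  next
    fix \<psi>
    assume \<psi>: "\<psi> \<in> Hom quotient X Y \<and>
      (\<forall>(s, f) \<in> frac_class X h Y. \<psi> \<cdot>\<^bsub>quotient\<^esub> fAr Q s = fAr Q f)"
    then obtain h' where h': "h' \<in> fractions A B F X Y" "\<psi> = frac_arr X h' Y"
      by (auto elim!: quotient_HomE)
    have "\<psi> \<cdot>\<^bsub>quotient\<^esub> fAr Q s = fAr Q f"
      using \<psi> s by blast
    then have "(s, f) \<in> frac_class X h' Y"
      using s iff [of \<psi> h' s f] h' by (simp add: mem_frac_class)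
    then show "\<psi> = \<phi>"
      using frac_class_unique [OF s, of h'] fractions_Hom [OF h'(1)] h h' by simp
  qed
  moreover have "fOb Q X = X" for X
    by (simp add: Q_def)
  ultimately show ?thesis
    unfolding h(2) by (simp add: serre_factor_def frac_arr_def)
qed

section \<open>Families of classifying functors\<close>

text \<open>Record schemes allow both absolute and relative theories as instances. Only exactness of
  the classifying functors is kept, as the comparison of kernels depends on nothing else.\<close>

locale exact_family =
  fixes R :: "('r, 'x) ring_scheme"
    and U :: "('c, 'd, 'o, 'm, 'r, 'y) cohomology_scheme"
    and F :: "('c, 'd, 'p, 'n, 'r, 'z) cohomology_scheme \<Rightarrow> ('o, 'm, 'p, 'n) cfunctor"
    and S :: "('c, 'd, 'p, 'n, 'r, 'z) cohomology_scheme set"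
  assumes exact: "H \<in> S \<Longrightarrow> exact_functor R (target U) (target H) (F H)"
begin

lemma common_Ker_subset: "H \<in> S \<Longrightarrow> common_Ker U F S \<subseteq> Ker_coh U F H"
  by (auto simp: common_Ker_def)

lemma zero_object_coh_quotient:
  "H \<in> S \<Longrightarrow> is_zero_object (coh_quotient U F H) X \<longleftrightarrow> X \<in> Ker_coh U F H"
  unfolding coh_quotient_def Ker_coh_def by (rule exact_functor.zero_object_quotient [OF exact])

lemma linear_category_coh_quotient: "H \<in> S \<Longrightarrow> linear_category R (coh_quotient U F H)"
  unfolding coh_quotient_def Ker_coh_def by (rule exact_functor.linear_category_quotient [OF exact])

text \<open>X is isomorphic in the target of \<open>U\<close> to a member of the intersection, and
  every \<open>F H'\<close> preserves the isomorphism. The linear structure \<open>K\<close> is a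
  hypothesis, provided in each use by the condition under study.\<close>

lemma common_Ker_of_zero_object:
  assumes H: "H \<in> S" and K: "linear_category R (class_quotient U F S)"
    and X: "is_zero_object (class_quotient U F S) X"
  shows "X \<in> common_Ker U F S"
proof -
  interpret H: exact_functor R "target U" "target H" "F H"
    by (rule exact [OF H])
  \<comment> \<open>Exact functors kill zero objects; this makes identities inverted in the class
    quotient.\<close>
  have "Z \<in> common_Ker U F S" if "is_zero_object (target U) Z" for Z
    using that linear_functor.fOb_zero [OF exact_functor.axioms(3) [OF exact]]
    by (auto simp: common_Ker_def Ker_coh_def functor_kernel_def is_zero_object_def)
  then obtain c
    where c: "is_iso (target U) c" "src (target U) c = X" "tgt (target U) c \<in> common_Ker U F S"
    using H.A.zero_object_serre_quotientD [of "common_Ker U F S" X] K X unfolding class_quotient_def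
    by metis
  have X': "X \<in> Ob (target U)"
    using H.A.iso_Ar [OF c(1)] c(2) by auto
  have "X \<in> Ker_coh U F H'" if H': "H' \<in> S" for H'
  proof -
    interpret H': exact_functor R "target U" "target H'" "F H'"
      by (rule exact [OF H'])
    show ?thesis
      using H'.B.zero_object_iso [OF H'.fAr_iso [OF c(1)]] H.A.iso_Ar [OF c(1)] c(2,3) H' X'
      by (auto simp: common_Ker_def Ker_coh_def functor_kernel_def)
  qed
  with X' show ?thesis
    by (simp add: common_Ker_def)
qed

text \<open>If \<open>F H\<close> kills X, then r_H sends the identity and the zero arrow of X to
  the same arrow, so faithfulness makes X zero in the class quotient. Conversely, equal kernels make
  that quotient the one by the kernel of \<open>F H\<close>, where exactness and faithfulness of the
  factorisation are known.\<close>

lemma exact_faithful_iff: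
  assumes H: "H \<in> S"
  shows "exact_functor R (class_quotient U F S) (target H) (realisation_functor F H) \<and>
      is_faithful (class_quotient U F S) (realisation_functor F H) \<longleftrightarrow>
    Ker_coh U F H = common_Ker U F S" (is "?L \<longleftrightarrow> ?R")
proof
  assume ?L
  then interpret r: exact_functor R "class_quotient U F S" "target H" "realisation_functor F H"
    by blast
  interpret H: exact_functor R "target U" "target H" "F H"
    by (rule exact [OF H])
  have "X \<in> common_Ker U F S" if X: "X \<in> Ker_coh U F H" for X
  proof (rule common_Ker_of_zero_object [OF H r.A.linear_category_axioms])
    let ?K = "class_quotient U F S" and ?r = "realisation_functor F H"
    have [simp]: "X \<in> Ob ?K"
      using X by (simp add: Ker_coh_def functor_kernel_def class_quotient_def serre_quotient_def)
    have "is_zero_object (target H) (fOb ?r X)"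
      using X by (simp add: Ker_coh_def functor_kernel_def realisation_functor_def serre_factor_def)
    then have eq: "fAr ?r (ident ?K X) = fAr ?r (hzero ?K X X)"
      by (simp add: r.fAr_ident r.fAr_hzero r.B.is_zero_object_iff)
    have "inj_on (fAr ?r) (Hom ?K X X)"
      using \<open>?L\<close> unfolding is_faithful_def by simp
    then have "ident ?K X = hzero ?K X X"
      using eq by (simp add: inj_on_eq_iff)
    then show "is_zero_object ?K X"
      by (simp add: r.A.is_zero_object_iff)
  qed
  then show ?R
    using common_Ker_subset [OF H] by blast
next
  assume ?R
  then show ?L
    using exact_functor.exact_functor_factor [OF exact [OF H]]
      exact_functor.faithful_factor [OF exact [OF H]]
    by (simp add: class_quotient_def realisation_functor_def Ker_coh_def)
qed

text \<open>An equivalence E under the universal category gives isomorphisms E X to X in the second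
  quotient; if X is zero in the first, so is E X, hence X. Conversely, equal kernels make the two
  quotients and projections literally equal, and the identity is an equivalence.\<close>

lemma equivalent_iff:
  "(\<forall>H \<in> S. \<forall>H' \<in> S. coh_equivalent R U F H H') \<longleftrightarrow> (\<forall>H \<in> S. Ker_coh U F H = common_Ker U F S)"
proof
  assume L: "\<forall>H \<in> S. \<forall>H' \<in> S. coh_equivalent R U F H H'"
  have "X \<in> Ker_coh U F H'" if H: "H \<in> S" "H' \<in> S" and X: "X \<in> Ker_coh U F H" for H H' X
  proof -
    let ?K = "coh_quotient U F H'"
    obtain E \<theta> where E: "linear_functor R (coh_quotient U F H) ?K E" and
      \<theta>: "nat_iso (target U) ?K (functor_comp E (coh_projection U F H)) (coh_projection U F H') \<theta>"
      using L H unfolding coh_equivalent_def linear_equivalence_def isomorphic_functors_def by meson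
    have "is_zero_object ?K (fOb E X)"
      using linear_functor.fOb_zero [OF E] zero_object_coh_quotient [OF H(1)] X by simp
    moreover have "is_iso ?K (\<theta> X)" "src ?K (\<theta> X) = fOb E X" "tgt ?K (\<theta> X) = X"
      using \<theta> X by (auto simp: nat_iso_def functor_comp_def coh_projection_def serre_projection_def
          Ker_coh_def functor_kernel_def)
    ultimately have "is_zero_object ?K X"
      using linear_category.zero_object_iso [OF linear_category_coh_quotient [OF H(2)], of "\<theta> X"]
      by simp
    then show ?thesis
      using zero_object_coh_quotient [OF H(2)] by simp
  qed
  moreover have "X \<in> Ob (target U)" if "X \<in> Ker_coh U F H" for X H
    using that by (simp add: Ker_coh_def functor_kernel_def)
  ultimately show "\<forall>H \<in> S. Ker_coh U F H = common_Ker U F S"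
    unfolding common_Ker_def by blast
next
  assume eq: "\<forall>H \<in> S. Ker_coh U F H = common_Ker U F S"
  show "\<forall>H \<in> S. \<forall>H' \<in> S. coh_equivalent R U F H H'"
  proof (intro ballI)
    fix H H' assume H: "H \<in> S" and H': "H' \<in> S"
    have "linear_equivalence R (coh_quotient U F H) (coh_quotient U F H) id_functor"
      by (rule linear_equivalence_identity [OF linear_category_coh_quotient [OF H]])
        (simp_all add: id_functor_def)
    moreover have "is_functor (target U) (coh_quotient U F H) (coh_projection U F H)"
      unfolding coh_quotient_def coh_projection_def Ker_coh_def
      by (rule linear_functor.axioms(3) [OF exact_functor.linear_functor_projection [OF exact [OF H]]])
    moreover have "functor_comp id_functor (coh_projection U F H) = coh_projection U F H"
      by (simp add: functor_comp_def id_functor_def coh_projection_def serre_projection_def comp_def)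
    moreover have "coh_quotient U F H' = coh_quotient U F H"
      "coh_projection U F H' = coh_projection U F H"
      using eq H H' by (simp_all add: coh_quotient_def coh_projection_def)
    ultimately show "coh_equivalent R U F H H'"
      unfolding coh_equivalent_def by (metis isomorphic_functors_of_eq)
  qed
qed

text \<open>The canonical functor fixes objects, so a quasi-inverse G comes with isomorphisms G X to
  X in the class quotient. If \<open>F H\<close> kills X, then X is zero in its own quotient, so G X
  and with it X are zero in the class quotient.\<close>

lemma canonical_equivalence_iff:
  assumes H: "H \<in> S"
  shows "linear_equivalence R (class_quotient U F S) (coh_quotient U F H) (canonical_functor U F H) \<longleftrightarrow>
    Ker_coh U F H = common_Ker U F S" (is "?L \<longleftrightarrow> ?R")
proof
  let ?C = "canonical_functor U F H" and ?K = "class_quotient U F S"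
  have C: "fOb ?C X = X" for X
    by (simp add: canonical_functor_def serre_factor_def coh_projection_def serre_projection_def)
  {
    assume ?L
    then obtain G \<theta> where C': "linear_functor R ?K (coh_quotient U F H) ?C" and
      G: "linear_functor R (coh_quotient U F H) ?K G" and
      \<theta>: "nat_iso ?K ?K (functor_comp G ?C) id_functor \<theta>"
      unfolding linear_equivalence_def isomorphic_functors_def by meson
    interpret K: linear_category R ?K
      by (rule linear_functor.axioms(1) [OF C'])
    have "X \<in> common_Ker U F S" if X: "X \<in> Ker_coh U F H" for X
    proof (rule common_Ker_of_zero_object [OF H K.linear_category_axioms])
      have "is_zero_object ?K (fOb G X)"
        using linear_functor.fOb_zero [OF G] zero_object_coh_quotient [OF H] X by simp
      moreover have "X \<in> Ob ?K"
        using X by (simp add: Ker_coh_def functor_kernel_def class_quotient_def serre_quotient_def)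
      then have "is_iso ?K (\<theta> X)" "src ?K (\<theta> X) = fOb G X" "tgt ?K (\<theta> X) = X"
        using \<theta> by (simp_all add: nat_iso_def functor_comp_def id_functor_def C)
      ultimately show "is_zero_object ?K X"
        using K.zero_object_iso [of "\<theta> X"] by simp
    qed
    then show ?R
      using common_Ker_subset [OF H] by blast
  }
  {
    assume ?R
    then have "?K = coh_quotient U F H"
      by (simp add: class_quotient_def coh_quotient_def)
    then show ?L
      using linear_equivalence_identity [OF linear_category_coh_quotient [OF H], of ?C] C
        exact_functor.serre_factor_projection_identity [OF exact [OF H]]
      by (simp add: canonical_functor_def coh_projection_def coh_quotient_def Ker_coh_def)
  }
qed

lemma realisation_functor_projection:
  assumes "H \<in> S" "Ker_coh U F H = common_Ker U F S"
  shows "fOb (realisation_functor F H) (fOb (class_projection U F S) X) = fOb (F H) X"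
    and "f \<in> Ar (target U) \<Longrightarrow>
      fAr (realisation_functor F H) (fAr (class_projection U F S) f) = fAr (F H) f"
  using exact_functor.serre_factor_projection [OF exact [OF assms(1)], of f] assms(2)
  by (simp_all add: realisation_functor_def class_projection_def Ker_coh_def serre_factor_def
      serre_projection_def)

end

section \<open>Realisations and the equivalence of the conditions\<close>

lemma realisation_class_cohomology_iff:
  assumes U: "cohomology R C U" and F: "\<And>H. H \<in> S \<Longrightarrow> classifies R C U H (F H)" and H: "H \<in> S"
  shows "realisation R C H (class_cohomology U F S) (realisation_functor F H) \<longleftrightarrow>
    Ker_coh U F H = common_Ker U F S"
proof -
  interpret exact_family R U F S
    by (rule exact_family.intro) (use F in \<open>simp add: classifies_def\<close>)
  have "cohomology_iso C H (push_forward (target H) (realisation_functor F H) (class_cohomology U F S))"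
    if K: "Ker_coh U F H = common_Ker U F S"
    unfolding cohomology_iso_def
  proof (intro conjI allI)
    fix i
    interpret is_functor "opp C" "target U" "deg U i"
      using U by (simp add: cohomology_def)
    obtain \<theta> where "nat_iso (opp C) (target H) (deg H i) (functor_comp (F H) (deg U i)) \<theta>"
      using F [OF H]
      by (auto simp: classifies_def cohomology_iso_def isomorphic_functors_def push_forward_def)
    \<comment> \<open>With equal kernels, r_H after the projection agrees with \<open>F H\<close> on
      objects and arrows, so the isomorphism given by \<open>classifies\<close> serves
      unchanged.\<close>
    then have "nat_iso (opp C) (target H) (deg H i)
        (functor_comp (realisation_functor F H) (functor_comp (class_projection U F S) (deg U i)))
          \<theta>"
      by (rule nat_iso_cong [OF _ A.category_axioms])
        (simp_all add: functor_comp_def realisation_functor_projection [OF H K])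
    then show "isomorphic_functors (opp C) (target H) (deg H i)
        (deg (push_forward (target H) (realisation_functor F H) (class_cohomology U F S)) i)"
      by (auto simp: isomorphic_functors_def push_forward_def class_cohomology_def)
  qed (simp add: push_forward_def)
  then show ?thesis
    using exact_faithful_iff [OF H]
    by (auto simp: realisation_def class_cohomology_def push_forward_def)
qed

text \<open>As in the absolute case, with one family \<open>\<theta>\<close> for all degrees. It
  stays compatible with boundaries because r_H after the projection also agrees with
  \<open>F H\<close> on the boundary arrows.\<close>

lemma rel_realisation_class_cohomology_iff:
  assumes U: "relative_cohomology R C D U" and F: "\<And>H. H \<in> S \<Longrightarrow> rel_classifies R C D U H (F H)"
    and H: "H \<in> S"
  shows "rel_realisation R C D H (class_rel_cohomology U F S) (realisation_functor F H) \<longleftrightarrow>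
    Ker_coh U F H = common_Ker U F S"
proof -
  interpret exact_family R U F S
    by (rule exact_family.intro) (use F in \<open>simp add: rel_classifies_def\<close>)
  interpret U: relative_cohomology R C D U
    by (rule U)
  let ?P = "pair_category C D" and ?r = "realisation_functor F H" and ?Q = "class_projection U F S"
  have "rel_cohomology_iso C D H (rel_push_forward (target H) ?r (class_rel_cohomology U F S))"
    if K: "Ker_coh U F H = common_Ker U F S"
  proof -
    obtain \<theta>
      where \<theta>: "\<And>n. nat_iso (opp ?P) (target H) (deg H n) (functor_comp (F H) (deg U n)) (\<theta> n)" and
      bd: "\<And>n i j. (i, j) \<in> triples C D \<Longrightarrow>
        \<theta> (Suc n) i \<cdot>\<^bsub>target H\<^esub> bd H n i j = fAr (F H) (bd U n i j) \<cdot>\<^bsub>target H\<^esub> \<theta> n j"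
      using F [OF H]
      by (fastforce simp: rel_classifies_def rel_cohomology_iso_def rel_push_forward_def)
    have "nat_iso (opp ?P) (target H) (deg H n) (functor_comp ?r (functor_comp ?Q (deg U n))) (\<theta> n)" for n
    proof -
      interpret is_functor "opp ?P" "target U" "deg U n"
        by (rule U.functor_deg)
      show ?thesis
        by (rule nat_iso_cong [OF \<theta> A.category_axioms])
          (simp_all add: functor_comp_def realisation_functor_projection [OF H K])
    qed
    moreover have "fAr ?r (fAr ?Q (bd U n i j)) = fAr (F H) (bd U n i j)" if
      "(i, j) \<in> triples C D" for n i j
      using U.bd_in_Hom [OF that] by (simp add: realisation_functor_projection [OF H K])
    ultimately show ?thesis
      using bd unfolding rel_cohomology_iso_def
      by (auto simp: rel_push_forward_def class_rel_cohomology_def intro!: exI [of _ \<theta>])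
  qed
  then show ?thesis
    using exact_faithful_iff [OF H]
    by (auto simp: rel_realisation_def class_rel_cohomology_def rel_push_forward_def)
qed

theorem proposition1p2:
  fixes R :: "('r, 'x) ring_scheme"
    and C :: "('c, 'd) category"
    and U :: "('c, 'd, 'o, 'm, 'r) cohomology"
    and S :: "('c, 'd, 'o, 'm, 'r) cohomology set"
    and F :: "('c, 'd, 'o, 'm, 'r) cohomology \<Rightarrow> ('o, 'm, 'o, 'm) cfunctor"
    and D :: "'d set"
    and U\<^sub>r :: "('d, 'p, 'n, 'r) rel_cohomology"
    and S\<^sub>r :: "('d, 'p, 'n, 'r) rel_cohomology set"
    and F\<^sub>r :: "('d, 'p, 'n, 'r) rel_cohomology \<Rightarrow> ('p, 'n, 'p, 'n) cfunctor"
  assumes "cring R" and "category C"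
  shows
    "(universal_cohomology R C U \<and> (\<forall>H \<in> S. cohomology R C H) \<and>
      (\<forall>H \<in> S. classifies R C U H (F H)) \<longrightarrow>
        ((\<forall>H \<in> S. \<forall>H' \<in> S. coh_equivalent R U F H H') \<longleftrightarrow>
         (\<forall>H \<in> S. realisation R C H (class_cohomology U F S) (realisation_functor F H))) \<and>
        ((\<forall>H \<in> S. realisation R C H (class_cohomology U F S) (realisation_functor F H)) \<longleftrightarrow>
         (\<forall>H \<in> S. linear_equivalence R (class_quotient U F S) (coh_quotient U F H)
                     (canonical_functor U F H)))) \<and>
     (distinguished_monos C D \<and> universal_relative_cohomology R C D U\<^sub>r \<and>
      (\<forall>H \<in> S\<^sub>r. relative_cohomology R C D H) \<and>
      (\<forall>H \<in> S\<^sub>r. rel_classifies R C D U\<^sub>r H (F\<^sub>r H)) \<longrightarrow>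
        ((\<forall>H \<in> S\<^sub>r. \<forall>H' \<in> S\<^sub>r. coh_equivalent R U\<^sub>r F\<^sub>r H H') \<longleftrightarrow>
         (\<forall>H \<in> S\<^sub>r. rel_realisation R C D H (class_rel_cohomology U\<^sub>r F\<^sub>r S\<^sub>r)
                     (realisation_functor F\<^sub>r H))) \<and>
        ((\<forall>H \<in> S\<^sub>r. rel_realisation R C D H (class_rel_cohomology U\<^sub>r F\<^sub>r S\<^sub>r)
                     (realisation_functor F\<^sub>r H)) \<longleftrightarrow>
         (\<forall>H \<in> S\<^sub>r. linear_equivalence R (class_quotient U\<^sub>r F\<^sub>r S\<^sub>r) (coh_quotient U\<^sub>r F\<^sub>r H)
                     (canonical_functor U\<^sub>r F\<^sub>r H))))"
proof (intro conjI impI)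
  assume A: "universal_cohomology R C U \<and> (\<forall>H \<in> S. cohomology R C H) \<and>
    (\<forall>H \<in> S. classifies R C U H (F H))"
  then interpret exact_family R U F S
    by (intro exact_family.intro) (simp add: classifies_def)
  have "cohomology R C U"
    using A by (blast intro: universal_cohomology.axioms)
  then have 2: "realisation R C H (class_cohomology U F S) (realisation_functor F H) \<longleftrightarrow>
      Ker_coh U F H = common_Ker U F S" if "H \<in> S" for H
    by (rule realisation_class_cohomology_iff) (use A that in simp_all)
  show "(\<forall>H \<in> S. \<forall>H' \<in> S. coh_equivalent R U F H H') \<longleftrightarrow>
      (\<forall>H \<in> S. realisation R C H (class_cohomology U F S) (realisation_functor F H))"
    "(\<forall>H \<in> S. realisation R C H (class_cohomology U F S) (realisation_functor F H)) \<longleftrightarrow>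
      (\<forall>H \<in> S. linear_equivalence R (class_quotient U F S) (coh_quotient U F H) (canonical_functor U F H))"
    \<comment> \<open>Each condition has become the equality of \<open>Ker_coh U F H\<close> with
      \<open>common_Ker U F S\<close> for all H in \<open>S\<close>.\<close>
    by (simp_all add: equivalent_iff 2 canonical_equivalence_iff)
next
  assume A: "distinguished_monos C D \<and> universal_relative_cohomology R C D U\<^sub>r \<and>
    (\<forall>H \<in> S\<^sub>r. relative_cohomology R C D H) \<and> (\<forall>H \<in> S\<^sub>r. rel_classifies R C D U\<^sub>r H (F\<^sub>r H))"
  then interpret exact_family R U\<^sub>r F\<^sub>r S\<^sub>r
    by (intro exact_family.intro) (simp add: rel_classifies_def)
  have "relative_cohomology R C D U\<^sub>r"
    using A by (blast intro: universal_relative_cohomology.axioms)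
  then have 2: "rel_realisation R C D H (class_rel_cohomology U\<^sub>r F\<^sub>r S\<^sub>r) (realisation_functor F\<^sub>r H) \<longleftrightarrow>
      Ker_coh U\<^sub>r F\<^sub>r H = common_Ker U\<^sub>r F\<^sub>r S\<^sub>r" if "H \<in> S\<^sub>r" for H
    by (rule rel_realisation_class_cohomology_iff) (use A that in simp_all)
  show "(\<forall>H \<in> S\<^sub>r. \<forall>H' \<in> S\<^sub>r. coh_equivalent R U\<^sub>r F\<^sub>r H H') \<longleftrightarrow>
      (\<forall>H \<in> S\<^sub>r. rel_realisation R C D H (class_rel_cohomology U\<^sub>r F\<^sub>r S\<^sub>r) (realisation_functor F\<^sub>r H))"
    "(\<forall>H \<in> S\<^sub>r. rel_realisation R C D H (class_rel_cohomology U\<^sub>r F\<^sub>r S\<^sub>r) (realisation_functor F\<^sub>r H)) \<longleftrightarrow>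
      (\<forall>H \<in> S\<^sub>r. linear_equivalence R (class_quotient U\<^sub>r F\<^sub>r S\<^sub>r) (coh_quotient U\<^sub>r F\<^sub>r H)
        (canonical_functor U\<^sub>r F\<^sub>r H))"
    by (simp_all add: equivalent_iff 2 canonical_equivalence_iff)
qed

end
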